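(* The inequality $$E_{n-1}(f)_p\le c_r(\delta)\,\gamma_r^*\,\omega_r(f,\delta)_p$$ holds for all $p\in[1,\infty]$, all integers $n\ge 1$ and all $f\in X_p$ in each of the following cases, with constants $c_r(\delta)$ that do not depend on $p$, $n$ or $f$: (1) $\delta=\frac{2\pi}{n}$, every integer $r\ge1$, with $c_r(\delta)=5$; that is, $E_{n-1}(f)_p\le 5\,\gamma_r^*\,\omega_r\left(f,\frac{2\pi}{n}\right)_p$; (2) $\delta=\frac{\alpha\pi}{n}$ for any real $\alpha>1$, every integer $r\ge1$, with $c_r(\delta)=c_\alpha$ a constant depending only on $\alpha$; (3) $\delta=\frac{\pi}{n}$, every integer $r\ge 1$, with constants $c_r(\delta)$ depending only on $r$ and satisfying $c_r(\delta)=O(\sqrt r\,\ln r)$ as $r\to\infty$; (4) $\delta=\frac{\pi}{n}$ with $c_r(\delta)=\frac54$ for $r\in\{1,2\}$ and $c_r(\delta)=\frac{27}{10}$ for $r\in\{3,4\}$; and $\delta=\frac{2\pi}{n}$ with $c_r(\delta)=\frac{17}{16}$ for $r\in\{1,2\}$, $c_r(\delta)=\frac{10}{9}$ for $r\in\{3,4\}$ and $c_r(\delta)=\frac32$ for $r\in\{5,6\}$.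
   Context: For $1\le p<\infty$, $X_p=L_p$ is the space of $2\pi$-periodic functions with $\|f\|_p=\left(\int_{-\pi}^{\pi}|f|^p\right)^{1/p}<\infty$; for $p=\infty$, $X_\infty=C$ is the space of continuous $2\pi$-periodic functions with the uniform norm $\|\cdot\|_\infty$. $T_{n-1}$ is the space of trigonometric polynomials of degree $\le n-1$, and $E_{n-1}(f)_p=\inf_{\tau\in T_{n-1}}\|f-\tau\|_p$. The $r$-th modulus of smoothness is $\omega_r(f,\delta)_p=\sup_{0<h\le\delta}\|\Delta_h^r(f,\cdot)\|_p$, where $\Delta_h^r(f,x)=\sum_{i=0}^r(-1)^i\binom{r}{i}f(x+ih)$. Also $\gamma_r^*=\binom{r}{\lfloor r/2\rfloor}^{-1}$. *)

theory Defs
  imports "HOL-Analysis.Analysis" "HOL-Library.Landau_Symbols"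
begin

text \<open>
  Functions on the circle are represented by everywhere \<open>2\<pi>\<close>-periodic functions
  \<^typ>\<open>real \<Rightarrow> real\<close>.  For \<open>p < \<infinity>\<close> elements of \<open>L\<^sub>p\<close> are given by (Lebesgue measurable)
  representatives; nothing below depends on the choice of representative.
\<close>

definition periodic_2pi :: "(real \<Rightarrow> real) \<Rightarrow> bool" where
  "periodic_2pi f \<longleftrightarrow> (\<forall>x. f (x + 2 * pi) = f x)"

definition Xspace :: "ereal \<Rightarrow> (real \<Rightarrow> real) set" where
  "Xspace p =
     (if p = \<infinity> then {f. periodic_2pi f \<and> continuous_on UNIV f}
      else {f. periodic_2pi f \<and> f \<in> borel_measurable lebesgue \<and>
               set_integrable lebesgue {-pi..pi} (\<lambda>x. \<bar>f x\<bar> powr real_of_ereal p)})"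

text \<open>
  The integral is not normalised by \<open>1 / (2\<pi>)\<close>.  This is meant only for members of
  \<^const>\<open>Xspace\<close>, where the integral exists and the supremum is that of a bounded set.
\<close>

definition Xnorm :: "ereal \<Rightarrow> (real \<Rightarrow> real) \<Rightarrow> real" where
  "Xnorm p f =
     (if p = \<infinity> then (SUP x. \<bar>f x\<bar>)
      else (LINT x:{-pi..pi}|lebesgue. \<bar>f x\<bar> powr real_of_ereal p) powr (1 / real_of_ereal p))"

definition trig_polys :: "nat \<Rightarrow> (real \<Rightarrow> real) set" where
  "trig_polys m =
     {\<tau>. \<exists>a b. \<tau> = (\<lambda>x. \<Sum>k\<le>m. a k * cos (real k * x) + b k * sin (real k * x))}"

definition best_approx :: "nat \<Rightarrow> (real \<Rightarrow> real) \<Rightarrow> ereal \<Rightarrow> real" where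
  "best_approx m f p = (INF \<tau>\<in>trig_polys m. Xnorm p (\<lambda>x. f x - \<tau> x))"

definition fin_diff :: "nat \<Rightarrow> real \<Rightarrow> (real \<Rightarrow> real) \<Rightarrow> real \<Rightarrow> real" where
  "fin_diff r h f x = (\<Sum>i\<le>r. (-1) ^ i * real (r choose i) * f (x + real i * h))"

definition mod_smooth :: "nat \<Rightarrow> (real \<Rightarrow> real) \<Rightarrow> real \<Rightarrow> ereal \<Rightarrow> real" where
  "mod_smooth r f \<delta> p = (SUP h\<in>{0<..\<delta>}. Xnorm p (fin_diff r h f))"

definition gamma_star :: "nat \<Rightarrow> real" where
  "gamma_star r = 1 / real (r choose (r div 2))"

text \<open>
  The Jackson--Stechkin inequality of order \<open>r\<close> with step \<open>\<delta> = a\<pi> / n\<close> and constant \<open>c\<close>,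
  uniformly in \<open>p\<close>, \<open>n\<close> and \<open>f\<close>.
\<close>

definition jackson_stechkin :: "nat \<Rightarrow> real \<Rightarrow> real \<Rightarrow> bool" where
  "jackson_stechkin r a c \<longleftrightarrow>
     (\<forall>p::ereal. \<forall>n::nat. \<forall>f. 1 \<le> p \<longrightarrow> 1 \<le> n \<longrightarrow> f \<in> Xspace p \<longrightarrow>
        best_approx (n - 1) f p \<le> c * gamma_star r * mod_smooth r f (a * pi / real n) p)"

end

theory Submission
  imports Defs
begin

text \<open>
  Let \<open>\<Delta>\<^sub>t\<close> be the central difference of order \<open>2 k\<close> with step \<open>t\<close>, divided by its middle
  coefficient.  It is the identity minus a combination of translations by multiples of \<open>t\<close>, with
  coefficients of modulus at most \<open>1\<close>.  Averaging over \<open>\<bar>t\<bar> \<le> h\<close> with a B-spline as weight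
  gives \<open>f = W f + U f\<close>, where \<open>\<parallel>W f\<parallel> \<le> \<gamma>\<^sup>* \<omega>\<^bsub>2k\<^esub>(f, h)\<close> (\<open>N_averaged_diff_le\<close>) and \<open>U f\<close> is
  smoother than \<open>f\<close>: with the hat function as weight, \<open>(U f)''\<close> is a combination of translates of
  \<open>f\<close> of total mass \<open>8 S\<^sub>k / h\<^sup>2\<close>, where \<open>S\<^sub>k < \<pi>\<^sup>2 / 8\<close> (\<open>odd_ratio_sum_le\<close>).

  The part \<open>U f\<close> is handled by the Bohr--Favard inequality: modulo trigonometric polynomials of
  degree below \<open>n\<close>, integrating an even number \<open>s\<close> of times has norm at most \<open>C / n\<^sup>s\<close>
  (\<open>bohr_favard_multiplier\<close>).  The kernel that realises it is \<open>2 cos (n t)\<close> times a nonnegative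
  cosine series with convex coefficients.  This gives \<open>C = 2\<close> for every \<open>s\<close>, and the sharp
  constants \<open>\<pi>\<^sup>2 / 8\<close> for \<open>s = 2\<close> and \<open>5 \<pi>\<^sup>4 / 384\<close> for \<open>s = 4\<close>.

  Iterating, \<open>f = W f + U W f + U\<^sup>2 W f + \<dots>\<close>, and \<open>U\<^sup>m\<close> is at most \<open>2 q\<^sup>m\<close> in norm modulo
  polynomials, where \<open>q = 8 S\<^sub>k / (n h)\<^sup>2\<close>.  Hence the constant is at most \<open>(1 + q) / (1 - q)\<close>
  (\<open>poly_jackson_general\<close>).  For \<open>h = \<alpha> \<pi> / n\<close> one has \<open>q \<le> 1 / \<alpha>\<^sup>2\<close>, which is below \<open>1\<close>
  uniformly in \<open>k\<close> if \<open>\<alpha> > 1\<close>; and for \<open>\<alpha> = 1\<close> the gap \<open>1 - q\<close> is at least of order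
  \<open>1 / \<surd>k\<close>, so that the constant is \<open>O(\<surd>r)\<close>.  For orders up to four a single averaging step is
  better: choosing a weight with \<open>2 k\<close> derivatives, \<open>(U f)\<^bsup>(2k)\<^esup>\<close> is a combination of differences
  of order \<open>2 k\<close> of \<open>f\<close> and is controlled by \<open>\<omega>\<^bsub>2k\<^esub>(f, h)\<close> itself (\<open>poly_jackson_2\<close>,
  \<open>poly_jackson_4\<close>).

  All of this is independent of the norm as long as it is invariant under translations.  Since both
  sides of the inequality are continuous in \<open>f\<close>, it suffices to treat trigonometric polynomials
  \<open>f\<close>, on which every operator acts by multiplying the coefficients of frequency \<open>j\<close> by a number
  \<open>l j\<close>.  Convolutions become limits of finite combinations of translations, and no integral is
  needed except to define the \<open>L\<^sub>p\<close> norm.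
\<close>

section \<open>Multipliers of trigonometric polynomials under a shift-invariant seminorm\<close>

definition trig_poly :: "nat \<Rightarrow> (nat \<Rightarrow> real) \<Rightarrow> (nat \<Rightarrow> real) \<Rightarrow> real \<Rightarrow> real" where
  "trig_poly M a b = (\<lambda>x. \<Sum>k\<le>M. a k * cos (real k * x) + b k * sin (real k * x))"

lemma trig_poly_in_trig_polys: "trig_poly M a b \<in> trig_polys M"
  by (auto simp: trig_polys_def trig_poly_def)

text \<open>
  All function spaces of the theorem enter the argument only through the following properties.
\<close>

locale shift_invariant_seminorm =
  fixes X :: "(real \<Rightarrow> real) set" and N :: "(real \<Rightarrow> real) \<Rightarrow> real"
  assumes X_add: "f \<in> X \<Longrightarrow> g \<in> X \<Longrightarrow> (\<lambda>x. f x + g x) \<in> X"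
    and X_scale: "f \<in> X \<Longrightarrow> (\<lambda>x. c * f x) \<in> X"
    and X_shift: "f \<in> X \<Longrightarrow> (\<lambda>x. f (x + t)) \<in> X"
    and X_cos: "(\<lambda>x. cos (real k * x)) \<in> X"
    and X_sin: "(\<lambda>x. sin (real k * x)) \<in> X"
    and N_add: "f \<in> X \<Longrightarrow> g \<in> X \<Longrightarrow> N (\<lambda>x. f x + g x) \<le> N f + N g"
    and N_scale: "f \<in> X \<Longrightarrow> N (\<lambda>x. c * f x) = \<bar>c\<bar> * N f"
    and N_shift: "f \<in> X \<Longrightarrow> N (\<lambda>x. f (x + t)) = N f"
    and dense: "f \<in> X \<Longrightarrow> 0 < \<epsilon> \<Longrightarrow> \<exists>M a b. N (\<lambda>x. f x - trig_poly M a b x) < \<epsilon>"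
begin

lemma X_zero: "(\<lambda>x. 0) \<in> X"
  using X_scale[OF X_cos, of 0] by simp

lemma N_zero: "N (\<lambda>x. 0) = 0"
  using N_scale[OF X_cos, of 0] by simp

lemma X_sum: "finite I \<Longrightarrow> (\<And>i. i \<in> I \<Longrightarrow> F i \<in> X) \<Longrightarrow> (\<lambda>x. \<Sum>i\<in>I. F i x) \<in> X"
  by (induction I rule: finite_induct) (auto intro: X_zero X_add)

lemma N_sum:
  assumes "finite I" "\<And>i. i \<in> I \<Longrightarrow> F i \<in> X"
  shows "N (\<lambda>x. \<Sum>i\<in>I. F i x) \<le> (\<Sum>i\<in>I. N (F i))"
  using assms
proof (induction I rule: finite_induct)
  case empty
  then show ?case by (simp add: N_zero)
next
  case (insert i I)
  have "N (\<lambda>x. F i x + (\<Sum>i\<in>I. F i x)) \<le> N (F i) + N (\<lambda>x. \<Sum>i\<in>I. F i x)"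
    by (rule N_add) (use insert in \<open>auto intro: X_sum\<close>)
  with insert show ?case by simp
qed

lemma X_diff: "f \<in> X \<Longrightarrow> g \<in> X \<Longrightarrow> (\<lambda>x. f x - g x) \<in> X"
  using X_add[of f "\<lambda>x. (-1) * g x"] X_scale[of g "-1"] by simp

lemma N_diff_le: "f \<in> X \<Longrightarrow> g \<in> X \<Longrightarrow> N (\<lambda>x. f x - g x) \<le> N f + N g"
  using N_add[of f "\<lambda>x. (-1) * g x"] X_scale[of g "-1"] N_scale[of g "-1"] by simp

lemma N_nonneg: "f \<in> X \<Longrightarrow> 0 \<le> N f"
  using N_diff_le[of f f] N_zero by simp

lemma X_trig_poly: "trig_poly M a b \<in> X"
  unfolding trig_poly_def by (intro X_sum X_add X_scale X_cos X_sin) auto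

definition act :: "(nat \<Rightarrow> real) \<Rightarrow> nat \<Rightarrow> (nat \<Rightarrow> real) \<Rightarrow> (nat \<Rightarrow> real) \<Rightarrow> real \<Rightarrow> real" where
  "act l M a b = trig_poly M (\<lambda>k. l k * a k) (\<lambda>k. l k * b k)"

lemma X_act: "act l M a b \<in> X"
  unfolding act_def by (rule X_trig_poly)

lemma act_add: "act (\<lambda>k. l k + m k) M a b = (\<lambda>x. act l M a b x + act m M a b x)"
  by (auto simp: act_def trig_poly_def sum.distrib[symmetric] algebra_simps)

lemma act_scale: "act (\<lambda>k. c * l k) M a b = (\<lambda>x. c * act l M a b x)"
  by (auto simp: act_def trig_poly_def sum_distrib_left algebra_simps)

lemma act_one: "act (\<lambda>k. 1) M a b = trig_poly M a b"
  by (simp add: act_def)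

lemma act_mult: "act (\<lambda>k. l k * m k) M a b = act l M (\<lambda>k. m k * a k) (\<lambda>k. m k * b k)"
  by (simp add: act_def mult_ac)

lemma act_cos:
  "act (\<lambda>k. cos (real k * t)) M a b = (\<lambda>x. (trig_poly M a b (x + t) + trig_poly M a b (x + - t)) / 2)"
proof -
  have "cos (real k * t) * a k * cos (real k * x) + cos (real k * t) * b k * sin (real k * x) =
      (1/2) * ((a k * cos (real k * (x + t)) + b k * sin (real k * (x + t))) +
       (a k * cos (real k * (x + - t)) + b k * sin (real k * (x + - t))))" for k x
    by (simp add: ring_distribs cos_add sin_add cos_diff sin_diff)
  then show ?thesis
    unfolding act_def trig_poly_def by (simp only: sum_distrib_left[symmetric] sum.distrib) simp
qed

lemma N_act_add: "N (act (\<lambda>k. l k + m k) M a b) \<le> N (act l M a b) + N (act m M a b)"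
  unfolding act_add by (intro N_add X_act)

lemma N_act_scale: "N (act (\<lambda>k. c * l k) M a b) = \<bar>c\<bar> * N (act l M a b)"
  unfolding act_scale by (intro N_scale X_act)

lemma N_act_sum:
  assumes "finite I"
  shows "N (act (\<lambda>k. \<Sum>i\<in>I. l i k) M a b) \<le> (\<Sum>i\<in>I. N (act (l i) M a b))"
  using assms
proof (induction I rule: finite_induct)
  case empty
  then show ?case by (simp add: act_def trig_poly_def N_zero)
next
  case (insert i I)
  with N_act_add[of "l i" "\<lambda>k. \<Sum>i\<in>I. l i k" M a b] show ?case by simp
qed

text \<open>
  On trigonometric polynomials of a fixed degree only finitely many entries of the multiplier
  matter, so that the seminorm is continuous under pointwise convergence of multipliers.
\<close>

lemma N_act_tendsto:
  assumes "\<And>k. (\<lambda>i. l i k) \<longlonglongrightarrow> m k"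
  shows "(\<lambda>i. N (act (l i) M a b)) \<longlonglongrightarrow> N (act m M a b)"
proof -
  define Q where "Q k = \<bar>a k\<bar> * N (\<lambda>x. cos (real k * x)) + \<bar>b k\<bar> * N (\<lambda>x. sin (real k * x))" for k
  have small: "N (act d M a b) \<le> (\<Sum>k\<le>M. \<bar>d k\<bar> * Q k)" for d
  proof -
    have "N (act d M a b) \<le>
        (\<Sum>k\<le>M. N (\<lambda>x. d k * a k * cos (real k * x) + d k * b k * sin (real k * x)))"
      unfolding act_def trig_poly_def
      by (rule N_sum) (auto intro!: X_add X_scale X_cos X_sin)
    also have "\<dots> \<le> (\<Sum>k\<le>M. \<bar>d k\<bar> * Q k)"
    proof (rule sum_mono)
      fix k
      have "N (\<lambda>x. d k * a k * cos (real k * x) + d k * b k * sin (real k * x))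
          \<le> N (\<lambda>x. d k * a k * cos (real k * x)) + N (\<lambda>x. d k * b k * sin (real k * x))"
        by (intro N_add X_scale X_cos X_sin)
      also have "\<dots> = \<bar>d k\<bar> * Q k"
        unfolding N_scale[OF X_cos] N_scale[OF X_sin] Q_def by (simp add: abs_mult algebra_simps)
      finally show "N (\<lambda>x. d k * a k * cos (real k * x) + d k * b k * sin (real k * x))
          \<le> \<bar>d k\<bar> * Q k" .
    qed
    finally show ?thesis .
  qed
  have close: "\<bar>N (act (l i) M a b) - N (act m M a b)\<bar> \<le> (\<Sum>k\<le>M. \<bar>l i k - m k\<bar> * Q k)" for i
  proof -
    have "N (act (l i) M a b) \<le> N (act (\<lambda>k. l i k - m k) M a b) + N (act m M a b)"
      using N_act_add[of "\<lambda>k. l i k - m k" m] by simp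
    moreover have "N (act m M a b) \<le> N (act (\<lambda>k. m k - l i k) M a b) + N (act (l i) M a b)"
      using N_act_add[of "\<lambda>k. m k - l i k" "l i"] by simp
    ultimately show ?thesis
      using small[of "\<lambda>k. l i k - m k"] small[of "\<lambda>k. m k - l i k"]
      by (simp add: abs_minus_commute)
  qed
  have "(\<lambda>i. \<Sum>k\<le>M. \<bar>l i k - m k\<bar> * Q k) \<longlonglongrightarrow> (\<Sum>k\<le>M. \<bar>m k - m k\<bar> * Q k)"
    by (intro tendsto_intros assms)
  then have lim: "(\<lambda>i. \<Sum>k\<le>M. \<bar>l i k - m k\<bar> * Q k) \<longlonglongrightarrow> 0" by simp
  have "(\<lambda>i. N (act (l i) M a b) - N (act m M a b)) \<longlonglongrightarrow> 0"
    by (rule Lim_null_comparison[OF _ lim]) (use close in auto)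
  then show ?thesis by (simp add: LIM_zero_iff)
qed

definition mult_bound :: "(nat \<Rightarrow> real) \<Rightarrow> real \<Rightarrow> bool" where
  "mult_bound l C \<longleftrightarrow> (\<forall>M a b. N (act l M a b) \<le> C * N (trig_poly M a b))"

lemma mult_boundD: "mult_bound l C \<Longrightarrow> N (act l M a b) \<le> C * N (trig_poly M a b)"
  by (simp add: mult_bound_def)

lemma mult_bound_mono: "mult_bound l C \<Longrightarrow> C \<le> D \<Longrightarrow> mult_bound l D"
  unfolding mult_bound_def by (meson N_nonneg X_trig_poly mult_right_mono order_trans)

lemma mult_bound_add:
  "mult_bound l C \<Longrightarrow> mult_bound m D \<Longrightarrow> mult_bound (\<lambda>k. l k + m k) (C + D)"
  unfolding mult_bound_def distrib_right
  by (blast intro: order_trans[OF N_act_add] add_mono)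

lemma mult_bound_scale: "mult_bound l C \<Longrightarrow> mult_bound (\<lambda>k. c * l k) (\<bar>c\<bar> * C)"
  unfolding mult_bound_def N_act_scale by (simp add: mult.assoc mult_left_mono)

lemma mult_bound_sum:
  assumes "finite I" "\<And>i. i \<in> I \<Longrightarrow> mult_bound (l i) (C i)"
  shows "mult_bound (\<lambda>k. \<Sum>i\<in>I. l i k) (\<Sum>i\<in>I. C i)"
  using assms
proof (induction I rule: finite_induct)
  case empty
  then show ?case by (simp add: mult_bound_def act_def trig_poly_def N_zero)
next
  case (insert i I)
  then have "mult_bound (\<lambda>k. l i k + (\<Sum>i\<in>I. l i k)) (C i + (\<Sum>i\<in>I. C i))"
    by (intro mult_bound_add) auto
  with insert show ?case by simp
qed

lemma mult_bound_one: "mult_bound (\<lambda>k. 1) 1"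
  by (simp add: mult_bound_def act_one)

lemma mult_bound_mult:
  assumes "mult_bound l C" "mult_bound m D" "0 \<le> C"
  shows "mult_bound (\<lambda>k. l k * m k) (C * D)"
  unfolding mult_bound_def
proof (intro allI)
  fix M a b
  have "N (act (\<lambda>k. l k * m k) M a b) \<le> C * N (act m M a b)"
    unfolding act_mult using mult_boundD[OF assms(1)] by (simp add: act_def)
  also have "\<dots> \<le> C * (D * N (trig_poly M a b))"
    using mult_boundD[OF assms(2)] assms(3) by (intro mult_left_mono)
  finally show "N (act (\<lambda>k. l k * m k) M a b) \<le> C * D * N (trig_poly M a b)"
    by (simp add: mult.assoc)
qed

lemma mult_bound_power:
  assumes "mult_bound l C" "0 \<le> C"
  shows "mult_bound (\<lambda>k. l k ^ m) (C ^ m)"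
proof (induction m)
  case 0
  show ?case using mult_bound_one by simp
next
  case (Suc m)
  show ?case using mult_bound_mult[OF assms(1) Suc assms(2)] by simp
qed

lemma mult_bound_limit:
  assumes "\<And>k. (\<lambda>i. l i k) \<longlonglongrightarrow> m k" "C \<longlonglongrightarrow> D" "\<And>i. mult_bound (l i) (C i)"
  shows "mult_bound m D"
  unfolding mult_bound_def
proof (intro allI)
  fix M a b
  show "N (act m M a b) \<le> D * N (trig_poly M a b)"
    by (rule LIMSEQ_le[OF N_act_tendsto[OF assms(1)] tendsto_mult[OF assms(2) tendsto_const]])
       (use mult_boundD[OF assms(3)] in blast)
qed

text \<open>The average of the translations by \<open>t\<close> and \<open>- t\<close>.\<close>

lemma mult_bound_cos: "mult_bound (\<lambda>k. cos (real k * t)) 1"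
  unfolding mult_bound_def
proof (intro allI)
  fix M a b
  let ?f = "trig_poly M a b"
  have "N (act (\<lambda>k. cos (real k * t)) M a b) = N (\<lambda>x. (1/2) * (?f (x + t) + ?f (x + - t)))"
    by (simp add: act_cos)
  also have "\<dots> = (1/2) * N (\<lambda>x. ?f (x + t) + ?f (x + - t))"
    by (subst N_scale) (intro X_add X_shift X_trig_poly, simp)
  also have "N (\<lambda>x. ?f (x + t) + ?f (x + - t)) \<le> N (\<lambda>x. ?f (x + t)) + N (\<lambda>x. ?f (x + - t))"
    by (intro N_add X_shift X_trig_poly)
  also have "\<dots> = 2 * N ?f"
    unfolding N_shift[OF X_trig_poly] by simp
  finally show "N (act (\<lambda>k. cos (real k * t)) M a b) \<le> 1 * N ?f" by simp
qed

lemma mult_bound_cos_sum: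
  assumes "finite I"
  shows "mult_bound (\<lambda>k. \<Sum>i\<in>I. w i * cos (real k * t i)) (\<Sum>i\<in>I. \<bar>w i\<bar>)"
proof (rule mult_bound_sum[OF assms])
  show "mult_bound (\<lambda>k. w i * cos (real k * t i)) \<bar>w i\<bar>" for i
    using mult_bound_scale[OF mult_bound_cos] by simp
qed

end

section \<open>Averages of cosines\<close>

definition sinc :: "real \<Rightarrow> real" where
  "sinc x = (if x = 0 then 1 else sin x / x)"

text \<open>
  The Fourier transforms of the even probability measures on \<open>[-h, h]\<close>.  Generating them from
  point masses keeps integration out of the argument.
\<close>

inductive_set averages :: "real \<Rightarrow> (real \<Rightarrow> real) set" for h :: real where
  point: "\<bar>t\<bar> \<le> h \<Longrightarrow> (\<lambda>y. cos (y * t)) \<in> averages h"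
| mix: "p \<in> averages h \<Longrightarrow> q \<in> averages h \<Longrightarrow> 0 \<le> s \<Longrightarrow> s \<le> 1 \<Longrightarrow>
    (\<lambda>y. s * p y + (1 - s) * q y) \<in> averages h"
| limit: "(\<And>i::nat. P i \<in> averages h) \<Longrightarrow> (\<And>y. (\<lambda>i. P i y) \<longlonglongrightarrow> p y) \<Longrightarrow> p \<in> averages h"

lemma averages_mono: "p \<in> averages h \<Longrightarrow> h \<le> h' \<Longrightarrow> p \<in> averages h'"
  by (induction rule: averages.induct) (auto intro: averages.intros)

text \<open>Convolution of the underlying measures.\<close>

lemma averages_mult:
  assumes "p \<in> averages h" "q \<in> averages h'"
  shows "(\<lambda>y. p y * q y) \<in> averages (h + h')"
  using assms(1)
proof (induction rule: averages.induct)
  case (point t)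
  show ?case
    using assms(2)
  proof (induction rule: averages.induct)
    case (point t')
    have "(\<lambda>y. 1/2 * cos (y * (t - t')) + (1 - 1/2) * cos (y * (t + t'))) \<in> averages (h + h')"
      using \<open>\<bar>t\<bar> \<le> h\<close> \<open>\<bar>t'\<bar> \<le> h'\<close> by (intro averages.mix averages.point) auto
    also have "(\<lambda>y. 1/2 * cos (y * (t - t')) + (1 - 1/2) * cos (y * (t + t')))
        = (\<lambda>y. cos (y * t) * cos (y * t'))"
      by (auto simp: algebra_simps cos_add cos_diff)
    finally show ?case .
  next
    case (mix p q s)
    from averages.mix[OF mix.IH mix.hyps(3,4)] show ?case by (simp add: algebra_simps)
  next
    case (limit P p)
    show ?case
      by (rule averages.limit[OF limit.IH tendsto_mult]) (auto intro: limit.hyps)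
  qed
next
  case (mix p q s)
  from averages.mix[OF mix.IH mix.hyps(3,4)] show ?case by (simp add: algebra_simps)
next
  case (limit P p)
  show ?case
    by (rule averages.limit[OF limit.IH tendsto_mult]) (auto intro: limit.hyps)
qed

text \<open>
  The uniform distribution on \<open>[-h, h]\<close>, as the convolution of the fair two-point
  distributions on \<open>\<plusminus>h / 2\<^sup>m\<close> (Viete's product).
\<close>

lemma sinc_eq_prod_cos: "sinc x = sinc (x / 2 ^ M) * (\<Prod>m<M. cos (x / 2 ^ Suc m))"
proof (induction M)
  case (Suc M)
  have "sinc y = sinc (y / 2) * cos (y / 2)" for y :: real
    using sin_double[of "y / 2"] by (simp add: sinc_def)
  from this[of "x / 2 ^ M"] Suc show ?case by (simp add: mult_ac)
qed simp

lemma sinc_tendsto_1: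
  assumes "e \<longlonglongrightarrow> 0"
  shows "(\<lambda>i. sinc (e i)) \<longlonglongrightarrow> 1"
proof -
  have "isCont sinc 0"
    unfolding isCont_def
  proof (rule Lim_transform_eventually)
    show "((\<lambda>x. sin x / x) \<longlongrightarrow> sinc 0) (at (0::real))"
      using DERIV_sin[of 0] by (simp add: sinc_def has_field_derivative_iff)
    show "\<forall>\<^sub>F x in at (0::real). sin x / x = sinc x"
      by (auto simp: eventually_at_filter sinc_def)
  qed
  from isCont_tendsto_compose[OF this assms] show ?thesis by (simp add: sinc_def)
qed

lemma averages_sinc:
  assumes "0 \<le> h"
  shows "(\<lambda>y. sinc (y * h)) \<in> averages h"
proof (rule averages.limit)
  fix M
  have "(\<lambda>y. \<Prod>m<M. cos (y * h / 2 ^ Suc m)) \<in> averages (h * (1 - 1 / 2 ^ M))"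
  proof (induction M)
    case 0
    show ?case using averages.point[of 0 0] by simp
  next
    case (Suc M)
    have "(\<lambda>y. cos (y * (h / 2 ^ Suc M))) \<in> averages (h / 2 ^ Suc M)"
      using assms by (intro averages.point) auto
    from averages_mult[OF Suc this] show ?case
      by (simp add: field_simps)
  qed
  then show "(\<lambda>y. \<Prod>m<M. cos (y * h / 2 ^ Suc m)) \<in> averages h"
    by (rule averages_mono) (use assms in \<open>simp add: mult_left_le\<close>)
next
  fix y
  have "(\<lambda>M. y * h * (1 / 2) ^ M) \<longlonglongrightarrow> y * h * 0"
    by (intro tendsto_intros LIMSEQ_power_zero) simp
  then have 1: "(\<lambda>M. sinc (y * h / 2 ^ M)) \<longlonglongrightarrow> 1"
    by (intro sinc_tendsto_1) (simp add: power_one_over)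
  have lim: "(\<lambda>M. sinc (y * h) / sinc (y * h / 2 ^ M)) \<longlonglongrightarrow> sinc (y * h) / 1"
    by (intro tendsto_intros 1) simp
  have "\<forall>\<^sub>F M in sequentially. sinc (y * h / 2 ^ M) \<noteq> 0"
    using tendsto_imp_eventually_ne[OF 1] by simp
  then have "\<forall>\<^sub>F M in sequentially.
      sinc (y * h) / sinc (y * h / 2 ^ M) = (\<Prod>m<M. cos (y * h / 2 ^ Suc m))"
  proof eventually_elim
    case (elim M)
    then show ?case using sinc_eq_prod_cos[of "y * h" M] by simp
  qed
  with lim show "(\<lambda>M. \<Prod>m<M. cos (y * h / 2 ^ Suc m)) \<longlonglongrightarrow> sinc (y * h)"
    by (simp add: Lim_transform_eventually)
qed

text \<open>
  Averaging with the hat function and with the cubic B-spline.  The powers of the sine are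
  multipliers of differences with steps \<open>h\<close> and \<open>h / 2\<close>, while the powers of \<open>y\<close> in the
  denominators provide the two or four derivatives that the Bohr--Favard inequality consumes.
\<close>

lemma averages_sinc_power2:
  assumes "0 \<le> h"
  shows "(\<lambda>y. sinc (y * (h / 2)) ^ 2) \<in> averages h"
  using averages_mult[OF averages_sinc averages_sinc, of "h/2" "h/2"] assms
  by (simp add: power2_eq_square)

lemma averages_sinc_power4:
  assumes "0 \<le> h"
  shows "(\<lambda>y. sinc (y * (h / 4)) ^ 4) \<in> averages h"
  using averages_mult[OF averages_sinc_power2 averages_sinc_power2, of "h/2" "h/2"] assms
  by (simp add: power_add[symmetric])

section \<open>Odd cosine polynomials approximating the sign of the cosine\<close>

text \<open>
  The parity of the frequencies is kept track of because products of cosines of odd frequencies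
  are needed, and a product of three of them is again odd.
\<close>

inductive_set cos_span :: "bool \<Rightarrow> (real \<Rightarrow> real) set" for e :: bool where
  cos: "even (m::int) = e \<Longrightarrow> (\<lambda>x. cos (of_int m * x)) \<in> cos_span e"
| add: "p \<in> cos_span e \<Longrightarrow> q \<in> cos_span e \<Longrightarrow> (\<lambda>x. p x + q x) \<in> cos_span e"
| scale: "p \<in> cos_span e \<Longrightarrow> (\<lambda>x. c * p x) \<in> cos_span e"

lemma cos_span_mult:
  assumes "p \<in> cos_span e" "q \<in> cos_span e'"
  shows "(\<lambda>x. p x * q x) \<in> cos_span (e = e')"
  using assms(1)
proof (induction rule: cos_span.induct)
  case (cos m)
  show ?case
    using assms(2)
  proof (induction rule: cos_span.induct)
    case (cos m')
    have "(\<lambda>x. 1/2 * (cos (of_int (m - m') * x) + cos (of_int (m + m') * x))) \<in> cos_span (e = e')"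
      using \<open>even m = e\<close> \<open>even m' = e'\<close> by (intro cos_span.intros) auto
    also have "(\<lambda>x::real. 1/2 * (cos (of_int (m - m') * x) + cos (of_int (m + m') * x)))
        = (\<lambda>x. cos (of_int m * x) * cos (of_int m' * x))"
      by (auto simp: left_diff_distrib distrib_right cos_add cos_diff fun_eq_iff)
    finally show ?case .
  next
    case (add p q)
    from cos_span.add[OF add.IH] show ?case by (simp add: algebra_simps)
  next
    case (scale p c)
    from cos_span.scale[OF scale.IH, of c] show ?case by (simp add: algebra_simps)
  qed
next
  case (add p q)
  from cos_span.add[OF add.IH] show ?case by (simp add: algebra_simps)
next
  case (scale p c)
  from cos_span.scale[OF scale.IH, of c] show ?case by (simp add: algebra_simps)
qed

lemma cos_span_odd_sum:
  assumes "p \<in> cos_span False"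
  obtains P c where "\<And>x. p x = (\<Sum>l<P. c l * cos (real (2 * l + 1) * x))"
proof -
  have "\<exists>P c. (\<forall>l\<ge>P. c l = 0) \<and> (\<forall>x. p x = (\<Sum>l<P. c l * cos (real (2 * l + 1) * x)))"
    using assms
  proof (induction rule: cos_span.induct)
    case (cos m)
    then have "odd m" by simp
    then obtain j where j: "\<bar>m\<bar> = 2 * j + 1" by (metis dvd_abs_iff oddE)
    then have "0 \<le> j" by simp
    define l where "l = nat j"
    have l: "real (2 * l + 1) = \<bar>of_int m\<bar>"
      using j \<open>0 \<le> j\<close> by (simp add: l_def flip: of_int_abs)
    have "cos (of_int m * x) = cos (real (2 * l + 1) * x)" for x
      unfolding l by (cases "m \<ge> 0") auto
    then have "cos (of_int m * x) =
        (\<Sum>i<Suc l. (if i = l then 1 else 0) * cos (real (2 * i + 1) * x))" for x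
      by simp
    then show ?case
      by (intro exI[of _ "Suc l"] exI[of _ "\<lambda>i. if i = l then 1 else 0"]) auto
  next
    case (add p q)
    then obtain P c P' c' where
      c: "\<forall>l\<ge>P. c l = 0" "\<forall>x. p x = (\<Sum>l<P. c l * cos (real (2 * l + 1) * x))" and
      c': "\<forall>l\<ge>P'. c' l = 0" "\<forall>x. q x = (\<Sum>l<P'. c' l * cos (real (2 * l + 1) * x))"
      by blast
    have "p x = (\<Sum>l<P+P'. c l * cos (real (2 * l + 1) * x))" for x
      using c by (simp add: sum.mono_neutral_left[of "{..<P+P'}" "{..<P}"])
    moreover have "q x = (\<Sum>l<P+P'. c' l * cos (real (2 * l + 1) * x))" for x
      using c' by (simp add: sum.mono_neutral_left[of "{..<P+P'}" "{..<P'}"])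
    ultimately have "p x + q x = (\<Sum>l<P+P'. (c l + c' l) * cos (real (2 * l + 1) * x))" for x
      by (simp add: sum.distrib algebra_simps)
    then show ?case using c(1) c'(1)
      by (intro exI[of _ "P+P'"] exI[of _ "\<lambda>l. c l + c' l"]) auto
  next
    case (scale p d)
    then obtain P c where
      c: "\<forall>l\<ge>P. c l = 0" "\<forall>x. p x = (\<Sum>l<P. c l * cos (real (2 * l + 1) * x))"
      by blast
    then show ?case
      by (intro exI[of _ P] exI[of _ "\<lambda>l. d * c l"]) (simp add: sum_distrib_left mult_ac)
  qed
  with that show thesis by blast
qed

text \<open>
  The classical iteration \<open>s \<mapsto> s + (x\<^sup>2 - s\<^sup>2) / 2\<close> towards \<open>\<bar>x\<bar>\<close>, divided by \<open>x\<close>.  It never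
  exceeds \<open>1\<close> on \<open>[0, 1]\<close>, which is what the comparison with the Euler splines needs.
\<close>

primrec sgn_approx :: "nat \<Rightarrow> real \<Rightarrow> real" where
  "sgn_approx 0 x = 0"
| "sgn_approx (Suc m) x = sgn_approx m x + x * (1 - sgn_approx m x * sgn_approx m x) / 2"

lemma sgn_approx_minus: "sgn_approx m (- x) = - sgn_approx m x"
  by (induction m) auto

lemma sgn_approx_bounds:
  assumes "0 \<le> x" "x \<le> 1"
  shows "0 \<le> sgn_approx m x \<and> sgn_approx m x \<le> 1 \<and> 1 - sgn_approx m x \<le> (1 - x / 2) ^ m"
proof (induction m)
  case (Suc m)
  define p where "p = sgn_approx m x"
  have p: "0 \<le> p" "p \<le> 1" "1 - p \<le> (1 - x / 2) ^ m" using Suc by (auto simp: p_def)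
  have eq: "1 - sgn_approx (Suc m) x = (1 - p) * (1 - x * (1 + p) / 2)"
    unfolding sgn_approx.simps p_def[symmetric] by (simp add: field_simps)
  have "x * (1 + p) \<le> 1 * 2" using assms p by (intro mult_mono) auto
  moreover have "x \<le> x * (1 + p)" using assms p by (simp add: mult_left_mono[of 1 "1+p" x, simplified])
  ultimately have b: "0 \<le> 1 - x * (1 + p) / 2" "1 - x * (1 + p) / 2 \<le> 1 - x / 2" by auto
  have "0 \<le> 1 - sgn_approx (Suc m) x" unfolding eq using p b by simp
  moreover have "1 - sgn_approx (Suc m) x \<le> (1 - x / 2) ^ m * (1 - x / 2)"
    unfolding eq using p b by (intro mult_mono) auto
  moreover have "0 \<le> sgn_approx (Suc m) x"
  proof -
    have "p * p \<le> 1" using p by (simp add: mult_le_one)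
    then show ?thesis using p assms by (simp add: p_def[symmetric])
  qed
  ultimately show ?case by (simp add: mult_ac)
qed simp

lemma sgn_approx_abs:
  assumes "\<bar>x\<bar> \<le> 1"
  shows "\<bar>x\<bar> \<le> x * sgn_approx m x + 2 / real (Suc m)"
proof -
  have pos: "y \<le> y * sgn_approx m y + 2 / real (Suc m)" if y: "0 \<le> y" "y \<le> 1" for y
  proof -
    define z where "z = y / 2"
    have z: "0 \<le> z" "z \<le> 1" using y by (auto simp: z_def)
    have "(1 - z) ^ m * (1 + real m * z) \<le> (1 - z) ^ m * (1 + z) ^ m"
      using z by (intro mult_left_mono Bernoulli_inequality) auto
    also have "\<dots> = (1 - z * z) ^ m" by (simp add: power_mult_distrib[symmetric] algebra_simps)
    also have "\<dots> \<le> 1" using z by (intro power_le_one) (auto simp: mult_le_one)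
    finally have *: "(1 - z) ^ m * (1 + real m * z) \<le> 1" .
    have "z * (1 - z) ^ m * (1 + real m) \<le> (1 - z) ^ m * (1 + real m * z)"
      using z by (simp add: algebra_simps mult_left_le_one_le)
    with * have "z * (1 - z) ^ m * (1 + real m) \<le> 1" by simp
    then have "y * (1 - z) ^ m \<le> 2 / real (Suc m)"
      by (simp add: z_def field_simps)
    moreover have "y * (1 - sgn_approx m y) \<le> y * (1 - z) ^ m"
      using sgn_approx_bounds[OF y, of m] y by (intro mult_left_mono) (auto simp: z_def)
    ultimately show ?thesis by (simp add: algebra_simps)
  qed
  show ?thesis
  proof (cases "0 \<le> x")
    case True
    then show ?thesis using pos[of x] assms by simp
  next
    case False
    then show ?thesis using pos[of "-x"] assms by (simp add: sgn_approx_minus)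
  qed
qed

lemma sgn_approx_cos_span: "(\<lambda>x. sgn_approx m (cos x)) \<in> cos_span False"
proof (induction m)
  case 0
  show ?case using cos_span.scale[OF cos_span.cos[of 1 False], of 0] by simp
next
  case (Suc m)
  let ?p = "\<lambda>x. sgn_approx m (cos x)"
  have c: "(\<lambda>x. cos x) \<in> cos_span False" using cos_span.cos[of 1 False] by simp
  have "(\<lambda>x. cos x * (?p x * ?p x)) \<in> cos_span False"
    using cos_span_mult[OF c cos_span_mult[OF Suc Suc]] by simp
  from cos_span.add[OF Suc cos_span.add[OF cos_span.scale[OF c, of "1/2"] cos_span.scale[OF this, of "-1/2"]]]
  show ?case by (simp add: algebra_simps diff_divide_distrib)
qed

lemma double_integral_le:
  fixes F F' F'' :: "real \<Rightarrow> real"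
  assumes 1: "\<And>x. (F has_real_derivative F' x) (at x)" "\<And>x. (F' has_real_derivative F'' x) (at x)"
    and 2: "\<And>x. 0 \<le> x \<Longrightarrow> x \<le> pi / 2 \<Longrightarrow> F'' x \<le> 0"
    and 3: "F' 0 = 0" "F (pi / 2) = 0" and x: "0 \<le> x" "x \<le> pi / 2"
  shows "0 \<le> F x"
proof -
  have "F' y \<le> 0" if y: "0 \<le> y" "y \<le> pi / 2" for y
    using DERIV_nonpos_imp_nonincreasing[OF y(1), of F'] 1 2 3 y by (metis order_trans)
  then have "F (pi / 2) \<le> F x"
    using DERIV_nonpos_imp_nonincreasing[OF x(2), of F] 1 x by (metis order_trans)
  with 3 show ?thesis by simp
qed

lemma cos_odd_half_pi: "cos (real (2 * l + 1) * (pi / 2)) = 0"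
proof -
  have "real (2 * l + 1) * (pi / 2) = pi / 2 + real l * pi" by (simp add: field_simps)
  then show ?thesis by (simp only: cos_add) simp
qed

text \<open>
  Comparison with the Euler splines.  Integrating the given sum twice, with vanishing derivative
  at \<open>0\<close> and vanishing value at \<open>\<pi> / 2\<close>, divides the coefficients by \<open>(2 l + 1)\<^sup>2\<close> and
  preserves upper bounds.  Applied to the constant \<open>1\<close>, two and four integrations give at \<open>0\<close> the
  Favard constants \<open>\<pi>\<^sup>2 / 8\<close> and \<open>5 \<pi>\<^sup>4 / 384\<close>.
\<close>

lemma odd_cos_sum_integrals:
  fixes c :: "nat \<Rightarrow> real"
  assumes le1: "\<And>x. 0 \<le> x \<Longrightarrow> x \<le> pi / 2 \<Longrightarrow> (\<Sum>l<P. c l * cos (real (2 * l + 1) * x)) \<le> 1"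
  shows "(\<Sum>l<P. c l / real (2 * l + 1) ^ 2) \<le> pi ^ 2 / 8"
    and "(\<Sum>l<P. c l / real (2 * l + 1) ^ 4) \<le> 5 * pi ^ 4 / 384"
proof -
  define C where "C j x = (\<Sum>l<P. c l / real (2 * l + 1) ^ j * cos (real (2 * l + 1) * x))" for j x
  define D where "D j x = (\<Sum>l<P. c l / real (2 * l + 1) ^ j * sin (real (2 * l + 1) * x))" for j x
  have derC: "(C (Suc j) has_real_derivative - D j x) (at x)" for j x
    unfolding C_def D_def
    by (rule derivative_eq_intros refl | simp)+
       (auto simp: sum_negf[symmetric] field_simps intro!: sum.cong)
  have derD: "(D (Suc j) has_real_derivative C j x) (at x)" for j x
    unfolding C_def D_def
    by (rule derivative_eq_intros refl | simp)+
       (auto simp: field_simps intro!: sum.cong)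
  have C0: "C 0 x \<le> 1" if "0 \<le> x" "x \<le> pi / 2" for x
    using le1[OF that] by (simp add: C_def)
  have Cpi: "C j (pi / 2) = 0" for j
    unfolding C_def cos_odd_half_pi by simp
  have D0: "D j 0 = 0" for j by (simp add: D_def)
  have C2: "C 2 x \<le> pi ^ 2 / 8 - x ^ 2 / 2" if x: "0 \<le> x" "x \<le> pi / 2" for x
  proof -
    have "0 \<le> pi ^ 2 / 8 - x ^ 2 / 2 - C 2 x"
    proof (rule double_integral_le[where F' = "\<lambda>x. - x + D 1 x" and F'' = "\<lambda>x. - 1 + C 0 x", OF _ _ _ _ _ x])
      show "((\<lambda>x. pi ^ 2 / 8 - x ^ 2 / 2 - C 2 x) has_real_derivative - x + D 1 x) (at x)" for x
        using derC[of 1 x] by (auto intro!: derivative_eq_intros simp: numeral_2_eq_2)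
      show "((\<lambda>x. - x + D 1 x) has_real_derivative - 1 + C 0 x) (at x)" for x
        using derD[of 0 x] by (auto intro!: derivative_eq_intros)
    qed (use C0 Cpi D0 in \<open>auto simp: power_divide\<close>)
    then show ?thesis by simp
  qed
  have C4: "C 4 x \<le> 5 * pi ^ 4 / 384 - pi ^ 2 * x ^ 2 / 16 + x ^ 4 / 24" if x: "0 \<le> x" "x \<le> pi / 2" for x
  proof -
    have "0 \<le> 5 * pi ^ 4 / 384 - pi ^ 2 * x ^ 2 / 16 + x ^ 4 / 24 - C 4 x"
    proof (rule double_integral_le[where F' = "\<lambda>x. - (pi ^ 2 * x / 8) + x ^ 3 / 6 + D 3 x"
          and F'' = "\<lambda>x. - (pi ^ 2 / 8) + x ^ 2 / 2 + C 2 x", OF _ _ _ _ _ x])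
      show "((\<lambda>x. 5 * pi ^ 4 / 384 - pi ^ 2 * x ^ 2 / 16 + x ^ 4 / 24 - C 4 x) has_real_derivative
          - (pi ^ 2 * x / 8) + x ^ 3 / 6 + D 3 x) (at x)" for x
        using derC[of 3 x] by (auto intro!: derivative_eq_intros)
      show "((\<lambda>x. - (pi ^ 2 * x / 8) + x ^ 3 / 6 + D 3 x) has_real_derivative
          - (pi ^ 2 / 8) + x ^ 2 / 2 + C 2 x) (at x)" for x
        using derD[of 2 x] by (auto intro!: derivative_eq_intros)
      show "- (pi ^ 2 / 8) + x ^ 2 / 2 + C 2 x \<le> 0" if "0 \<le> x" "x \<le> pi / 2" for x
        using C2[OF that] by simp
      show "- (pi ^ 2 * 0 / 8) + 0 ^ 3 / 6 + D 3 0 = 0"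
        by (simp add: D0)
      have "pi ^ 2 * pi ^ 2 = pi ^ 4" by (simp add: power_add[symmetric])
      then show "5 * pi ^ 4 / 384 - pi ^ 2 * (pi / 2) ^ 2 / 16 + (pi / 2) ^ 4 / 24 - C 4 (pi / 2) = 0"
        unfolding Cpi by (simp add: power_divide)
    qed
    then show ?thesis by simp
  qed
  show "(\<Sum>l<P. c l / real (2 * l + 1) ^ 2) \<le> pi ^ 2 / 8"
    using C2[of 0] by (simp add: C_def)
  show "(\<Sum>l<P. c l / real (2 * l + 1) ^ 4) \<le> 5 * pi ^ 4 / 384"
    using C4[of 0] by (simp add: C_def)
qed

lemma odd_cos_majorant:
  assumes "0 < \<epsilon>"
  obtains P c where
    "\<And>x. \<bar>cos x\<bar> \<le> cos x * (\<Sum>l<P. c l * cos (real (2 * l + 1) * x)) + \<epsilon>"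
    "(\<Sum>l<P. c l / real (2 * l + 1) ^ 2) \<le> pi ^ 2 / 8"
    "(\<Sum>l<P. c l / real (2 * l + 1) ^ 4) \<le> 5 * pi ^ 4 / 384"
proof -
  obtain m where m: "2 / \<epsilon> < real m" using reals_Archimedean2 by blast
  then have "2 < \<epsilon> * real (Suc m)" using assms by (simp add: field_simps)
  then have m': "2 / real (Suc m) \<le> \<epsilon>" by (simp add: field_simps)
  obtain P c where c: "\<And>x. sgn_approx m (cos x) = (\<Sum>l<P. c l * cos (real (2 * l + 1) * x))"
    using cos_span_odd_sum[OF sgn_approx_cos_span] by blast
  have "\<bar>cos x\<bar> \<le> cos x * (\<Sum>l<P. c l * cos (real (2 * l + 1) * x)) + \<epsilon>" for x
    unfolding c[symmetric] using sgn_approx_abs[of "cos x" m] m' by simp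
  moreover have "(\<Sum>l<P. c l * cos (real (2 * l + 1) * x)) \<le> 1" if "0 \<le> x" "x \<le> pi / 2" for x
    unfolding c[symmetric] using sgn_approx_bounds[of "cos x" m] that by (simp add: cos_ge_zero)
  ultimately show thesis using that odd_cos_sum_integrals[where P = P and c = c] by blast
qed

section \<open>Convex cosine coefficients\<close>

text \<open>
  Complete monotonicity up to order \<open>k\<close> with respect to steps of length \<open>1\<close>.  In this recursive
  form the product rule for differences shows closure under products, and \<open>1 / x\<close> qualifies since
  its difference is the product of two functions of the same kind.
\<close>

primrec alternating_differences :: "nat \<Rightarrow> (real \<Rightarrow> real) \<Rightarrow> bool" where
  "alternating_differences 0 f = (\<forall>x>0. 0 \<le> f x)"
| "alternating_differences (Suc k) f =
    ((\<forall>x>0. 0 \<le> f x) \<and> alternating_differences k (\<lambda>x. f x - f (x + 1)))"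

lemma alternating_differences_cong:
  "(\<And>x. 0 < x \<Longrightarrow> f x = g x) \<Longrightarrow> alternating_differences k f = alternating_differences k g"
proof (induction k arbitrary: f g)
  case (Suc k)
  have "alternating_differences k (\<lambda>x. f x - f (x + 1)) = alternating_differences k (\<lambda>x. g x - g (x + 1))"
    by (rule Suc.IH) (use Suc.prems in auto)
  then show ?case using Suc.prems by auto
qed auto

lemma alternating_differences_nonneg: "alternating_differences k f \<Longrightarrow> 0 < x \<Longrightarrow> 0 \<le> f x"
  by (cases k) auto

lemma alternating_differences_Suc: "alternating_differences (Suc k) f \<Longrightarrow> alternating_differences k f"
proof (induction k arbitrary: f)
  case (Suc k)
  show ?case using Suc.IH[of "\<lambda>x. f x - f (x + 1)"] Suc.prems by simp
qed simp

lemma alternating_differences_add: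
  "alternating_differences k f \<Longrightarrow> alternating_differences k g \<Longrightarrow> alternating_differences k (\<lambda>x. f x + g x)"
proof (induction k arbitrary: f g)
  case (Suc k)
  have "alternating_differences k (\<lambda>x. (f x - f (x + 1)) + (g x - g (x + 1)))"
    by (rule Suc.IH) (use Suc.prems in auto)
  then show ?case using Suc.prems by (auto simp: algebra_simps)
qed auto

lemma alternating_differences_shift:
  "alternating_differences k f \<Longrightarrow> alternating_differences k (\<lambda>x. f (x + 1))"
proof (induction k arbitrary: f)
  case (Suc k)
  have "alternating_differences k (\<lambda>x. f (x + 1) - f (x + 1 + 1))"
    by (rule Suc.IH[where f = "\<lambda>x. f x - f (x + 1)"]) (use Suc.prems in auto)
  then show ?case using Suc.prems by auto
qed auto

lemma alternating_differences_mult: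
  "alternating_differences k f \<Longrightarrow> alternating_differences k g \<Longrightarrow> alternating_differences k (\<lambda>x. f x * g x)"
proof (induction k arbitrary: f g)
  case (Suc k)
  have "alternating_differences k (\<lambda>x. (f x - f (x + 1)) * g x + f (x + 1) * (g x - g (x + 1)))"
    by (intro alternating_differences_add Suc.IH alternating_differences_shift)
      (use Suc.prems alternating_differences_Suc[of k f] alternating_differences_Suc[of k g] in auto)
  then show ?case using Suc.prems by (auto simp: algebra_simps)
qed auto

lemma alternating_differences_inverse: "alternating_differences k (\<lambda>x. 1 / x)"
proof (induction k)
  case (Suc k)
  have "alternating_differences k (\<lambda>x. 1 / x * (1 / (x + 1)))"
    by (intro alternating_differences_mult Suc alternating_differences_shift)
  also have "?this \<longleftrightarrow> alternating_differences k (\<lambda>x. 1 / x - 1 / (x + 1))"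
    by (rule alternating_differences_cong) (simp add: field_simps)
  finally show ?case by simp
qed auto

lemma alternating_differences_one: "alternating_differences k (\<lambda>x. 1)"
proof -
  have "alternating_differences k (\<lambda>x. 0)" for k by (induction k) auto
  then show ?thesis by (cases k) auto
qed

lemma alternating_differences_power: "alternating_differences k (\<lambda>x. 1 / x ^ s)"
proof (induction s)
  case 0
  show ?case using alternating_differences_one by simp
next
  case (Suc s)
  from alternating_differences_mult[OF alternating_differences_inverse Suc] show ?case by simp
qed

lemma antimono_steps:
  fixes f :: "real \<Rightarrow> real"
  assumes "\<And>x. 0 < x \<Longrightarrow> f (x + 1) \<le> f x" "0 < x"
  shows "f (x + real d) \<le> f x"
proof (induction d)
  case (Suc d)
  have "f (x + real d + 1) \<le> f (x + real d)" using assms by (intro assms(1)) auto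
  with Suc have "f (x + real d + 1) \<le> f x" by simp
  moreover have "x + real (Suc d) = x + real d + 1" by simp
  ultimately show ?case by (simp only:)
qed simp

definition alternating_sum :: "nat \<Rightarrow> (real \<Rightarrow> real) \<Rightarrow> real \<Rightarrow> real" where
  "alternating_sum d f x = (\<Sum>l. (-1) ^ l * f (x + real l * real d))"

lemma alternating_sum:
  assumes f: "alternating_differences 1 f" and lim: "(f \<longlongrightarrow> 0) at_top" and "0 < x" "0 < d"
  shows "summable (\<lambda>l. (-1) ^ l * f (x + real l * real d))"
    and "0 \<le> alternating_sum d f x" and "alternating_sum d f x \<le> f x"
proof -
  define a where "a l = f (x + real l * real d)" for l
  have "filterlim (\<lambda>l. x + real l * real d) at_top sequentially"
    by (rule filterlim_tendsto_add_at_top[OF tendsto_const], rule filterlim_at_top_mult_tendsto_pos[OF tendsto_const])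
       (use \<open>0 < d\<close> filterlim_real_sequentially in auto)
  from filterlim_compose[OF lim this] have 1: "a \<longlonglongrightarrow> 0" by (simp add: a_def[abs_def])
  have 2: "0 \<le> a l" for l
    using alternating_differences_nonneg[OF f] \<open>0 < x\<close> by (simp add: a_def add_pos_nonneg)
  have 3: "a (Suc l) \<le> a l" for l
  proof -
    have "f (x + real l * real d + real d) \<le> f (x + real l * real d)"
      using f \<open>0 < x\<close> by (intro antimono_steps) (auto simp: add_pos_nonneg)
    then show ?thesis by (simp add: a_def algebra_simps)
  qed
  note L = summable_Leibniz'[OF 1 2 3]
  show "summable (\<lambda>l. (-1) ^ l * f (x + real l * real d))"
    using L(1) by (simp add: a_def)
  show "0 \<le> alternating_sum d f x" "alternating_sum d f x \<le> f x"
    using L(2)[of 0] L(4)[of 0] by (simp_all add: a_def alternating_sum_def)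
qed

lemma alternating_sum_shift:
  assumes "alternating_differences 1 f" "(f \<longlongrightarrow> 0) at_top" "0 < x" "0 < d"
  shows "alternating_sum d f x + alternating_sum d f (x + real d) = f x"
proof -
  define a where "a l = (-1) ^ l * f (x + real l * real d)" for l
  have s: "summable a" using alternating_sum(1)[OF assms] by (simp add: a_def[abs_def])
  have "(\<Sum>l. - a (Suc l)) = - (\<Sum>l. a (Suc l))"
    using s by (intro suminf_minus) (simp add: summable_Suc_iff)
  moreover have "suminf a = (\<Sum>l. a (Suc l)) + a 0"
    using suminf_split_head[OF s] by simp
  moreover have "alternating_sum d f (x + real d) = (\<Sum>l. - a (Suc l))"
    by (simp add: alternating_sum_def a_def algebra_simps)
  ultimately show ?thesis by (simp add: alternating_sum_def a_def[abs_def])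
qed

text \<open>
  The alternating series with steps \<open>2 n\<close> solves the functional equation.  Its first and second
  differences are alternating series of decreasing terms, because the differences of \<open>1 / x\<^sup>s\<close>
  alternate in sign up to order three.
\<close>

lemma convex_coefficients:
  assumes "0 < n" "0 < s"
  obtains \<kappa> :: "nat \<Rightarrow> real" where
    "\<And>i. 0 \<le> \<kappa> i" "\<And>i. \<kappa> (Suc i) \<le> \<kappa> i" "\<And>i. 0 \<le> \<kappa> i - 2 * \<kappa> (Suc i) + \<kappa> (Suc (Suc i))"
    "\<kappa> \<longlonglongrightarrow> 0" "\<kappa> 0 \<le> 1 / real n ^ s" "\<And>i. \<kappa> i + \<kappa> (i + 2 * n) = 1 / real (n + i) ^ s"
proof -
  define f :: "real \<Rightarrow> real" where "f = (\<lambda>x. 1 / x ^ s)"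
  define A where "A g x = alternating_sum (2 * n) g x" for g x
  define \<kappa> where "\<kappa> i = A f (real (n + i))" for i
  have d: "0 < 2 * n" using assms by simp
  have x: "0 < real (n + i)" for i using assms by simp
  have alt: "alternating_differences k f" for k
    unfolding f_def by (rule alternating_differences_power)
  define f1 where "f1 = (\<lambda>x. f x - f (x + 1))"
  define f2 where "f2 = (\<lambda>x. f1 x - f1 (x + 1))"
  have alt1: "alternating_differences k f1" for k using alt[of "Suc k"] by (simp add: f1_def)
  have alt2: "alternating_differences k f2" for k using alt1[of "Suc k"] by (simp add: f2_def)
  have sh: "((\<lambda>x. g (x + 1)) \<longlongrightarrow> 0) at_top" if "(g \<longlongrightarrow> 0) at_top" for g :: "real \<Rightarrow> real"
    using filterlim_compose[OF that filterlim_tendsto_add_at_top[OF tendsto_const filterlim_ident], of 1]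
    by (simp add: add.commute)
  have "((\<lambda>x::real. inverse (x ^ s)) \<longlongrightarrow> 0) at_top"
    using assms(2) by (intro tendsto_inverse_0_at_top filterlim_pow_at_top filterlim_ident)
  then have lim: "(f \<longlongrightarrow> 0) at_top" by (simp add: f_def divide_inverse)
  have lim1: "(f1 \<longlongrightarrow> 0) at_top" unfolding f1_def using tendsto_diff[OF lim sh[OF lim]] by simp
  have lim2: "(f2 \<longlongrightarrow> 0) at_top" unfolding f2_def using tendsto_diff[OF lim1 sh[OF lim1]] by simp
  note S = alternating_sum(1)[OF alt lim _ d] alternating_sum(1)[OF alt1 lim1 _ d]
  have diff: "A f x - A f (x + 1) = A f1 x" "A f1 x - A f1 (x + 1) = A f2 x" if "0 < x" for x
    unfolding A_def alternating_sum_def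
    using S[of x] S[of "x + 1"] that
    by (simp_all add: suminf_diff f1_def f2_def algebra_simps)
  have Suc: "real (n + Suc i) = real (n + i) + 1" for i by simp
  have k1: "\<kappa> i - \<kappa> (Suc i) = A f1 (real (n + i))" for i
    using diff(1)[OF x] by (simp add: \<kappa>_def add_ac)
  have k2: "\<kappa> i - 2 * \<kappa> (Suc i) + \<kappa> (Suc (Suc i)) = A f2 (real (n + i))" for i
    using k1[of i] k1[of "Suc i"] diff(2)[OF x, of i] by (simp add: add_ac)
  show thesis
  proof
    show "0 \<le> \<kappa> i" for i
      unfolding \<kappa>_def A_def by (rule alternating_sum(2)[OF alt lim x d])
    show "\<kappa> (Suc i) \<le> \<kappa> i" for i
      using k1[of i] alternating_sum(2)[OF alt1 lim1 x[of i] d] by (simp add: A_def)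
    show "0 \<le> \<kappa> i - 2 * \<kappa> (Suc i) + \<kappa> (Suc (Suc i))" for i
      using k2[of i] alternating_sum(2)[OF alt2 lim2 x[of i] d] by (simp add: A_def)
    have "filterlim (\<lambda>i. real (n + i)) at_top sequentially"
      unfolding of_nat_add
      by (intro filterlim_tendsto_add_at_top[OF tendsto_const] filterlim_real_sequentially)
    from filterlim_compose[OF lim this] have z: "(\<lambda>i. f (real (n + i))) \<longlonglongrightarrow> 0" .
    show "\<kappa> \<longlonglongrightarrow> 0"
      using alternating_sum(2,3)[OF alt lim x d]
      by (intro tendsto_sandwich[OF _ _ tendsto_const z]) (auto simp: \<kappa>_def A_def)
    show "\<kappa> 0 \<le> 1 / real n ^ s"
      using alternating_sum(3)[OF alt lim x[of 0] d] by (simp add: \<kappa>_def A_def f_def)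
    show "\<kappa> i + \<kappa> (i + 2 * n) = 1 / real (n + i) ^ s" for i
      using alternating_sum_shift[OF alt lim x[of i] d] by (simp add: \<kappa>_def A_def f_def add_ac)
  qed
qed

text \<open>
  Two summations by parts turn a cosine sum into a combination of Fejer kernels
  \<open>(1 - cos (k t)) / (1 - cos t)\<close>, up to boundary terms.
\<close>

lemma cosine_sum_second_differences:
  fixes \<kappa> :: "nat \<Rightarrow> real"
  shows "(2 - 2 * cos t) * (\<kappa> 0 + 2 * (\<Sum>i<D. \<kappa> (Suc i) * cos (real (Suc i) * t))) =
    2 * (\<Sum>i<D. (\<kappa> i - 2 * \<kappa> (Suc i) + \<kappa> (Suc (Suc i))) * (1 - cos (real (Suc i) * t)))
    + 2 * (\<kappa> D - \<kappa> (Suc D)) + 2 * \<kappa> (Suc D) * cos (real D * t) - 2 * \<kappa> D * cos (real (Suc D) * t)"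
proof (induction D)
  case (Suc D)
  have "cos (real (Suc (Suc D)) * t) + cos (real D * t) = 2 * cos t * cos (real (Suc D) * t)"
  proof -
    have "real (Suc (Suc D)) * t = real (Suc D) * t + t" "real D * t = real (Suc D) * t - t"
      by (simp_all add: algebra_simps)
    then have "cos (real (Suc (Suc D)) * t) = cos (real (Suc D) * t) * cos t - sin (real (Suc D) * t) * sin t"
      "cos (real D * t) = cos (real (Suc D) * t) * cos t + sin (real (Suc D) * t) * sin t"
      by (simp_all only: cos_add cos_diff)
    then show ?thesis by simp
  qed
  then have e: "cos (real (Suc (Suc D)) * t) = 2 * cos t * cos (real (Suc D) * t) - cos (real D * t)"
    by simp
  show ?case
    unfolding sum.lessThan_Suc e using Suc by (simp add: algebra_simps)
qed (simp add: algebra_simps)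

lemma convex_cosine_sum_nonneg:
  fixes \<kappa> :: "nat \<Rightarrow> real"
  assumes "\<And>i. 0 \<le> \<kappa> i" "\<And>i. 0 \<le> \<kappa> i - 2 * \<kappa> (Suc i) + \<kappa> (Suc (Suc i))" "\<kappa> D = 0" "\<kappa> (Suc D) = 0"
  shows "0 \<le> \<kappa> 0 + 2 * (\<Sum>i<D. \<kappa> (Suc i) * cos (real (Suc i) * t))" (is "0 \<le> ?K")
proof (cases "cos t = 1")
  case True
  have "cos (real i * t) = 1 \<and> sin (real i * t) = 0" for i
  proof (induction i)
    case (Suc i)
    have "sin t = 0" using True sin_cos_squared_add[of t] by simp
    then show ?case using Suc True by (simp add: distrib_right cos_add sin_add)
  qed simp
  then show ?thesis using assms(1) by (simp add: sum_nonneg del: of_nat_Suc)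
next
  case False
  then have pos: "0 < 2 - 2 * cos t" using cos_le_one[of t] by linarith
  have "0 \<le> (2 - 2 * cos t) * ?K"
    unfolding cosine_sum_second_differences using assms by (simp add: sum_nonneg del: of_nat_Suc)
  then show ?thesis using pos by (simp add: zero_le_mult_iff)
qed

section \<open>Mean values over equidistant points\<close>

text \<open>
  The mean value over a period is taken as a limit of averages over equidistant nodes, so that a
  convolution operator is a limit of finite combinations of translations.
\<close>

definition node_mean :: "nat \<Rightarrow> (real \<Rightarrow> real) \<Rightarrow> real" where
  "node_mean m g = (\<Sum>l<m. g (2 * pi * real l / real m)) / real m"

definition has_mean :: "(real \<Rightarrow> real) \<Rightarrow> real \<Rightarrow> bool" where
  "has_mean g d \<longleftrightarrow> (\<lambda>m. node_mean m g) \<longlonglongrightarrow> d"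

lemma has_mean_add: "has_mean f a \<Longrightarrow> has_mean g b \<Longrightarrow> has_mean (\<lambda>t. f t + g t) (a + b)"
  unfolding has_mean_def by (drule (1) tendsto_add) (simp add: node_mean_def sum.distrib add_divide_distrib)

lemma has_mean_cmult: "has_mean f a \<Longrightarrow> has_mean (\<lambda>t. c * f t) (c * a)"
  unfolding has_mean_def by (drule tendsto_mult_left[of _ _ _ c]) (simp add: node_mean_def sum_distrib_left)

lemma has_mean_sum:
  assumes "finite I" "\<And>i. i \<in> I \<Longrightarrow> has_mean (f i) (a i)"
  shows "has_mean (\<lambda>t. \<Sum>i\<in>I. f i t) (\<Sum>i\<in>I. a i)"
  using assms
proof (induction I rule: finite_induct)
  case empty
  then show ?case by (simp add: has_mean_def node_mean_def)
qed (simp add: has_mean_add)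

lemma sum_cos_telescope:
  "2 * sin (a / 2) * (\<Sum>l<m. cos (real l * a)) = sin (real m * a - a / 2) + sin (a / 2)"
proof (induction m)
  case (Suc m)
  have "real (Suc m) * a - a / 2 = real m * a + a / 2" by (simp add: algebra_simps)
  then have "sin (real (Suc m) * a - a / 2) = sin (real m * a - a / 2) + 2 * sin (a / 2) * cos (real m * a)"
    by (simp only: sin_add sin_diff) simp
  then show ?case using Suc by (simp add: algebra_simps)
qed simp

lemma has_mean_cos: "has_mean (\<lambda>t. cos (of_int j * t)) (if j = 0 then 1 else 0)"
proof -
  define k where "k = nat \<bar>j\<bar>"
  have c: "cos (of_int j * t) = cos (real k * t)" for t
    by (cases "0 \<le> j") (simp_all add: k_def)
  have "node_mean m (\<lambda>t. cos (real k * t)) = (if j = 0 then 1 else 0)" if "k < m" for m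
  proof (cases "k = 0")
    case True
    then show ?thesis using that by (simp add: node_mean_def k_def)
  next
    case False
    define a where "a = 2 * pi * real k / real m"
    have "0 < a / 2" "a / 2 < pi" using that False by (simp_all add: a_def field_simps)
    then have "sin (a / 2) \<noteq> 0" using sin_gt_zero[of "a / 2"] by simp
    have "real m * a = 2 * pi * real k" using that by (simp add: a_def)
    moreover have "sin (2 * pi * real k) = 0" "cos (2 * pi * real k) = 1"
      using sin_npi[of "2 * k"] cos_npi[of "2 * k"] by (simp_all add: mult_ac)
    ultimately have "sin (real m * a - a / 2) = - sin (a / 2)"
      by (simp add: sin_diff)
    then have "(\<Sum>l<m. cos (real l * a)) = 0"
      using sum_cos_telescope[of a m] \<open>sin (a / 2) \<noteq> 0\<close> by simp
    then show ?thesis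
      using False by (simp add: node_mean_def a_def k_def mult_ac)
  qed
  from this[symmetric] have "eventually (\<lambda>m. (if j = 0 then 1 else 0) = node_mean m (\<lambda>t. cos (of_int j * t))) sequentially"
    unfolding c by (intro eventually_sequentiallyI[of "Suc k"]) simp
  then show ?thesis
    unfolding has_mean_def by (rule Lim_transform_eventually[OF tendsto_const])
qed

lemma has_mean_cosine_sum:
  fixes \<kappa> :: "nat \<Rightarrow> real"
  assumes "\<And>i. D < i \<Longrightarrow> \<kappa> i = 0"
  shows "has_mean (\<lambda>t. (\<kappa> 0 + 2 * (\<Sum>i<D. \<kappa> (Suc i) * cos (real (Suc i) * t))) * cos (of_int j * t))
    (\<kappa> (nat \<bar>j\<bar>))"
proof -
  let ?\<delta> = "\<lambda>j::int. if j = 0 then 1 else 0 :: real"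
  have "has_mean (\<lambda>t. \<kappa> 0 * cos (of_int j * t) + (\<Sum>i<D. \<kappa> (Suc i) *
      (cos (of_int (j - int (Suc i)) * t) + cos (of_int (j + int (Suc i)) * t))))
    (\<kappa> 0 * ?\<delta> j + (\<Sum>i<D. \<kappa> (Suc i) * (?\<delta> (j - int (Suc i)) + ?\<delta> (j + int (Suc i)))))"
    by (intro has_mean_add has_mean_cmult has_mean_sum has_mean_cos) auto
  moreover have "(\<lambda>t. \<kappa> 0 * cos (of_int j * t) + (\<Sum>i<D. \<kappa> (Suc i) *
      (cos (of_int (j - int (Suc i)) * t) + cos (of_int (j + int (Suc i)) * t)))) =
    (\<lambda>t. (\<kappa> 0 + 2 * (\<Sum>i<D. \<kappa> (Suc i) * cos (real (Suc i) * t))) * cos (of_int j * t))"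
  proof -
    have "cos (of_int (j - int i) * t) + cos (of_int (j + int i) * t) = 2 * cos (real i * t) * cos (of_int j * t)" for i t
      by (simp add: left_diff_distrib distrib_right cos_add cos_diff)
    then have "(\<Sum>i<D. \<kappa> (Suc i) *
        (cos (of_int (j - int (Suc i)) * t) + cos (of_int (j + int (Suc i)) * t))) =
        2 * (\<Sum>i<D. \<kappa> (Suc i) * cos (real (Suc i) * t)) * cos (of_int j * t)" for t
      by (simp only: sum_distrib_left sum_distrib_right mult_ac)
    then show ?thesis
      by (simp only: distrib_right)
  qed
  moreover have "\<kappa> 0 * ?\<delta> j + (\<Sum>i<D. \<kappa> (Suc i) * (?\<delta> (j - int (Suc i)) + ?\<delta> (j + int (Suc i)))) = \<kappa> (nat \<bar>j\<bar>)"
  proof (cases "j = 0")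
    case True
    then have "?\<delta> (j - int (Suc i)) + ?\<delta> (j + int (Suc i)) = 0" for i by auto
    then show ?thesis using True by (simp del: of_nat_Suc)
  next
    case False
    then obtain k where k: "nat \<bar>j\<bar> = Suc k" using not0_implies_Suc[of "nat \<bar>j\<bar>"] by auto
    then have "?\<delta> (j - int (Suc i)) + ?\<delta> (j + int (Suc i)) = (if i = k then 1 else 0)" for i by auto
    then have "(\<Sum>i<D. \<kappa> (Suc i) * (?\<delta> (j - int (Suc i)) + ?\<delta> (j + int (Suc i)))) = (if k < D then \<kappa> (Suc k) else 0)"
      by (simp add: if_distrib[where f = "\<lambda>x. _ * x"] cong: if_cong del: of_nat_Suc)
    with False k assms[of "Suc k"] show ?thesis by auto
  qed
  ultimately show ?thesis by simp
qed

section \<open>The Bohr--Favard inequality for multipliers\<close>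

context shift_invariant_seminorm
begin

text \<open>Convolution with a kernel \<open>g\<close>, discretised.\<close>

lemma mult_bound_kernel:
  assumes le: "\<And>t. \<bar>g t\<bar> \<le> G t"
    and l: "\<And>k. has_mean (\<lambda>t. g t * cos (real k * t)) (l k)" and G: "has_mean G d"
  shows "mult_bound l d"
proof (rule mult_bound_limit)
  show "(\<lambda>m. node_mean m (\<lambda>t. g t * cos (real k * t))) \<longlonglongrightarrow> l k" for k
    using l by (simp add: has_mean_def)
  show "(\<lambda>m. node_mean m G) \<longlonglongrightarrow> d"
    using G by (simp add: has_mean_def)
  fix m
  let ?t = "\<lambda>l. 2 * pi * real l / real m"
  have "mult_bound (\<lambda>k. \<Sum>l<m. (g (?t l) / real m) * cos (real k * ?t l)) (\<Sum>l<m. \<bar>g (?t l) / real m\<bar>)"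
    by (rule mult_bound_cos_sum) simp
  also have "(\<lambda>k. \<Sum>l<m. (g (?t l) / real m) * cos (real k * ?t l)) =
      (\<lambda>k. node_mean m (\<lambda>t. g t * cos (real k * t)))"
    by (simp add: node_mean_def sum_divide_distrib)
  finally show "mult_bound (\<lambda>k. node_mean m (\<lambda>t. g t * cos (real k * t))) (node_mean m G)"
    by (rule mult_bound_mono)
       (simp add: node_mean_def sum_divide_distrib, intro sum_mono divide_right_mono le, simp)
qed

text \<open>
  The kernel \<open>2 cos (n t) K(t)\<close> with \<open>K \<ge> 0\<close> has the sign of \<open>cos (n t)\<close>.  Its \<open>L\<^sub>1\<close> norm is
  therefore found by testing it against an odd cosine polynomial in \<open>n t\<close> that imitates this sign,
  which only involves the multiplier at the odd multiples of \<open>n\<close>.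
\<close>

lemma mult_bound_modulated_cosine_sum:
  fixes \<kappa> :: "nat \<Rightarrow> real"
  assumes "\<And>i. 0 \<le> \<kappa> i" "\<And>i. 0 \<le> \<kappa> i - 2 * \<kappa> (Suc i) + \<kappa> (Suc (Suc i))" "\<And>i. D \<le> i \<Longrightarrow> \<kappa> i = 0"
    and majorant: "\<And>x. \<bar>cos x\<bar> \<le> cos x * (\<Sum>l<P. c l * cos (real (2 * l + 1) * x)) + \<epsilon>"
  shows "mult_bound (\<lambda>k. \<kappa> (nat \<bar>int k - int n\<bar>) + \<kappa> (k + n))
    ((\<Sum>l<P. c l * (\<kappa> (2 * l * n) + \<kappa> (2 * l * n + 2 * n))) + 2 * \<epsilon> * \<kappa> 0)"
proof -
  define K where "K t = \<kappa> 0 + 2 * (\<Sum>i<D. \<kappa> (Suc i) * cos (real (Suc i) * t))" for t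
  have K0: "0 \<le> K t" for t
    unfolding K_def
    by (rule convex_cosine_sum_nonneg[of \<kappa>, OF assms(1,2) assms(3)[of D] assms(3)[of "Suc D"]]) auto
  have Kmean: "has_mean (\<lambda>t. K t * cos (of_int j * t)) (\<kappa> (nat \<bar>j\<bar>))" for j
    unfolding K_def by (rule has_mean_cosine_sum) (simp add: assms(3))
  define g where "g t = 2 * cos (real n * t) * K t" for t
  have gmean: "has_mean (\<lambda>t. g t * cos (real k * t)) (\<kappa> (nat \<bar>int k - int n\<bar>) + \<kappa> (k + n))" for k
  proof -
    have "has_mean (\<lambda>t. K t * cos (of_int (int k - int n) * t) + K t * cos (of_int (int k + int n) * t))
        (\<kappa> (nat \<bar>int k - int n\<bar>) + \<kappa> (nat \<bar>int k + int n\<bar>))"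
      by (intro has_mean_add Kmean)
    also have "(\<lambda>t. K t * cos (of_int (int k - int n) * t) + K t * cos (of_int (int k + int n) * t)) =
        (\<lambda>t. g t * cos (real k * t))"
    proof -
      have "cos (of_int (int k - int n) * t) + cos (of_int (int k + int n) * t) =
          2 * cos (real n * t) * cos (real k * t)" for t
        by (simp add: left_diff_distrib distrib_right cos_add cos_diff)
      then show ?thesis
        unfolding g_def by (simp only: distrib_left[symmetric] mult_ac)
    qed
    finally show ?thesis by (simp add: nat_add_distrib)
  qed
  define G where "G t = (\<Sum>l<P. c l * (g t * cos (real (2 * l * n + n) * t))) + 2 * \<epsilon> * (K t * cos (of_int 0 * t))" for t
  have "has_mean G ((\<Sum>l<P. c l * (\<kappa> (nat \<bar>int (2 * l * n + n) - int n\<bar>) + \<kappa> (2 * l * n + n + n)))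
      + 2 * \<epsilon> * \<kappa> (nat \<bar>0\<bar>))"
    unfolding G_def by (intro has_mean_add has_mean_sum has_mean_cmult gmean Kmean) auto
  moreover have "nat \<bar>int (2 * l * n + n) - int n\<bar> = 2 * l * n" "2 * l * n + n + n = 2 * l * n + 2 * n" for l
    by (simp_all add: nat_mult_distrib)
  ultimately have Gmean: "has_mean G ((\<Sum>l<P. c l * (\<kappa> (2 * l * n) + \<kappa> (2 * l * n + 2 * n))) + 2 * \<epsilon> * \<kappa> 0)"
    by (simp only: abs_zero nat_0)
  have "\<bar>g t\<bar> \<le> G t" for t
  proof -
    define x where "x = real n * t"
    have "\<bar>g t\<bar> = 2 * K t * \<bar>cos x\<bar>" using K0[of t] by (simp add: g_def x_def abs_mult)
    also have "\<dots> \<le> 2 * K t * (cos x * (\<Sum>l<P. c l * cos (real (2 * l + 1) * x)) + \<epsilon>)"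
      using K0[of t] by (intro mult_left_mono majorant) auto
    also have "\<dots> = G t"
    proof -
      have "real (2 * l * n + n) * t = real (2 * l + 1) * x" for l
        by (simp add: x_def algebra_simps)
      moreover have "2 * K t * (cos x * (\<Sum>l<P. c l * cos (real (2 * l + 1) * x))) =
          (\<Sum>l<P. c l * (2 * cos x * K t * cos (real (2 * l + 1) * x)))"
        by (simp only: sum_distrib_left mult_ac)
      ultimately show ?thesis
        unfolding G_def g_def x_def[symmetric] by (simp add: distrib_left)
    qed
    finally show ?thesis .
  qed
  from mult_bound_kernel[OF this gmean Gmean] show ?thesis .
qed

text \<open>
  Truncating the coefficients keeps them convex, hence the kernel nonnegative.
\<close>

lemma mult_bound_modulated_limit:
  fixes \<kappa> :: "nat \<Rightarrow> real"
  assumes "\<And>i. \<kappa> (Suc i) \<le> \<kappa> i" "\<And>i. 0 \<le> \<kappa> i - 2 * \<kappa> (Suc i) + \<kappa> (Suc (Suc i))" "\<kappa> \<longlonglongrightarrow> 0"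
    and majorant: "\<And>x. \<bar>cos x\<bar> \<le> cos x * (\<Sum>l<P. c l * cos (real (2 * l + 1) * x)) + \<epsilon>"
  shows "mult_bound (\<lambda>k. \<kappa> (nat \<bar>int k - int n\<bar>) + \<kappa> (k + n))
    ((\<Sum>l<P. c l * (\<kappa> (2 * l * n) + \<kappa> (2 * l * n + 2 * n))) + 2 * \<epsilon> * \<kappa> 0)"
proof (rule mult_bound_limit)
  define \<mu> where "\<mu> D i = max (\<kappa> i - \<kappa> D) 0" for D i
  have lim: "(\<lambda>D. \<mu> D i) \<longlonglongrightarrow> \<kappa> i" for i
  proof -
    have "(\<lambda>D. max (\<kappa> i - \<kappa> D) 0) \<longlonglongrightarrow> max (\<kappa> i - 0) 0"
      by (intro tendsto_intros assms)
    moreover have "0 \<le> \<kappa> i" using decseq_ge[OF decseq_SucI assms(3)] assms(1) by blast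
    ultimately show ?thesis by (simp add: \<mu>_def)
  qed
  show "(\<lambda>D. \<mu> D (nat \<bar>int k - int n\<bar>) + \<mu> D (k + n)) \<longlonglongrightarrow> \<kappa> (nat \<bar>int k - int n\<bar>) + \<kappa> (k + n)" for k
    by (intro tendsto_intros lim)
  show "(\<lambda>D. (\<Sum>l<P. c l * (\<mu> D (2 * l * n) + \<mu> D (2 * l * n + 2 * n))) + 2 * \<epsilon> * \<mu> D 0)
      \<longlonglongrightarrow> (\<Sum>l<P. c l * (\<kappa> (2 * l * n) + \<kappa> (2 * l * n + 2 * n))) + 2 * \<epsilon> * \<kappa> 0"
    by (intro tendsto_intros lim)
  fix D
  have mono: "\<kappa> j \<le> \<kappa> i" if "i \<le> j" for i j
    using lift_Suc_antimono_le[of \<kappa>] assms(1) that by blast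
  show "mult_bound (\<lambda>k. \<mu> D (nat \<bar>int k - int n\<bar>) + \<mu> D (k + n))
      ((\<Sum>l<P. c l * (\<mu> D (2 * l * n) + \<mu> D (2 * l * n + 2 * n))) + 2 * \<epsilon> * \<mu> D 0)"
  proof (rule mult_bound_modulated_cosine_sum[OF _ _ _ majorant])
    show "0 \<le> \<mu> D i" for i by (simp add: \<mu>_def)
    show "\<mu> D i = 0" if "D \<le> i" for i using mono[OF that] by (simp add: \<mu>_def)
    show "0 \<le> \<mu> D i - 2 * \<mu> D (Suc i) + \<mu> D (Suc (Suc i))" for i
      using assms(1)[of i] assms(1)[of "Suc i"] assms(2)[of i] by (auto simp: \<mu>_def max_def)
  qed
qed

text \<open>
  For even \<open>s\<close>, the multiplier \<open>1 / j\<^sup>s\<close> is, up to sign, integration \<open>s\<close> times.  Modulo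
  trigonometric polynomials of degree below \<open>n\<close> it is convolution with a kernel
  \<open>2 cos (n t) K(t)\<close> as above, whose multiplier is \<open>\<kappa>(\<bar>j - n\<bar>) + \<kappa>(j + n)\<close>, and the
  choice of \<open>\<kappa>\<close> makes this equal to \<open>1 / j\<^sup>s\<close> for \<open>j \<ge> n\<close>.  The bound \<open>2 / n\<^sup>s\<close> comes from
  \<open>\<bar>cos (n t)\<bar> \<le> 1\<close> alone; it is good enough whenever it is used for all \<open>s\<close> at once.
\<close>

lemma bohr_favard_multiplier:
  assumes "0 < n" "0 < s"
  obtains l where "\<And>k. n \<le> k \<Longrightarrow> l k = 1 / real k ^ s" "mult_bound l (2 / real n ^ s)"
    "s = 2 \<Longrightarrow> mult_bound l (pi ^ 2 / 8 / real n ^ s)"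
    "s = 4 \<Longrightarrow> mult_bound l (5 * pi ^ 4 / 384 / real n ^ s)"
proof -
  obtain \<kappa> :: "nat \<Rightarrow> real" where \<kappa>: "\<And>i. 0 \<le> \<kappa> i" "\<And>i. \<kappa> (Suc i) \<le> \<kappa> i"
    "\<And>i. 0 \<le> \<kappa> i - 2 * \<kappa> (Suc i) + \<kappa> (Suc (Suc i))" "\<kappa> \<longlonglongrightarrow> 0" "\<kappa> 0 \<le> 1 / real n ^ s"
    "\<And>i. \<kappa> i + \<kappa> (i + 2 * n) = 1 / real (n + i) ^ s"
    using convex_coefficients[OF assms] by blast
  define l where "l k = \<kappa> (nat \<bar>int k - int n\<bar>) + \<kappa> (k + n)" for k
  have bound: "mult_bound l ((\<Sum>l<P. c l / real (2 * l + 1) ^ s) / real n ^ s + 2 * \<epsilon> * \<kappa> 0)"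
    if "\<And>x. \<bar>cos x\<bar> \<le> cos x * (\<Sum>l<P. c l * cos (real (2 * l + 1) * x)) + \<epsilon>" for P c \<epsilon>
  proof -
    have "\<kappa> (2 * i * n) + \<kappa> (2 * i * n + 2 * n) = 1 / (real (2 * i + 1) ^ s * real n ^ s)" for i
      unfolding \<kappa>(6) power_mult_distrib[symmetric] by (simp add: algebra_simps)
    then have "(\<Sum>i<P. c i * (\<kappa> (2 * i * n) + \<kappa> (2 * i * n + 2 * n))) =
        (\<Sum>l<P. c l / real (2 * l + 1) ^ s) / real n ^ s"
      by (simp add: sum_divide_distrib)
    with mult_bound_modulated_limit[OF \<kappa>(2,3,4) that, of n] show ?thesis
      unfolding l_def[abs_def] by (simp only:)
  qed
  have sharp: "mult_bound l (q / real n ^ s)"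
    if q: "\<And>\<epsilon>. 0 < \<epsilon> \<Longrightarrow> \<exists>P c. (\<forall>x. \<bar>cos x\<bar> \<le> cos x * (\<Sum>l<P. c l * cos (real (2 * l + 1) * x)) + \<epsilon>) \<and>
      (\<Sum>l<P. c l / real (2 * l + 1) ^ s) \<le> q" for q
  proof (rule mult_bound_limit[where l = "\<lambda>i. l" and C = "\<lambda>i. q / real n ^ s + 2 * (1 / real (Suc i)) * \<kappa> 0"])
    have "(\<lambda>i. q / real n ^ s + 2 * (1 / real (Suc i)) * \<kappa> 0) \<longlonglongrightarrow> q / real n ^ s + 2 * 0 * \<kappa> 0"
      by (intro tendsto_add tendsto_mult tendsto_const LIMSEQ_Suc[OF lim_1_over_n])
    then show "(\<lambda>i. q / real n ^ s + 2 * (1 / real (Suc i)) * \<kappa> 0) \<longlonglongrightarrow> q / real n ^ s"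
      by simp
    fix i
    obtain P c where Pc: "\<And>x. \<bar>cos x\<bar> \<le> cos x * (\<Sum>l<P. c l * cos (real (2 * l + 1) * x)) + 1 / real (Suc i)"
      "(\<Sum>l<P. c l / real (2 * l + 1) ^ s) \<le> q"
      using q[of "1 / real (Suc i)"] by auto
    show "mult_bound l (q / real n ^ s + 2 * (1 / real (Suc i)) * \<kappa> 0)"
      using mult_bound_mono[OF bound[OF Pc(1)]] Pc(2) by (simp add: divide_right_mono)
  qed simp
  show thesis
  proof
    show "l k = 1 / real k ^ s" if "n \<le> k" for k
    proof -
      from that obtain i where k: "k = n + i" using le_Suc_ex by blast
      then have "nat \<bar>int k - int n\<bar> = i" "k + n = i + 2 * n" by simp_all
      then show ?thesis using \<kappa>(6)[of i] by (simp only: l_def k)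
    qed
    have "mult_bound l (2 * \<kappa> 0)"
      using bound[where P = 0 and c = "\<lambda>_. 0" and \<epsilon> = 1] by simp
    then show "mult_bound l (2 / real n ^ s)"
      by (rule mult_bound_mono) (use \<kappa>(5) in simp)
    show "mult_bound l (pi ^ 2 / 8 / real n ^ s)" if "s = 2"
    proof (rule sharp)
      fix \<epsilon> :: real
      assume "0 < \<epsilon>"
      then show "\<exists>P c. (\<forall>x. \<bar>cos x\<bar> \<le> cos x * (\<Sum>l<P. c l * cos (real (2 * l + 1) * x)) + \<epsilon>) \<and>
          (\<Sum>l<P. c l / real (2 * l + 1) ^ s) \<le> pi ^ 2 / 8"
        unfolding that by (rule odd_cos_majorant) auto
    qed
    show "mult_bound l (5 * pi ^ 4 / 384 / real n ^ s)" if "s = 4"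
    proof (rule sharp)
      fix \<epsilon> :: real
      assume "0 < \<epsilon>"
      then show "\<exists>P c. (\<forall>x. \<bar>cos x\<bar> \<le> cos x * (\<Sum>l<P. c l * cos (real (2 * l + 1) * x)) + \<epsilon>) \<and>
          (\<Sum>l<P. c l / real (2 * l + 1) ^ s) \<le> 5 * pi ^ 4 / 384"
        unfolding that by (rule odd_cos_majorant) auto
    qed
  qed
qed

end

section \<open>Central differences\<close>

text \<open>
  The coefficients, up to sign, of the central difference of order \<open>2 k\<close> after division by the
  middle one.
\<close>

definition binomial_ratio :: "nat \<Rightarrow> nat \<Rightarrow> real" where
  "binomial_ratio k i = real ((2 * k) choose (k + i)) / real ((2 * k) choose k)"

text \<open>The multiplier of the central difference of order \<open>2 k\<close>, equal to \<open>(-4 sin\<^sup>2 (y / 2))\<^sup>k\<close>.\<close>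

definition central_diff :: "nat \<Rightarrow> real \<Rightarrow> real" where
  "central_diff k y = (\<Sum>i\<le>2*k. (-1) ^ i * real ((2 * k) choose i) * cos ((real i - real k) * y))"

lemma central_diff_even: "central_diff k (- y) = central_diff k y"
  unfolding central_diff_def by (simp flip: minus_mult_right)

lemma central_diff_0: "0 < k \<Longrightarrow> central_diff k 0 = 0"
  using choose_alternating_sum[of "2 * k", where 'a = real] by (simp add: central_diff_def)

lemma central_diff_eq:
  "(-1) ^ k / real ((2 * k) choose k) * central_diff k y =
    1 - 2 * (\<Sum>i<k. (-1) ^ i * binomial_ratio k (Suc i) * cos (real (Suc i) * y))"
proof -
  define F where "F i = (-1) ^ i * real ((2 * k) choose i) * cos ((real i - real k) * y)" for i
  have "{..2*k} = {..<k} \<union> {k} \<union> {Suc k..2*k}" by auto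
  then have "central_diff k y = (\<Sum>i<k. F i) + F k + (\<Sum>i=Suc k..2*k. F i)"
    unfolding central_diff_def F_def[symmetric]
    by (simp only:) (subst sum.union_disjoint; auto simp: sum.union_disjoint)+
  also have "(\<Sum>i=Suc k..2*k. F i) = (\<Sum>i<k. F (k + Suc i))"
    by (rule sum.reindex_bij_witness[of _ "\<lambda>i. k + Suc i" "\<lambda>i. i - Suc k"]) auto
  also have "(\<Sum>i<k. F i) = (\<Sum>i<k. F (k - Suc i))"
    by (rule sum.nat_diff_reindex[symmetric])
  also have "\<dots> = (\<Sum>i<k. F (k + Suc i))"
  proof (rule sum.cong[OF refl])
    fix i assume "i \<in> {..<k}"
    then have i: "Suc i \<le> k" by simp
    have 1: "(2 * k) choose (k - Suc i) = (2 * k) choose (k + Suc i)"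
      using binomial_symmetric[of "k - Suc i" "2 * k"] i by (simp add: mult_2)
    have 2: "(-1::real) ^ (k + Suc i) = (-1) ^ (k - Suc i)"
    proof -
      have "k + Suc i = (k - Suc i) + 2 * Suc i" using i by simp
      then show ?thesis by (simp only: power_add power_mult) simp
    qed
    have 3: "(real (k - Suc i) - real k) * y = - ((real (k + Suc i) - real k) * y)"
      using i by (simp add: of_nat_diff algebra_simps)
    show "F (k - Suc i) = F (k + Suc i)"
      unfolding F_def 1 2 3 cos_minus ..
  qed
  finally have "central_diff k y = F k + 2 * (\<Sum>i<k. F (k + Suc i))" by simp
  moreover have "(-1) ^ k / real ((2 * k) choose k) * F k = 1"
    by (simp add: F_def flip: power_mult_distrib)
  moreover have "(-1) ^ k / real ((2 * k) choose k) * F (k + Suc i) =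
      - ((-1) ^ i * binomial_ratio k (Suc i) * cos (real (Suc i) * y))" for i
  proof -
    have "(-1::real) ^ k * (-1) ^ (k + Suc i) = - ((-1) ^ i)"
      by (simp add: power_add flip: power_mult_distrib mult.assoc)
    then have "(-1) ^ k * F (k + Suc i) =
        - ((-1) ^ i) * real ((2 * k) choose (k + Suc i)) * cos (real (Suc i) * y)"
      unfolding F_def mult.assoc[symmetric] by simp
    then show ?thesis by (simp add: binomial_ratio_def)
  qed
  ultimately have "(-1) ^ k / real ((2 * k) choose k) * central_diff k y =
      1 + 2 * (\<Sum>i<k. - ((-1) ^ i * binomial_ratio k (Suc i) * cos (real (Suc i) * y)))"
    by (simp only: distrib_left sum_distrib_left mult.left_commute[of _ 2])
  then show ?thesis by (simp only: sum_negf)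
qed

lemma fin_diff_Suc: "fin_diff (Suc r) t f x = fin_diff r t f x - fin_diff r t f (x + t)"
proof -
  let ?c = "\<lambda>i. (-1) ^ i * f (x + real i * t)"
  have "fin_diff (Suc r) t f x = ?c 0 + (\<Sum>i\<le>r. real (Suc r choose Suc i) * ?c (Suc i))"
    unfolding fin_diff_def by (subst sum.atMost_Suc_shift) (simp add: mult_ac del: binomial_Suc_Suc)
  also have "\<dots> = ?c 0 + (\<Sum>i\<le>r. real (r choose Suc i) * ?c (Suc i)) + (\<Sum>i\<le>r. real (r choose i) * ?c (Suc i))"
    by (simp add: distrib_right sum.distrib del: power_Suc of_nat_Suc)
  also have "?c 0 + (\<Sum>i\<le>r. real (r choose Suc i) * ?c (Suc i)) = (\<Sum>i\<le>Suc r. real (r choose i) * ?c i)"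
    by (subst sum.atMost_Suc_shift) simp
  also have "\<dots> = fin_diff r t f x"
    by (simp add: fin_diff_def mult_ac)
  also have "(\<Sum>i\<le>r. real (r choose i) * ?c (Suc i)) = - fin_diff r t f (x + t)"
    unfolding fin_diff_def sum_negf[symmetric] by (intro sum.cong) (simp_all add: algebra_simps)
  finally show ?thesis by simp
qed

lemma fin_diff_diff: "fin_diff r t (\<lambda>x. f x - g x) x = fin_diff r t f x - fin_diff r t g x"
  by (simp add: fin_diff_def sum_subtractf[symmetric] algebra_simps)

context shift_invariant_seminorm
begin

lemma X_fin_diff: "f \<in> X \<Longrightarrow> fin_diff r t f \<in> X"
  unfolding fin_diff_def[abs_def] by (intro X_sum X_scale X_shift) auto

lemma N_fin_diff_le:
  assumes "f \<in> X"
  shows "N (fin_diff r t f) \<le> 2 ^ r * N f"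
proof -
  have "N (fin_diff r t f) \<le> (\<Sum>i\<le>r. N (\<lambda>x. (-1) ^ i * real (r choose i) * f (x + real i * t)))"
    unfolding fin_diff_def[abs_def] using assms by (intro N_sum X_scale X_shift) auto
  also have "\<dots> = (\<Sum>i\<le>r. real (r choose i) * N f)"
    using N_scale[OF X_shift[OF assms]] N_shift[OF assms] by (simp add: abs_mult)
  also have "\<dots> = 2 ^ r * N f"
    using choose_row_sum[of r] by (simp flip: sum_distrib_right of_nat_sum)
  finally show ?thesis .
qed

lemma N_fin_diff_Suc_le:
  assumes "f \<in> X"
  shows "N (fin_diff (Suc r) t f) \<le> 2 * N (fin_diff r t f)"
proof -
  have "N (fin_diff (Suc r) t f) \<le> N (fin_diff r t f) + N (\<lambda>x. fin_diff r t f (x + t))"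
    unfolding fin_diff_Suc[abs_def] by (intro N_diff_le X_shift X_fin_diff assms)
  then show ?thesis using N_shift[OF X_fin_diff[OF assms], of r t t] by simp
qed

lemma act_central_diff:
  "act (\<lambda>j. central_diff k (real j * t)) M a b x = fin_diff (2 * k) t (trig_poly M a b) (x - real k * t)"
proof -
  let ?f = "trig_poly M a b"
  define c where "c i = (-1) ^ i * real ((2 * k) choose i)" for i
  have "act (\<lambda>j. central_diff k (real j * t)) M a b x =
      (\<Sum>i\<le>2*k. c i * act (\<lambda>j. cos (real j * ((real i - real k) * t))) M a b x)"
    unfolding act_def trig_poly_def central_diff_def c_def sum_distrib_left sum_distrib_right
      sum.distrib[symmetric]
    by (subst sum.swap) (simp add: algebra_simps)
  also have "\<dots> = ((\<Sum>i\<le>2*k. c i * ?f (x + (real i - real k) * t)) +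
      (\<Sum>i\<le>2*k. c i * ?f (x - (real i - real k) * t))) / 2"
    unfolding act_cos by (simp add: sum_divide_distrib sum.distrib[symmetric] algebra_simps)
  also have "(\<Sum>i\<le>2*k. c i * ?f (x - (real i - real k) * t)) =
      (\<Sum>i\<le>2*k. c i * ?f (x + (real i - real k) * t))"
  proof (rule sum.reindex_bij_witness[of _ "\<lambda>i. 2 * k - i" "\<lambda>i. 2 * k - i"])
    fix i assume "i \<in> {..2 * k}"
    then have i: "i \<le> 2 * k" by simp
    have "(-1::real) ^ (2 * k - i) = (-1) ^ i"
      using i by (simp add: minus_one_power_iff)
    then have "c (2 * k - i) = c i"
      using binomial_symmetric[OF i] by (simp add: c_def)
    moreover have "x + (real (2 * k - i) - real k) * t = x - (real i - real k) * t"
      using i by (simp add: of_nat_diff algebra_simps)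
    ultimately show "c (2 * k - i) * ?f (x + (real (2 * k - i) - real k) * t) =
        c i * ?f (x - (real i - real k) * t)" by simp
  qed auto
  also have "((\<Sum>i\<le>2*k. c i * ?f (x + (real i - real k) * t)) +
      (\<Sum>i\<le>2*k. c i * ?f (x + (real i - real k) * t))) / 2 = fin_diff (2 * k) t ?f (x - real k * t)"
    by (simp add: fin_diff_def c_def algebra_simps)
  finally show ?thesis .
qed

lemma N_central_diff_le:
  assumes "0 < k" "0 \<le> \<omega>" "\<bar>t\<bar> \<le> h"
    and \<omega>: "\<And>t. 0 < t \<Longrightarrow> t \<le> h \<Longrightarrow> N (fin_diff (2 * k) t (trig_poly M a b)) \<le> \<omega>"
  shows "N (act (\<lambda>j. central_diff k (real j * t)) M a b) \<le> \<omega>"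
proof (cases "t = 0")
  case True
  then show ?thesis
    using assms by (simp add: central_diff_0 act_def trig_poly_def N_zero)
next
  case False
  have "central_diff k (real j * t) = central_diff k (real j * \<bar>t\<bar>)" for j
    using central_diff_even[of k "real j * t"] by (cases "0 \<le> t") auto
  then have "act (\<lambda>j. central_diff k (real j * t)) M a b =
      (\<lambda>x. fin_diff (2 * k) \<bar>t\<bar> (trig_poly M a b) (x + - (real k * \<bar>t\<bar>)))"
    using act_central_diff[of k "\<bar>t\<bar>" M a b] by (intro ext) (simp only: diff_conv_add_uminus)
  then have "N (act (\<lambda>j. central_diff k (real j * t)) M a b) =
      N (\<lambda>x. fin_diff (2 * k) \<bar>t\<bar> (trig_poly M a b) (x + - (real k * \<bar>t\<bar>)))"
    by (simp only:)
  also have "\<dots> = N (fin_diff (2 * k) \<bar>t\<bar> (trig_poly M a b))"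
    by (intro N_shift X_fin_diff X_trig_poly)
  also have "\<dots> \<le> \<omega>" using assms False by auto
  finally show ?thesis .
qed

text \<open>
  Averaging the normalised central difference over its step, with any even probability
  distribution on \<open>[-h, h]\<close>, leaves the identity minus an averaging operator.
\<close>

lemma N_averaged_diff_le:
  assumes "Q \<in> averages h" "0 < k" "0 \<le> \<omega>"
    and \<omega>: "\<And>t. 0 < t \<Longrightarrow> t \<le> h \<Longrightarrow> N (fin_diff (2 * k) t (trig_poly M a b)) \<le> \<omega>"
  shows "N (act (\<lambda>j. 1 - 2 * (\<Sum>i<k. (-1) ^ i * binomial_ratio k (Suc i) * Q (real (Suc i) * real j))) M a b)
    \<le> \<omega> / real ((2 * k) choose k)"
  using assms(1)
proof (induction rule: averages.induct)
  case (point t)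
  have "1 - 2 * (\<Sum>i<k. (-1) ^ i * binomial_ratio k (Suc i) * cos (real (Suc i) * real j * t)) =
      (-1) ^ k / real ((2 * k) choose k) * central_diff k (real j * t)" for j
    unfolding central_diff_eq by (simp only: mult.assoc)
  then show ?case
    using N_central_diff_le[OF assms(2,3) point \<omega>]
    by (simp only: N_act_scale) (simp add: power_abs divide_right_mono)
next
  case (mix p q s)
  let ?w = "\<lambda>Q j. 1 - 2 * (\<Sum>i<k. (-1) ^ i * binomial_ratio k (Suc i) * Q (real (Suc i) * real j))"
  have "?w (\<lambda>y. s * p y + (1 - s) * q y) j = s * ?w p j + (1 - s) * ?w q j" for j
    by (simp add: algebra_simps sum.distrib sum_distrib_left sum_subtractf)
  then have "N (act (?w (\<lambda>y. s * p y + (1 - s) * q y)) M a b)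
      \<le> N (act (\<lambda>j. s * ?w p j) M a b) + N (act (\<lambda>j. (1 - s) * ?w q j) M a b)"
    using N_act_add by presburger
  also have "\<dots> \<le> s * (\<omega> / real ((2 * k) choose k)) + (1 - s) * (\<omega> / real ((2 * k) choose k))"
    unfolding N_act_scale using mix by (intro add_mono mult_mono N_nonneg X_act) auto
  also have "\<dots> = \<omega> / real ((2 * k) choose k)"
    by (simp only: distrib_right[symmetric]) simp
  finally show ?case .
next
  case (limit P p)
  show ?case
  proof (rule LIMSEQ_le_const2)
    show "(\<lambda>i'. N (act (\<lambda>j. 1 - 2 * (\<Sum>i<k. (-1) ^ i * binomial_ratio k (Suc i) * P i' (real (Suc i) * real j))) M a b))
      \<longlonglongrightarrow> N (act (\<lambda>j. 1 - 2 * (\<Sum>i<k. (-1) ^ i * binomial_ratio k (Suc i) * p (real (Suc i) * real j))) M a b)"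
      by (intro N_act_tendsto tendsto_intros limit.hyps)
  qed (use limit.IH in auto)
qed

section \<open>Jackson--Stechkin estimates for trigonometric polynomials\<close>

text \<open>Frequencies below \<open>n\<close> can be approximated away, so only the others constrain the multiplier.\<close>

lemma approximant_of_multiplier:
  assumes "0 < n" "\<And>j. n \<le> j \<Longrightarrow> l j = 1"
  shows "\<exists>\<tau>\<in>trig_polys (n - 1). (\<lambda>x. trig_poly M a b x - \<tau> x) = act l M a b"
proof
  let ?c = "\<lambda>a k. if k \<le> M then (1 - l k) * a k else 0"
  show "trig_poly (n - 1) (?c a) (?c b) \<in> trig_polys (n - 1)"
    by (rule trig_poly_in_trig_polys)
  have "trig_poly (n - 1) (?c a) (?c b) x = trig_poly M (?c a) (?c b) x" for x
  proof -
    have out: "l k = 1" if "\<not> k \<le> n - 1" for k using assms(2)[of k] that by linarith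
    let ?g = "\<lambda>k. ?c a k * cos (real k * x) + ?c b k * sin (real k * x)"
    have "(\<Sum>k\<le>n - 1. ?g k) = (\<Sum>k\<in>{..n - 1} \<inter> {..M}. ?g k)"
      by (rule sum.mono_neutral_right) auto
    also have "\<dots> = (\<Sum>k\<le>M. ?g k)"
    proof (rule sum.mono_neutral_left)
      show "\<forall>i\<in>{..M} - {..n - 1} \<inter> {..M}. ?g i = 0"
      proof
        fix i assume "i \<in> {..M} - {..n - 1} \<inter> {..M}"
        then have "l i = 1" by (intro out) auto
        then show "?g i = 0" by simp
      qed
    qed auto
    finally show ?thesis by (simp add: trig_poly_def)
  qed
  moreover have "trig_poly M (?c a) (?c b) x = trig_poly M a b x - act l M a b x" for x
    by (simp add: act_def trig_poly_def sum_subtractf[symmetric] algebra_simps)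
  ultimately show "(\<lambda>x. trig_poly M a b x - trig_poly (n - 1) (?c a) (?c b) x) = act l M a b"
    by simp
qed

text \<open>
  The inequality of order \<open>2 k\<close> for trigonometric polynomials.  The slack \<open>\<epsilon>\<close> absorbs the
  remainder of the Neumann series.
\<close>

definition poly_jackson :: "nat \<Rightarrow> nat \<Rightarrow> real \<Rightarrow> real \<Rightarrow> bool" where
  "poly_jackson k n h c \<longleftrightarrow> (\<forall>M a b \<omega> \<epsilon>. 0 \<le> \<omega> \<longrightarrow> 0 < \<epsilon> \<longrightarrow>
    (\<forall>t. 0 < t \<longrightarrow> t \<le> h \<longrightarrow> N (fin_diff (2 * k) t (trig_poly M a b)) \<le> \<omega>) \<longrightarrow>
    (\<exists>\<tau>\<in>trig_polys (n - 1). N (\<lambda>x. trig_poly M a b x - \<tau> x) \<le> c * (\<omega> / real ((2 * k) choose k)) + \<epsilon>))"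

lemma poly_jacksonI:
  assumes "0 < n"
    and "\<And>M a b \<omega> \<epsilon>. 0 \<le> \<omega> \<Longrightarrow> 0 < \<epsilon> \<Longrightarrow>
      (\<And>t. 0 < t \<Longrightarrow> t \<le> h \<Longrightarrow> N (fin_diff (2 * k) t (trig_poly M a b)) \<le> \<omega>) \<Longrightarrow>
      \<exists>l. (\<forall>j\<ge>n. l j = 1) \<and> N (act l M a b) \<le> c * (\<omega> / real ((2 * k) choose k)) + \<epsilon>"
  shows "poly_jackson k n h c"
  unfolding poly_jackson_def
proof (intro allI impI)
  fix M a b \<omega> and \<epsilon> :: real
  assume "0 \<le> \<omega>" "0 < \<epsilon>" "\<forall>t. 0 < t \<longrightarrow> t \<le> h \<longrightarrow> N (fin_diff (2 * k) t (trig_poly M a b)) \<le> \<omega>"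
  then obtain l where l: "\<forall>j\<ge>n. l j = 1" "N (act l M a b) \<le> c * (\<omega> / real ((2 * k) choose k)) + \<epsilon>"
    using assms(2)[of \<omega> \<epsilon> M a b] by blast
  obtain \<tau> where \<tau>: "\<tau> \<in> trig_polys (n - 1)" "(\<lambda>x. trig_poly M a b x - \<tau> x) = act l M a b"
    using approximant_of_multiplier[OF assms(1), of l M a b] l(1) by blast
  show "\<exists>\<tau>\<in>trig_polys (n - 1). N (\<lambda>x. trig_poly M a b x - \<tau> x) \<le> c * (\<omega> / real ((2 * k) choose k)) + \<epsilon>"
    by (rule bexI[OF _ \<tau>(1)]) (simp only: \<tau>(2) l(2))
qed

lemma N_act_mult_le:
  assumes "mult_bound m C" "N (act w M a b) \<le> e" "0 \<le> C"
  shows "N (act (\<lambda>j. m j * w j) M a b) \<le> C * e"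
proof -
  have "N (act (\<lambda>j. m j * w j) M a b) \<le> C * N (act w M a b)"
    unfolding act_mult using mult_boundD[OF assms(1)] by (simp add: act_def)
  also have "\<dots> \<le> C * e" using assms by (intro mult_left_mono)
  finally show ?thesis .
qed

text \<open>
  One averaging step.  The average of \<open>f\<close> over the hat function has the second derivative
  \<open>\<Delta>\<^sup>2f / h\<^sup>2\<close> with step exactly \<open>h\<close>, which the modulus of smoothness controls directly; this costs
  \<open>(\<pi>\<^sup>2 / 8) / (n h)\<^sup>2 = 1 / (8 \<alpha>\<^sup>2)\<close>.
\<close>

lemma poly_jackson_2:
  assumes "0 < n" "0 < \<alpha>"
  shows "poly_jackson 1 n (\<alpha> * pi / real n) (1 + 1 / (4 * \<alpha> ^ 2))"
proof (rule poly_jacksonI[OF assms(1)])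
  fix M a b \<omega> and \<epsilon> :: real
  define h where "h = \<alpha> * pi / real n"
  assume \<omega>: "0 \<le> \<omega>" and \<epsilon>: "0 < \<epsilon>"
    and le: "\<And>t. 0 < t \<Longrightarrow> t \<le> \<alpha> * pi / real n \<Longrightarrow> N (fin_diff (2 * 1) t (trig_poly M a b)) \<le> \<omega>"
  have h: "0 < h" using assms by (simp add: h_def)
  obtain d where d: "\<And>k. n \<le> k \<Longrightarrow> d k = 1 / real k ^ 2" "mult_bound d (pi ^ 2 / 8 / real n ^ 2)"
    by (rule bohr_favard_multiplier[OF assms(1), of 2]) auto
  define Q where "Q y = sinc (y * (h / 2)) ^ 2" for y
  have Q: "Q \<in> averages h" unfolding Q_def[abs_def] by (rule averages_sinc_power2) (use h in simp)
  define w where "w j = 1 - 2 * (\<Sum>i<1. (-1) ^ i * binomial_ratio 1 (Suc i) * Q (real (Suc i) * real j))" for j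
  have w: "N (act w M a b) \<le> \<omega> / 2"
    unfolding w_def[abs_def] using N_averaged_diff_le[OF Q _ \<omega> le[folded h_def]] by (simp add: numeral_2_eq_2)
  define g where "g j = - central_diff 1 (real j * h)" for j
  have "N (act (\<lambda>j. central_diff 1 (real j * h)) M a b) \<le> \<omega>"
    by (rule N_central_diff_le[OF _ \<omega> _ le[folded h_def]]) (use h in auto)
  then have g: "N (act g M a b) \<le> \<omega>"
    unfolding g_def[abs_def] using N_act_scale[of "-1" "\<lambda>j. central_diff 1 (real j * h)" M a b] by simp
  have one: "w j + d j / h ^ 2 * g j = 1" if "n \<le> j" for j
  proof -
    have j: "0 < real j" using that assms by simp
    have "g j = 4 * sin (real j * h / 2) ^ 2"
      using cos_double_sin[of "real j * h / 2"]
      by (simp add: g_def central_diff_def numeral_2_eq_2 algebra_simps)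
    moreover have "w j = 1 - (sin (real j * h / 2) / (real j * h / 2)) ^ 2"
      using j h by (simp add: w_def Q_def sinc_def binomial_ratio_def numeral_2_eq_2)
    ultimately show ?thesis
      using j h by (simp add: d(1)[OF that] power_divide power_mult_distrib field_simps)
  qed
  have "mult_bound (\<lambda>j. d j / h ^ 2) (pi ^ 2 / 8 / real n ^ 2 / h ^ 2)"
    using mult_bound_scale[OF d(2), of "1 / h ^ 2"] by (simp add: mult_ac)
  from N_act_mult_le[OF this g] have "N (act (\<lambda>j. d j / h ^ 2 * g j) M a b) \<le> pi ^ 2 / 8 / real n ^ 2 / h ^ 2 * \<omega>"
    by simp
  also have "pi ^ 2 / 8 / real n ^ 2 / h ^ 2 = 1 / (4 * \<alpha> ^ 2) / 2"
    using assms by (simp add: h_def power_divide power_mult_distrib field_simps)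
  finally have "N (act (\<lambda>j. w j + d j / h ^ 2 * g j) M a b) \<le> \<omega> / 2 + 1 / (4 * \<alpha> ^ 2) / 2 * \<omega>"
    using N_act_add[of w "\<lambda>j. d j / h ^ 2 * g j" M a b] w by simp
  also have "\<dots> \<le> (1 + 1 / (4 * \<alpha> ^ 2)) * (\<omega> / real ((2 * 1) choose 1)) + \<epsilon>"
    using \<epsilon> by (simp add: field_simps)
  finally show "\<exists>l. (\<forall>j\<ge>n. l j = 1) \<and> N (act l M a b) \<le> (1 + 1 / (4 * \<alpha> ^ 2)) * (\<omega> / real ((2 * 1) choose 1)) + \<epsilon>"
    using one by (intro exI[of _ "\<lambda>j. w j + d j / h ^ 2 * g j"]) blast
qed

end

lemma binomial_ratio_Suc:
  "binomial_ratio k (Suc i) * real (k + i + 1) = binomial_ratio k i * (real k - real i)"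
proof (cases "i \<le> k")
  case True
  have "Suc (k + i) * (2 * k choose Suc (k + i)) = (2 * k - (k + i)) * (2 * k choose (k + i))"
    unfolding binomial_absorption binomial_absorb_comp ..
  moreover have "2 * k - (k + i) = k - i" by simp
  ultimately have "real (Suc (k + i)) * real (2 * k choose Suc (k + i)) = (real k - real i) * real (2 * k choose (k + i))"
    using True by (simp only: of_nat_mult[symmetric] of_nat_diff[symmetric])
  then show ?thesis by (simp add: binomial_ratio_def mult_ac)
next
  case False
  then show ?thesis by (simp add: binomial_ratio_def binomial_eq_0)
qed

lemma binomial_ratio_nonneg: "0 \<le> binomial_ratio k i"
  by (simp add: binomial_ratio_def)

lemma binomial_ratio_zero: "k < i \<Longrightarrow> binomial_ratio k i = 0"
  by (simp add: binomial_ratio_def)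

lemma binomial_ratio_antimono: "binomial_ratio k (Suc i) \<le> binomial_ratio k i"
proof (cases "i \<le> k")
  case True
  have "binomial_ratio k (Suc i) * real (k + i + 1) \<le> binomial_ratio k i * real (k + i + 1)"
    unfolding binomial_ratio_Suc by (intro mult_left_mono binomial_ratio_nonneg) simp
  then show ?thesis by (simp add: mult_le_cancel_right del: of_nat_Suc of_nat_add)
qed (simp add: binomial_ratio_zero)

text \<open>
  Multiplying the ratios of consecutive binomial coefficients gives \<open>1 + i\<^sup>2 / k\<close> as a lower bound
  for the reciprocal.
\<close>

lemma binomial_ratio_le: "i \<le> k \<Longrightarrow> binomial_ratio k i * (real k + real i ^ 2) \<le> real k"
proof (induction i)
  case 0
  then show ?case by (simp add: binomial_ratio_def)
next
  case (Suc i)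
  define x y where "x = real k" and "y = real i"
  have xy: "0 \<le> y" "y + 1 \<le> x" using Suc.prems by (simp_all add: x_def y_def)
  have "(x - y) * (x + (y + 1) ^ 2) \<le> (x + y ^ 2) * (x + y + 1)"
  proof -
    have "(x + y ^ 2) * (x + y + 1) - (x - y) * (x + (y + 1) ^ 2) = 2 * y ^ 3 + 3 * y ^ 2 + y"
      by (simp add: power2_eq_square power3_eq_cube algebra_simps)
    moreover have "0 \<le> 2 * y ^ 3 + 3 * y ^ 2 + y" using xy by simp
    ultimately show ?thesis by simp
  qed
  then have "binomial_ratio k i * ((x - y) * (x + (y + 1) ^ 2)) \<le> binomial_ratio k i * ((x + y ^ 2) * (x + y + 1))"
    by (intro mult_left_mono binomial_ratio_nonneg)
  also have "\<dots> \<le> x * (x + y + 1)"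
    using Suc xy by (simp add: x_def y_def mult.assoc[symmetric] mult_right_mono)
  also have "binomial_ratio k i * ((x - y) * (x + (y + 1) ^ 2)) =
      binomial_ratio k (Suc i) * (x + (y + 1) ^ 2) * (x + y + 1)"
  proof -
    have "binomial_ratio k (Suc i) * (x + y + 1) = binomial_ratio k i * (x - y)"
      using binomial_ratio_Suc[of k i] by (simp only: x_def y_def of_nat_add of_nat_1)
    then show ?thesis by (metis mult.assoc mult.commute)
  qed
  finally have "binomial_ratio k (Suc i) * (x + (y + 1) ^ 2) \<le> x"
    using xy by (simp add: mult_le_cancel_right)
  then show ?case by (simp add: x_def y_def add_ac)
qed

text \<open>
  With the hat function on \<open>[-h, h]\<close> as weight, the second derivative of the kernel of the averaging
  operator is a measure of total variation
  \<open>8 odd_ratio_sum k / h\<^sup>2\<close>.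
\<close>

definition odd_ratio_sum :: "nat \<Rightarrow> real" where
  "odd_ratio_sum k = (\<Sum>m<k. binomial_ratio k (2 * m + 1) / real (2 * m + 1) ^ 2)"

text \<open>The value of the full series, from Euler's \<open>\<pi>\<^sup>2 / 6\<close> by removing the even terms.\<close>

lemma odd_squares_sum_le: "(\<Sum>m<k. 1 / real (2 * m + 1) ^ 2) \<le> pi ^ 2 / 8"
proof -
  define H where "H k = (\<Sum>m<k. 1 / real (m + 1) ^ 2)" for k
  define O1 where "O1 k = (\<Sum>m<k. 1 / real (2 * m + 1) ^ 2)" for k
  have eq: "O1 k = H (2 * k) - H k / 4" for k
  proof (induction k)
    case (Suc k)
    define p r where "p = 1 / real (2 * k + 1) ^ 2" and "r = 1 / real (k + 1) ^ 2"
    have "1 / real (2 * k + 2) ^ 2 = r / 4"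
      by (simp add: r_def field_simps power2_eq_square)
    then have "H (2 * Suc k) = H (2 * k) + p + r / 4"
      by (simp add: H_def p_def)
    moreover have "O1 (Suc k) = O1 k + p" "H (Suc k) = H k + r"
      by (simp_all add: O1_def H_def p_def r_def)
    ultimately show ?case using Suc by (simp add: field_simps)
  qed (simp add: H_def O1_def)
  have H: "H \<longlonglongrightarrow> pi ^ 2 / 6"
    using inverse_squares_sums by (simp add: H_def[abs_def] sums_def add.commute)
  have "strict_mono ((*) (2::nat))" by (simp add: strict_mono_def)
  from LIMSEQ_subseq_LIMSEQ[OF H this] have "(\<lambda>k. H (2 * k)) \<longlonglongrightarrow> pi ^ 2 / 6"
    by (simp add: o_def)
  then have "O1 \<longlonglongrightarrow> pi ^ 2 / 6 - pi ^ 2 / 6 / 4"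
    unfolding eq by (intro tendsto_intros H) auto
  moreover have "incseq O1" by (rule incseq_SucI) (simp add: O1_def)
  ultimately have "O1 k \<le> pi ^ 2 / 6 - pi ^ 2 / 6 / 4" by (intro incseq_le)
  then show ?thesis by (simp add: O1_def)
qed

text \<open>
  About \<open>\<surd>k / 2\<close> odd numbers \<open>i\<close> satisfy \<open>i\<^sup>2 \<le> k\<close>; for each of them the ratio falls short of \<open>1\<close> by
  a fraction \<open>i\<^sup>2 / (2 k)\<close> at least.
\<close>

lemma odd_ratio_sum_le:
  assumes "0 < k"
  shows "odd_ratio_sum k \<le> pi ^ 2 / 8 - 1 / (8 * sqrt (real k))"
proof -
  define s where "s = sqrt (real k)"
  have s: "1 \<le> s" "s * s = real k" using assms by (simp_all add: s_def)
  define K where "K = nat \<lfloor>(s + 1) / 2\<rfloor>"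
  have K1: "real K \<le> (s + 1) / 2"
    using s of_int_floor_le[of "(s + 1) / 2"] unfolding K_def by (subst of_nat_nat) auto
  have K2: "s / 4 \<le> real K"
  proof -
    have "1 \<le> \<lfloor>(s + 1) / 2\<rfloor>" using s by simp
    then have "real K = of_int \<lfloor>(s + 1) / 2\<rfloor>" "1 \<le> real_of_int \<lfloor>(s + 1) / 2\<rfloor>"
      by (simp_all add: K_def)
    moreover have "(s + 1) / 2 - 1 < of_int \<lfloor>(s + 1) / 2\<rfloor>" by linarith
    ultimately have "1 \<le> real K" "(s + 1) / 2 - 1 < real K" by simp_all
    then show ?thesis by (simp add: field_simps)
  qed
  have "(s + 1) / 2 \<le> s" using s(1) by simp
  also have "\<dots> \<le> s * s" using mult_left_mono[of 1 s s] s(1) by simp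
  finally have "real K \<le> real k" using K1 unfolding s(2) by (rule order_trans[rotated])
  then have Kk: "K \<le> k" by simp
  define F where "F m = (1 - binomial_ratio k (2 * m + 1)) / real (2 * m + 1) ^ 2" for m
  have F0: "0 \<le> F m" for m
  proof -
    have "binomial_ratio k i \<le> 1" for i
    proof (induction i)
      case 0
      show ?case by (simp add: binomial_ratio_def)
    next
      case (Suc i)
      with binomial_ratio_antimono[of k i] show ?case by linarith
    qed
    then show ?thesis by (simp add: F_def)
  qed
  have F1: "1 / (2 * real k) \<le> F m" if "m < K" for m
  proof -
    define y where "y = real (2 * m + 1)"
    have "real m + 1 \<le> real K" using that by linarith
    then have y: "1 \<le> y" "y \<le> s" using K1 by (simp_all add: y_def)
    have y2: "y ^ 2 \<le> real k" using mult_mono[OF y(2) y(2)] y s by (simp add: power2_eq_square)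
    have "y \<le> y ^ 2" using y by (simp add: power2_eq_square mult_le_cancel_left1)
    then have "2 * m + 1 \<le> k" using y2 by (simp add: y_def)
    from binomial_ratio_le[OF this] have "binomial_ratio k (2 * m + 1) * (real k + y ^ 2) \<le> real k"
      unfolding y_def .
    then have "y ^ 2 \<le> (1 - binomial_ratio k (2 * m + 1)) * (real k + y ^ 2)"
      by (simp add: algebra_simps)
    also have "\<dots> \<le> (1 - binomial_ratio k (2 * m + 1)) * (2 * real k)"
    proof (rule mult_left_mono)
      show "0 \<le> 1 - binomial_ratio k (2 * m + 1)"
        using F0[of m] y by (simp add: F_def zero_le_divide_iff y_def)
    qed (use y2 in simp)
    finally have "y ^ 2 \<le> (1 - binomial_ratio k (2 * m + 1)) * (2 * real k)" .
    moreover have "0 < y ^ 2" "0 < 2 * real k" using y assms by simp_all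
    ultimately show ?thesis unfolding F_def y_def[symmetric] by (simp add: field_simps)
  qed
  have "1 / (8 * s) = (s / 4) * (1 / (2 * real k))" using s(1) unfolding s(2)[symmetric] by (simp add: field_simps)
  also have "\<dots> \<le> real K * (1 / (2 * real k))" using K2 by (intro mult_right_mono) auto
  also have "\<dots> \<le> (\<Sum>m<K. F m)" using sum_mono[of "{..<K}" "\<lambda>_. 1 / (2 * real k)" F] F1 by simp
  also have "\<dots> \<le> (\<Sum>m<k. F m)" using Kk F0 by (intro sum_mono2) auto
  also have "\<dots> = (\<Sum>m<k. 1 / real (2 * m + 1) ^ 2) - odd_ratio_sum k"
    by (simp only: F_def odd_ratio_sum_def sum_subtractf diff_divide_distrib)
  finally show ?thesis using odd_squares_sum_le[of k] by (simp add: s_def)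
qed

lemma odd_ratio_sum_nonneg: "0 \<le> odd_ratio_sum k"
  unfolding odd_ratio_sum_def by (intro sum_nonneg divide_nonneg_nonneg binomial_ratio_nonneg) auto

lemma alternating_finite_sum_bounds:
  fixes c :: "nat \<Rightarrow> real"
  assumes "\<And>i. 0 \<le> c i" "\<And>i. c (Suc i) \<le> c i"
  shows "0 \<le> (\<Sum>i<k. (-1) ^ i * c i) \<and> (\<Sum>i<k. (-1) ^ i * c i) \<le> c 0"
  using assms
proof (induction k arbitrary: c)
  case (Suc k)
  have "(\<Sum>i<Suc k. (-1) ^ i * c i) = c 0 - (\<Sum>i<k. (-1) ^ i * c (Suc i))"
    by (subst sum.lessThan_Suc_shift) (simp add: sum_negf)
  moreover have "0 \<le> (\<Sum>i<k. (-1) ^ i * c (Suc i)) \<and> (\<Sum>i<k. (-1) ^ i * c (Suc i)) \<le> c (Suc 0)"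
    by (rule Suc.IH) (use Suc.prems in auto)
  ultimately show ?case
    using Suc.prems(2)[of 0] by linarith
qed simp

lemma abs_alternating_plus_sum:
  fixes c :: "nat \<Rightarrow> real"
  assumes "\<And>i. 0 \<le> c i" "\<And>i. c (Suc i) \<le> c i" "\<And>i. k \<le> i \<Longrightarrow> c i = 0"
  shows "\<bar>\<Sum>i<k. (-1) ^ i * c i\<bar> + (\<Sum>i<k. c i) = 2 * (\<Sum>m<k. c (2 * m))"
proof -
  have pairs: "(\<Sum>i<2*k. f i) = (\<Sum>m<k. f (2 * m) + f (2 * m + 1))" for f :: "nat \<Rightarrow> real" and k
    by (induction k) auto
  have ext: "(\<Sum>i<k. e i * c i) = (\<Sum>i<2*k. e i * c i)" for e
    by (rule sum.mono_neutral_left) (use assms(3) in auto)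
  have "\<bar>\<Sum>i<k. (-1) ^ i * c i\<bar> = (\<Sum>i<k. (-1) ^ i * c i)"
    using alternating_finite_sum_bounds[of c k] assms by simp
  then show ?thesis
    using ext[of "\<lambda>i. (-1) ^ i"] ext[of "\<lambda>i. 1"] unfolding pairs
    by (simp add: sum.distrib[symmetric] sum_distrib_left sum_negf)
qed

context shift_invariant_seminorm
begin

text \<open>
  As for the second order, with the cubic B-spline: the fourth derivative of the average consists of
  the fourth differences with steps \<open>h / 2\<close> and \<open>h\<close>, whose coefficients \<open>64 / 3\<close> and \<open>1 / 3\<close> come
  from \<open>16 \<sqdot> 2 \<sqdot> 2/3\<close> and \<open>2 \<sqdot> 1/6\<close>.
\<close>

lemma poly_jackson_4:
  assumes "0 < n" "0 < \<alpha>"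
  shows "poly_jackson 2 n (\<alpha> * pi / real n) (1 + 325 / (192 * \<alpha> ^ 4))"
proof (rule poly_jacksonI[OF assms(1)])
  fix M a b \<omega> and \<epsilon> :: real
  define h where "h = \<alpha> * pi / real n"
  assume \<omega>: "0 \<le> \<omega>" and \<epsilon>: "0 < \<epsilon>"
    and le: "\<And>t. 0 < t \<Longrightarrow> t \<le> \<alpha> * pi / real n \<Longrightarrow> N (fin_diff (2 * 2) t (trig_poly M a b)) \<le> \<omega>"
  have h: "0 < h" using assms by (simp add: h_def)
  obtain d where d: "\<And>k. n \<le> k \<Longrightarrow> d k = 1 / real k ^ 4" "mult_bound d (5 * pi ^ 4 / 384 / real n ^ 4)"
    by (rule bohr_favard_multiplier[OF assms(1), of 4]) auto
  define Q where "Q y = sinc (y * (h / 4)) ^ 4" for y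
  have Q: "Q \<in> averages h" unfolding Q_def[abs_def] by (rule averages_sinc_power4) (use h in simp)
  have ratios: "binomial_ratio 2 1 = 2 / 3" "binomial_ratio 2 2 = 1 / 6" "real ((2 * 2) choose 2) = 6"
    by (simp_all add: binomial_ratio_def eval_nat_numeral)
  define w where "w j = 1 - 2 * (\<Sum>i<2. (-1) ^ i * binomial_ratio 2 (Suc i) * Q (real (Suc i) * real j))" for j
  have w: "N (act w M a b) \<le> \<omega> / 6"
    using N_averaged_diff_le[OF Q pos2 \<omega> le[folded h_def]] unfolding w_def[abs_def] ratios .
  have w_eq: "w j = 1 - 4 / 3 * Q (real j) + 1 / 3 * Q (2 * real j)" for j
  proof -
    have "(\<Sum>i<2. f i) = f 0 + f 1" for f :: "nat \<Rightarrow> real" by (simp add: numeral_2_eq_2)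
    moreover have "binomial_ratio 2 (Suc 0) = 2 / 3" "binomial_ratio 2 (Suc 1) = 1 / 6"
      using ratios by (simp_all add: numeral_2_eq_2)
    moreover have "real (Suc 0) * real j = real j" "real (Suc 1) * real j = 2 * real j" by simp_all
    ultimately have "w j = 1 - 2 * ((-1) ^ 0 * (2 / 3) * Q (real j) + (-1) ^ 1 * (1 / 6) * Q (2 * real j))"
      unfolding w_def by (simp only:)
    then show ?thesis by simp
  qed
  have cd: "N (act (\<lambda>j. central_diff 2 (real j * t)) M a b) \<le> \<omega>" if "0 < t" "t \<le> h" for t
    by (rule N_central_diff_le[OF _ \<omega> _ le[folded h_def]]) (use that in auto)
  have cd_eq: "central_diff 2 y = 16 * sin (y / 2) ^ 4" for y
  proof -
    have 1: "cos y = 1 - 2 * sin (y / 2) ^ 2" using cos_double_sin[of "y / 2"] by simp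
    have 2: "cos (2 * y) = 2 * cos y ^ 2 - 1" by (rule cos_double_cos)
    have "central_diff 2 y = 2 * cos (2 * y) - 8 * cos y + 6"
      by (simp add: central_diff_def eval_nat_numeral)
    then show ?thesis unfolding 2 1 by algebra
  qed
  define g where "g j = 64 / 3 * central_diff 2 (real j * (h / 2)) + - (1 / 3) * central_diff 2 (real j * h)" for j
  have g: "N (act g M a b) \<le> 65 / 3 * \<omega>"
  proof -
    have "N (act g M a b) \<le> N (act (\<lambda>j. 64 / 3 * central_diff 2 (real j * (h / 2))) M a b) +
        N (act (\<lambda>j. - (1 / 3) * central_diff 2 (real j * h)) M a b)"
      unfolding g_def[abs_def] by (rule N_act_add)
    also have "\<dots> \<le> 64 / 3 * \<omega> + 1 / 3 * \<omega>"
      unfolding N_act_scale using cd[of "h / 2"] cd[of h] h by simp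
    finally show ?thesis by simp
  qed
  have one: "w j + d j / h ^ 4 * g j = 1" if "n \<le> j" for j
  proof -
    have j: "0 < real j" using that assms by simp
    have "Q (real j) = 256 * sin (real j * h / 4) ^ 4 / (real j * h) ^ 4"
      using j h by (simp add: Q_def sinc_def power_divide)
    moreover have "Q (2 * real j) = 16 * sin (real j * h / 2) ^ 4 / (real j * h) ^ 4"
    proof -
      have "Q (2 * real j) = (sin (real j * h / 2) / (real j * h / 2)) ^ 4"
        using j h by (simp add: Q_def sinc_def mult_ac)
      then show ?thesis by (simp add: power_divide)
    qed
    ultimately have "w j = 1 - (1024 / 3 * sin (real j * h / 4) ^ 4 - 16 / 3 * sin (real j * h / 2) ^ 4) / (real j * h) ^ 4"
      by (simp add: w_eq diff_divide_distrib)
    moreover have "g j = 1024 / 3 * sin (real j * h / 4) ^ 4 - 16 / 3 * sin (real j * h / 2) ^ 4"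
      by (simp add: g_def cd_eq)
    ultimately show ?thesis
      using j h by (simp add: d(1)[OF that] power_mult_distrib)
  qed
  have "mult_bound (\<lambda>j. d j / h ^ 4) (5 * pi ^ 4 / 384 / real n ^ 4 / h ^ 4)"
    using mult_bound_scale[OF d(2), of "1 / h ^ 4"] by (simp add: mult_ac)
  from N_act_mult_le[OF this g] have "N (act (\<lambda>j. d j / h ^ 4 * g j) M a b) \<le> 5 * pi ^ 4 / 384 / real n ^ 4 / h ^ 4 * (65 / 3 * \<omega>)"
    by simp
  also have "5 * pi ^ 4 / 384 / real n ^ 4 / h ^ 4 = 5 / (384 * \<alpha> ^ 4)"
    using assms by (simp add: h_def power_divide power_mult_distrib field_simps)
  finally have "N (act (\<lambda>j. w j + d j / h ^ 4 * g j) M a b) \<le> \<omega> / 6 + 5 / (384 * \<alpha> ^ 4) * (65 / 3 * \<omega>)"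
    using N_act_add[of w "\<lambda>j. d j / h ^ 4 * g j" M a b] w by simp
  also have "\<dots> = (1 + 325 / (192 * \<alpha> ^ 4)) * (\<omega> / 6)"
    using assms by (simp add: field_simps)
  also have "\<dots> \<le> (1 + 325 / (192 * \<alpha> ^ 4)) * (\<omega> / 6) + \<epsilon>" using \<epsilon> by simp
  finally show "\<exists>l. (\<forall>j\<ge>n. l j = 1) \<and> N (act l M a b) \<le> (1 + 325 / (192 * \<alpha> ^ 4)) * (\<omega> / real ((2 * 2) choose 2)) + \<epsilon>"
    unfolding ratios using one by (intro exI[of _ "\<lambda>j. w j + d j / h ^ 4 * g j"]) blast
qed

text \<open>
  With \<open>u\<close> the multiplier of the averaging operator \<open>U\<close>, the identity is
  \<open>(1 - u) + (u + \<dots> + u\<^sup>L)(1 - u) + u\<^bsup>L+1\<^esup>\<close>.  For \<open>j \<ge> n\<close> one has \<open>u = \<beta> / j\<^sup>2\<close> with \<open>\<beta>\<close> of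
  norm \<open>B\<close>, hence \<open>u\<^sup>m = \<beta>\<^sup>m / j\<^bsup>2m\<^esup>\<close> has norm at most \<open>2 (B / n\<^sup>2)\<^sup>m\<close>
  modulo polynomials.  Splitting the kernel of
  \<open>u\<^sup>m\<close> in this way, rather than iterating the estimate for \<open>m = 1\<close>, keeps the ratio of the series
  below \<open>1\<close> for every step larger than \<open>\<pi> / n\<close>.
\<close>

lemma poly_jackson_general:
  assumes "0 < k" "0 < n" "0 < \<alpha>" and q: "8 * odd_ratio_sum k \<le> q * (\<alpha> ^ 2 * pi ^ 2)" "q < 1"
  shows "poly_jackson k n (\<alpha> * pi / real n) ((1 + q) / (1 - q))"
proof (rule poly_jacksonI[OF assms(2)])
  fix M a b \<omega> and \<epsilon> :: real
  define h where "h = \<alpha> * pi / real n"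
  assume \<omega>: "0 \<le> \<omega>" and \<epsilon>: "0 < \<epsilon>"
    and le: "\<And>t. 0 < t \<Longrightarrow> t \<le> \<alpha> * pi / real n \<Longrightarrow> N (fin_diff (2 * k) t (trig_poly M a b)) \<le> \<omega>"
  define e where "e = \<omega> / real ((2 * k) choose k)"
  have e0: "0 \<le> e" using \<omega> by (simp add: e_def)
  have h: "0 < h" using assms by (simp add: h_def)
  have q0: "0 \<le> q"
  proof -
    have "0 \<le> q * (\<alpha> ^ 2 * pi ^ 2)" using q(1) odd_ratio_sum_nonneg[of k] by linarith
    moreover have "0 < \<alpha> ^ 2 * pi ^ 2" using assms(3) by simp
    ultimately show ?thesis by (simp only: zero_le_mult_iff) linarith
  qed
  define Q where "Q y = sinc (y * (h / 2)) ^ 2" for y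
  have Q: "Q \<in> averages h" unfolding Q_def[abs_def] by (rule averages_sinc_power2) (use h in simp)
  define u where "u j = 2 * (\<Sum>i<k. (-1) ^ i * binomial_ratio k (Suc i) * Q (real (Suc i) * real j))" for j
  have w: "N (act (\<lambda>j. 1 - u j) M a b) \<le> e"
    unfolding u_def e_def by (rule N_averaged_diff_le[OF Q assms(1) \<omega> le[folded h_def]])
  define c where "c i = binomial_ratio k (Suc i) / real (Suc i) ^ 2" for i
  define \<beta> where "\<beta> j = 4 / h ^ 2 * ((\<Sum>i<k. (-1) ^ i * c i) * 1 +
      (\<Sum>i<k. (- ((-1) ^ i * c i)) * cos (real j * (real (Suc i) * h))))" for j
  define B where "B = 8 * odd_ratio_sum k / h ^ 2"
  have c: "0 \<le> c i" "c (Suc i) \<le> c i" "k \<le> i \<Longrightarrow> c i = 0" for i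
  proof -
    show "0 \<le> c i" by (simp add: c_def binomial_ratio_nonneg)
    show "c (Suc i) \<le> c i" unfolding c_def
      by (intro frac_le binomial_ratio_nonneg binomial_ratio_antimono power_mono) auto
    show "c i = 0" if "k \<le> i" using that by (simp add: c_def binomial_ratio_zero)
  qed
  have \<beta>: "mult_bound \<beta> B"
  proof -
    have "mult_bound \<beta> (\<bar>4 / h ^ 2\<bar> * (\<bar>\<Sum>i<k. (-1) ^ i * c i\<bar> * 1 + (\<Sum>i<k. \<bar>- ((-1) ^ i * c i)\<bar>)))"
      unfolding \<beta>_def[abs_def]
      by (intro mult_bound_scale mult_bound_add mult_bound_one mult_bound_cos_sum) auto
    also have "(\<Sum>i<k. \<bar>- ((-1) ^ i * c i)\<bar>) = (\<Sum>i<k. c i)"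
      using c(1) by (simp add: abs_mult power_abs)
    also have "\<bar>\<Sum>i<k. (-1) ^ i * c i\<bar> * 1 + (\<Sum>i<k. c i) = 2 * odd_ratio_sum k"
      using abs_alternating_plus_sum[of c k, OF c] by (simp add: odd_ratio_sum_def c_def)
    finally show ?thesis by (simp add: B_def)
  qed
  have u: "u j = \<beta> j / real j ^ 2" if "0 < j" for j
  proof -
    have "binomial_ratio k (Suc i) * Q (real (Suc i) * real j) =
        2 / (h ^ 2 * real j ^ 2) * (c i - c i * cos (real j * (real (Suc i) * h)))" for i
    proof -
      define x where "x = real (Suc i) * real j * (h / 2)"
      have "x \<noteq> 0" using that h by (simp add: x_def)
      then have "sinc x ^ 2 = sin x ^ 2 / x ^ 2" by (simp add: sinc_def power_divide)
      also have "\<dots> = (1 - cos (2 * x)) / 2 / x ^ 2" using cos_double_sin[of x] by simp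
      finally have "Q (real (Suc i) * real j) = (1 - cos (2 * x)) / 2 / x ^ 2"
        by (simp add: Q_def x_def)
      moreover have "2 * x = real j * (real (Suc i) * h)" by (simp add: x_def)
      moreover have "x ^ 2 = real (Suc i) ^ 2 * real j ^ 2 * h ^ 2 / 4"
        by (simp add: x_def power_mult_distrib power_divide del: of_nat_Suc)
      ultimately have "Q (real (Suc i) * real j) =
          (1 - cos (real j * (real (Suc i) * h))) / 2 / (real (Suc i) ^ 2 * real j ^ 2 * h ^ 2 / 4)"
        by (simp only:)
      also have "binomial_ratio k (Suc i) * \<dots> =
          2 / (h ^ 2 * real j ^ 2) * (c i - c i * cos (real j * (real (Suc i) * h)))"
        using that h by (simp add: c_def field_simps del: of_nat_Suc)
      finally show ?thesis .
    qed
    then have "u j = 2 * (\<Sum>i<k. (-1) ^ i * (2 / (h ^ 2 * real j ^ 2) * (c i - c i * cos (real j * (real (Suc i) * h)))))"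
      by (simp only: u_def mult.assoc)
    also have "\<dots> = \<beta> j / real j ^ 2"
      unfolding \<beta>_def mult_1_right sum.distrib[symmetric] sum_distrib_left sum_divide_distrib
      by (intro sum.cong refl) (simp add: field_simps del: of_nat_Suc)
    finally show ?thesis .
  qed
  have "\<forall>m. \<exists>d. (\<forall>j\<ge>n. d j = 1 / real j ^ (2 * Suc m)) \<and> mult_bound d (2 / real n ^ (2 * Suc m))"
  proof
    fix m :: nat
    have "0 < 2 * Suc m" by simp
    from bohr_favard_multiplier[OF assms(2) this] show "\<exists>d. (\<forall>j\<ge>n. d j = 1 / real j ^ (2 * Suc m)) \<and> mult_bound d (2 / real n ^ (2 * Suc m))" by blast
  qed
  from choice[OF this] obtain d where d: "\<And>m j. n \<le> j \<Longrightarrow> d m j = 1 / real j ^ (2 * Suc m)"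
    "\<And>m. mult_bound (d m) (2 / real n ^ (2 * Suc m))" by blast
  define v where "v m j = \<beta> j ^ Suc m * d m j" for m j
  have B0: "0 \<le> B" using odd_ratio_sum_nonneg by (simp add: B_def)
  have Bq: "B / real n ^ 2 \<le> q"
  proof -
    have "B / real n ^ 2 = 8 * odd_ratio_sum k / (\<alpha> ^ 2 * pi ^ 2)"
      using assms by (simp add: B_def h_def power_divide power_mult_distrib)
    also have "\<dots> \<le> q" using q(1) assms(3) by (simp add: pos_divide_le_eq)
    finally show ?thesis .
  qed
  have v: "mult_bound (v m) (2 * q ^ Suc m)" for m
  proof -
    have "mult_bound (v m) (B ^ Suc m * (2 / real n ^ (2 * Suc m)))"
      unfolding v_def[abs_def] by (rule mult_bound_mult[OF mult_bound_power[OF \<beta> B0] d(2) zero_le_power[OF B0]])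
    moreover have "B ^ Suc m * (2 / real n ^ (2 * Suc m)) = 2 * (B / real n ^ 2) ^ Suc m"
      by (simp only: power_divide power_mult) simp
    moreover have "(B / real n ^ 2) ^ Suc m \<le> q ^ Suc m"
      using B0 Bq by (intro power_mono) auto
    ultimately show ?thesis by (elim mult_bound_mono) simp
  qed
  have v_eq: "v m j = u j ^ Suc m" if "n \<le> j" for m j
    using that assms(2) by (simp only: v_def d(1) u power_mult power_divide) simp
  have "(\<lambda>m. 2 * q ^ Suc m * N (trig_poly M a b)) \<longlonglongrightarrow> 2 * 0 * N (trig_poly M a b)"
    using q0 q(2) by (intro tendsto_intros LIMSEQ_Suc LIMSEQ_power_zero) auto
  then have "\<forall>\<^sub>F m in sequentially. 2 * q ^ Suc m * N (trig_poly M a b) < \<epsilon>"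
    using \<epsilon> by (intro order_tendstoD) auto
  then obtain L where L: "2 * q ^ Suc L * N (trig_poly M a b) < \<epsilon>"
    by (auto simp: eventually_sequentially)
  define l where "l j = ((1 - u j) + (\<Sum>m<L. v m j * (1 - u j))) + v L j" for j
  have one: "l j = 1" if "n \<le> j" for j
  proof -
    have "l j = (1 - u j) * (1 + (\<Sum>m<L. u j ^ Suc m)) + u j ^ Suc L"
      unfolding l_def v_eq[OF that] by (simp add: sum_distrib_left algebra_simps)
    also have "1 + (\<Sum>m<L. u j ^ Suc m) = (\<Sum>m<Suc L. u j ^ m)"
      by (subst sum.lessThan_Suc_shift) simp
    also have "(1 - u j) * (\<Sum>m<Suc L. u j ^ m) = 1 - u j ^ Suc L"
      by (rule one_diff_power_eq[symmetric])
    finally show ?thesis by simp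
  qed
  have "N (act l M a b) \<le> N (act (\<lambda>j. 1 - u j) M a b) + N (act (\<lambda>j. \<Sum>m<L. v m j * (1 - u j)) M a b) + N (act (v L) M a b)"
    unfolding l_def[abs_def]
    using N_act_add[of "\<lambda>j. (1 - u j) + (\<Sum>m<L. v m j * (1 - u j))" "v L" M a b]
      N_act_add[of "\<lambda>j. 1 - u j" "\<lambda>j. \<Sum>m<L. v m j * (1 - u j)" M a b] by linarith
  also have "\<dots> \<le> e + (\<Sum>m<L. 2 * q ^ Suc m * e) + \<epsilon>"
  proof (intro add_mono w)
    have "N (act (\<lambda>j. \<Sum>m<L. v m j * (1 - u j)) M a b) \<le> (\<Sum>m<L. N (act (\<lambda>j. v m j * (1 - u j)) M a b))"
      by (rule N_act_sum) simp
    also have "\<dots> \<le> (\<Sum>m<L. 2 * q ^ Suc m * e)"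
      using q0 by (intro sum_mono N_act_mult_le v w) auto
    finally show "N (act (\<lambda>j. \<Sum>m<L. v m j * (1 - u j)) M a b) \<le> (\<Sum>m<L. 2 * q ^ Suc m * e)" .
    show "N (act (v L) M a b) \<le> \<epsilon>"
      using mult_boundD[OF v, of L M a b] L by linarith
  qed
  also have "(\<Sum>m<L. 2 * q ^ Suc m * e) = 2 * q * e * (\<Sum>m<L. q ^ m)"
    by (simp add: sum_distrib_left mult_ac)
  also have "\<dots> \<le> 2 * q * e * (1 / (1 - q))"
  proof (intro mult_left_mono)
    have "(1 - q) * (\<Sum>m<L. q ^ m) = 1 - q ^ L" by (rule one_diff_power_eq[symmetric])
    then show "(\<Sum>m<L. q ^ m) \<le> 1 / (1 - q)"
      using q0 q(2) by (simp add: pos_le_divide_eq mult.commute)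
  qed (use q0 e0 in simp)
  also have "e + 2 * q * e * (1 / (1 - q)) + \<epsilon> = (1 + q) / (1 - q) * e + \<epsilon>"
    using q(2) by (simp add: field_simps)
  finally show "\<exists>l. (\<forall>j\<ge>n. l j = 1) \<and> N (act l M a b) \<le> (1 + q) / (1 - q) * (\<omega> / real ((2 * k) choose k)) + \<epsilon>"
    using one unfolding e_def[symmetric] by (intro exI[of _ l]) auto
qed

section \<open>Passage to the whole space\<close>

lemma approximants_of_poly_jackson:
  assumes J: "poly_jackson k n h c" "0 \<le> c" and f: "f \<in> X" and "0 < \<epsilon>" "0 \<le> \<omega>"
    and \<omega>: "\<And>t. 0 < t \<Longrightarrow> t \<le> h \<Longrightarrow> N (fin_diff (2 * k) t f) \<le> \<omega>"
  shows "\<exists>\<tau>\<in>trig_polys (n - 1). N (\<lambda>x. f x - \<tau> x) \<le> c * (\<omega> / real ((2 * k) choose k)) + \<epsilon>"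
proof -
  define C where "C = c / real ((2 * k) choose k)"
  have C0: "0 \<le> C" using J(2) by (simp add: C_def)
  define \<delta> where "\<delta> = \<epsilon> / (2 + C * 2 ^ (2 * k))"
  have den: "0 < 2 + C * 2 ^ (2 * k)" using C0 by (simp add: add_pos_nonneg)
  have \<delta>: "0 < \<delta>" "\<delta> * (2 + C * 2 ^ (2 * k)) = \<epsilon>" using \<open>0 < \<epsilon>\<close> den by (simp_all add: \<delta>_def)
  obtain M a b where g: "N (\<lambda>x. f x - trig_poly M a b x) < \<delta>" using dense[OF f \<delta>(1)] by blast
  let ?g = "trig_poly M a b"
  let ?d = "\<lambda>x. f x - ?g x"
  have d: "?d \<in> X" by (intro X_diff f X_trig_poly)
  have step: "N (fin_diff (2 * k) t ?g) \<le> \<omega> + 2 ^ (2 * k) * \<delta>" if "0 < t" "t \<le> h" for t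
  proof -
    have "fin_diff (2 * k) t ?g = (\<lambda>x. fin_diff (2 * k) t f x - fin_diff (2 * k) t ?d x)"
      by (simp add: fin_diff_diff)
    then have "N (fin_diff (2 * k) t ?g) \<le> N (fin_diff (2 * k) t f) + N (fin_diff (2 * k) t ?d)"
      using N_diff_le[OF X_fin_diff[OF f] X_fin_diff[OF d]] by simp
    also have "N (fin_diff (2 * k) t ?d) \<le> 2 ^ (2 * k) * \<delta>"
      using N_fin_diff_le[OF d, of "2 * k" t] g by (rule order_trans[OF _ mult_left_mono[OF less_imp_le]]) simp
    finally show ?thesis using \<omega>[OF that] by simp
  qed
  have "0 \<le> \<omega> + 2 ^ (2 * k) * \<delta>" using \<open>0 \<le> \<omega>\<close> \<delta>(1) by simp
  from J(1)[unfolded poly_jackson_def, rule_format, OF this \<delta>(1) step]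
  obtain \<tau> where \<tau>: "\<tau> \<in> trig_polys (n - 1)"
    "N (\<lambda>x. ?g x - \<tau> x) \<le> c * ((\<omega> + 2 ^ (2 * k) * \<delta>) / real ((2 * k) choose k)) + \<delta>"
    by blast
  obtain a' b' where "\<tau> = trig_poly (n - 1) a' b'"
    using \<tau>(1) by (auto simp: trig_polys_def trig_poly_def)
  then have \<tau>X: "\<tau> \<in> X" using X_trig_poly by simp
  have "N (\<lambda>x. ?d x + (?g x - \<tau> x)) \<le> N ?d + N (\<lambda>x. ?g x - \<tau> x)"
    by (intro N_add d X_diff X_trig_poly \<tau>X)
  also have "\<dots> \<le> \<delta> + (C * (\<omega> + 2 ^ (2 * k) * \<delta>) + \<delta>)"
    using g \<tau>(2) by (simp add: C_def)
  also have "\<dots> = C * \<omega> + \<delta> * (2 + C * 2 ^ (2 * k))" by (simp add: algebra_simps)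
  finally have "N (\<lambda>x. f x - \<tau> x) \<le> c * (\<omega> / real ((2 * k) choose k)) + \<epsilon>"
    unfolding \<delta>(2) by (simp add: C_def)
  with \<tau>(1) show ?thesis by blast
qed

end

section \<open>Density of trigonometric polynomials in the continuous periodic functions\<close>

lemma periodic_2pi_int:
  assumes "periodic_2pi f"
  shows "f (x + 2 * pi * of_int n) = f x"
proof (induction n rule: int_induct[of _ 0])
  case base
  then show ?case by simp
next
  case (step1 n)
  have "f (x + 2 * pi * of_int n + 2 * pi) = f (x + 2 * pi * of_int n)"
    using assms by (simp add: periodic_2pi_def)
  with step1 show ?case by (simp add: algebra_simps)
next
  case (step2 n)
  have "f (x + 2 * pi * of_int (n - 1) + 2 * pi) = f (x + 2 * pi * of_int (n - 1))"
    using assms by (simp add: periodic_2pi_def)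
  with step2 show ?case by (simp add: algebra_simps)
qed

definition is_trig_poly :: "(real \<Rightarrow> real) \<Rightarrow> bool" where
  "is_trig_poly f \<longleftrightarrow> (\<exists>M a b. f = trig_poly M a b)"

lemma trig_poly_extend:
  assumes "M \<le> M'"
  shows "trig_poly M a b = trig_poly M' (\<lambda>k. if k \<le> M then a k else 0) (\<lambda>k. if k \<le> M then b k else 0)"
proof
  fix x
  have "(\<Sum>k\<le>M. a k * cos (real k * x) + b k * sin (real k * x)) =
      (\<Sum>k\<le>M. (if k \<le> M then a k else 0) * cos (real k * x) + (if k \<le> M then b k else 0) * sin (real k * x))"
    by (intro sum.cong) auto
  also have "\<dots> = (\<Sum>k\<le>M'. (if k \<le> M then a k else 0) * cos (real k * x) + (if k \<le> M then b k else 0) * sin (real k * x))"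
    by (rule sum.mono_neutral_left) (use assms in auto)
  finally show "trig_poly M a b x = trig_poly M' (\<lambda>k. if k \<le> M then a k else 0) (\<lambda>k. if k \<le> M then b k else 0) x"
    by (simp only: trig_poly_def)
qed

lemma is_trig_poly_add:
  assumes "is_trig_poly f" "is_trig_poly g"
  shows "is_trig_poly (\<lambda>x. f x + g x)"
proof -
  obtain M a b M' a' b' where f: "f = trig_poly M a b" and g: "g = trig_poly M' a' b'"
    using assms by (auto simp: is_trig_poly_def)
  obtain a1 b1 where "f = trig_poly (max M M') a1 b1" using trig_poly_extend[of M "max M M'"] f by auto
  moreover obtain a2 b2 where "g = trig_poly (max M M') a2 b2" using trig_poly_extend[of M' "max M M'"] g by auto
  ultimately have "(\<lambda>x. f x + g x) = trig_poly (max M M') (\<lambda>k. a1 k + a2 k) (\<lambda>k. b1 k + b2 k)"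
    by (simp add: trig_poly_def fun_eq_iff sum.distrib[symmetric] algebra_simps)
  then show ?thesis by (auto simp: is_trig_poly_def)
qed

lemma is_trig_poly_scale: 
  assumes "is_trig_poly f"
  shows "is_trig_poly (\<lambda>x. c * f x)"
proof -
  obtain M a b where f: "f = trig_poly M a b" using assms by (auto simp: is_trig_poly_def)
  then have "(\<lambda>x. c * f x) = trig_poly M (\<lambda>k. c * a k) (\<lambda>k. c * b k)"
    by (simp add: trig_poly_def fun_eq_iff sum_distrib_left algebra_simps)
  then show ?thesis by (auto simp: is_trig_poly_def)
qed

lemma is_trig_poly_cos: "is_trig_poly (\<lambda>x. cos (of_int m * x))"
proof -
  have "cos (of_int m * x) = cos (real (nat \<bar>m\<bar>) * x)" for x :: real
    by (cases "0 \<le> m") auto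
  then have "(\<lambda>x. cos (of_int m * x)) = trig_poly (nat \<bar>m\<bar>) (\<lambda>k. if k = nat \<bar>m\<bar> then 1 else 0) (\<lambda>_. 0)"
    by (simp add: trig_poly_def if_distrib[of "\<lambda>y. y * _"] cong: if_cong)
  then show ?thesis by (auto simp: is_trig_poly_def)
qed

lemma is_trig_poly_sin: "is_trig_poly (\<lambda>x. sin (of_int m * x))"
proof -
  define s :: real where "s = (if 0 \<le> m then 1 else -1)"
  have "sin (of_int m * x) = s * sin (real (nat \<bar>m\<bar>) * x)" for x :: real
    by (cases "0 \<le> m") (auto simp: s_def)
  then have "(\<lambda>x. sin (of_int m * x)) = trig_poly (nat \<bar>m\<bar>) (\<lambda>_. 0) (\<lambda>k. if k = nat \<bar>m\<bar> then s else 0)"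
    by (simp add: trig_poly_def if_distrib[of "\<lambda>y. y * _"] cong: if_cong)
  then show ?thesis by (auto simp: is_trig_poly_def)
qed

lemma is_trig_poly_const: "is_trig_poly (\<lambda>x. c)"
  using is_trig_poly_scale[OF is_trig_poly_cos[of 0], of c] by simp

lemma is_trig_poly_sum:
  "finite I \<Longrightarrow> (\<And>i. i \<in> I \<Longrightarrow> is_trig_poly (f i)) \<Longrightarrow> is_trig_poly (\<lambda>x. \<Sum>i\<in>I. f i x)"
  by (induction I rule: finite_induct) (auto intro: is_trig_poly_add is_trig_poly_const)

lemma is_trig_poly_mult:
  assumes "is_trig_poly f" "is_trig_poly g"
  shows "is_trig_poly (\<lambda>x. f x * g x)"
proof -
  obtain M a b M' a' b' where f: "f = trig_poly M a b" and g: "g = trig_poly M' a' b'"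
    using assms by (auto simp: is_trig_poly_def)
  have half: "is_trig_poly (\<lambda>x. 1 / 2 * (u x + s * v x))" if "is_trig_poly u" "is_trig_poly v" for u v and s :: real
    by (intro is_trig_poly_scale is_trig_poly_add that)
  have cc: "is_trig_poly (\<lambda>x. cos (real i * x) * cos (real j * x))" for i j
  proof -
    have "(\<lambda>x. cos (real i * x) * cos (real j * x)) =
        (\<lambda>x. 1 / 2 * (cos (of_int (int i - int j) * x) + 1 * cos (of_int (int i + int j) * x)))"
      by (rule ext) (simp add: left_diff_distrib distrib_right cos_add cos_diff)
    then show ?thesis by (simp only:) (rule half[OF is_trig_poly_cos is_trig_poly_cos])
  qed
  have ss: "is_trig_poly (\<lambda>x. sin (real i * x) * sin (real j * x))" for i j
  proof -
    have "(\<lambda>x. sin (real i * x) * sin (real j * x)) =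
        (\<lambda>x. 1 / 2 * (cos (of_int (int i - int j) * x) + (-1) * cos (of_int (int i + int j) * x)))"
      by (rule ext) (simp add: left_diff_distrib distrib_right cos_add cos_diff)
    then show ?thesis by (simp only:) (rule half[OF is_trig_poly_cos is_trig_poly_cos])
  qed
  have sc: "is_trig_poly (\<lambda>x. sin (real i * x) * cos (real j * x))" for i j
  proof -
    have "(\<lambda>x. sin (real i * x) * cos (real j * x)) =
        (\<lambda>x. 1 / 2 * (sin (of_int (int i - int j) * x) + 1 * sin (of_int (int i + int j) * x)))"
      by (rule ext) (simp add: left_diff_distrib distrib_right sin_add sin_diff)
    then show ?thesis by (simp only:) (rule half[OF is_trig_poly_sin is_trig_poly_sin])
  qed
  have "(\<lambda>x. f x * g x) = (\<lambda>x. \<Sum>i\<le>M. \<Sum>j\<le>M'.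
      ((a i * a' j) * (cos (real i * x) * cos (real j * x)) + (b i * b' j) * (sin (real i * x) * sin (real j * x)))
      + ((b i * a' j) * (sin (real i * x) * cos (real j * x)) + (a i * b' j) * (sin (real j * x) * cos (real i * x))))"
    unfolding f g trig_poly_def sum_product
    by (rule ext, rule sum.cong[OF refl], rule sum.cong[OF refl]) (simp only: ring_distribs mult_ac add_ac)
  then show ?thesis
    by (simp only:) (rule is_trig_poly_sum[OF finite_atMost], rule is_trig_poly_sum[OF finite_atMost],
        rule is_trig_poly_add[OF is_trig_poly_add[OF is_trig_poly_scale[OF cc] is_trig_poly_scale[OF ss]]
          is_trig_poly_add[OF is_trig_poly_scale[OF sc] is_trig_poly_scale[OF sc]]])
qed

lemma is_trig_poly_polynomial_cis:
  "real_polynomial_function g \<Longrightarrow> is_trig_poly (\<lambda>x. g (cis x))"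
proof (induction rule: real_polynomial_function.induct)
  case (linear h)
  interpret bounded_linear h by fact
  have "h (cis x) = h 1 * cos x + h \<i> * sin x" for x
  proof -
    have "cis x = cos x *\<^sub>R 1 + sin x *\<^sub>R \<i>" by (simp add: complex_eq_iff)
    then show ?thesis by (simp add: add scaleR)
  qed
  moreover have "is_trig_poly (\<lambda>x. h 1 * cos x + h \<i> * sin x)"
    using is_trig_poly_add[OF is_trig_poly_scale[OF is_trig_poly_cos[of 1]] is_trig_poly_scale[OF is_trig_poly_sin[of 1]]]
    by simp
  ultimately show ?case by simp
qed (auto intro: is_trig_poly_const is_trig_poly_add is_trig_poly_mult)

lemma trig_weierstrass:
  assumes f: "periodic_2pi f" "continuous_on UNIV f" and "0 < e"
  obtains M a b where "\<And>x. \<bar>f x - trig_poly M a b x\<bar> < e"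
proof -
  define F where "F z = f (Arg z)" for z
  have per: "f x = f y" if "cis x = cis y" for x y
  proof -
    have "sin x = sin y \<and> cos x = cos y" using that by (simp add: complex_eq_iff)
    then obtain n :: int where "x = y + 2 * pi * of_int n" by (auto simp: sin_cos_eq_iff)
    then show ?thesis using periodic_2pi_int[OF f(1)] by simp
  qed
  have "isCont F z" if "z \<in> sphere 0 1" for z
  proof (cases "z \<in> \<real>\<^sub>\<le>\<^sub>0")
    case False
    then have "isCont Arg z" by (rule continuous_at_Arg)
    moreover have "isCont f (Arg z)" using f(2) by (simp add: continuous_on_eq_continuous_at)
    ultimately show ?thesis unfolding F_def[abs_def] by (rule isCont_o2)
  next
    case True
    have z: "z \<noteq> 0" using that by auto
    then have "- z \<notin> \<real>\<^sub>\<le>\<^sub>0" using True by (auto simp: complex_nonpos_Reals_iff complex_eq_iff)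
    then have "isCont Arg (- z)" by (rule continuous_at_Arg)
    moreover have "isCont (\<lambda>z::complex. - z) z" by simp
    ultimately have "isCont (\<lambda>z. Arg (- z)) z" by (rule isCont_o2[rotated])
    then have "isCont (\<lambda>z. Arg (- z) + pi) z" by (intro continuous_intros)
    moreover have "isCont f (Arg (- z) + pi)" using f(2) by (simp add: continuous_on_eq_continuous_at)
    ultimately have "isCont (\<lambda>z. f (Arg (- z) + pi)) z" by (rule isCont_o2)
    moreover have "\<forall>\<^sub>F w in nhds z. f (Arg (- w) + pi) = F w"
    proof -
      have "\<forall>\<^sub>F w in nhds z. w \<noteq> 0" using z by (rule t1_space_nhds)
      then show ?thesis
      proof eventually_elim
        case (elim w)
        have "cis (Arg (- w) + pi) = cis (Arg (- w)) * cis pi" by (rule cis_mult[symmetric])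
        also have "\<dots> = cis (Arg w)" using elim cis_Arg[of w] cis_Arg[of "- w"] by (simp add: sgn_minus)
        finally show ?case unfolding F_def by (rule per)
      qed
    qed
    ultimately show ?thesis by (simp add: isCont_cong)
  qed
  then have "continuous_on (sphere 0 1) F" by (simp add: continuous_at_imp_continuous_on)
  from Stone_Weierstrass_real_polynomial_function[OF compact_sphere this \<open>0 < e\<close>]
  obtain g where g: "real_polynomial_function g" "\<And>z. z \<in> sphere 0 1 \<Longrightarrow> \<bar>F z - g z\<bar> < e" by blast
  obtain M a b where "(\<lambda>x. g (cis x)) = trig_poly M a b"
    using is_trig_poly_polynomial_cis[OF g(1)] by (auto simp: is_trig_poly_def)
  then have "trig_poly M a b x = g (cis x)" for x by (metis (full_types))
  moreover have "F (cis x) = f x" for x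
    unfolding F_def by (rule per) (simp add: cis_Arg)
  ultimately have "\<bar>f x - trig_poly M a b x\<bar> < e" for x
    using g(2)[of "cis x"] by simp
  then show thesis by (rule that)
qed

section \<open>The spaces as shift-invariant seminorms\<close>

lemma periodic_2pi_cos_sin:
  "periodic_2pi (\<lambda>x. cos (real k * x))" "periodic_2pi (\<lambda>x. sin (real k * x))"
proof -
  have 0: "sin (real k * (2 * pi)) = 0" "cos (real k * (2 * pi)) = 1"
    using sin_npi[of "2 * k"] cos_npi[of "2 * k"] by (simp_all add: mult_ac)
  show "periodic_2pi (\<lambda>x. cos (real k * x))" "periodic_2pi (\<lambda>x. sin (real k * x))"
    unfolding periodic_2pi_def by (simp_all only: distrib_left cos_add sin_add 0) simp_all
qed

lemma continuous_periodic_bounded: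
  assumes "periodic_2pi f" "continuous_on UNIV f"
  obtains B where "\<And>x. \<bar>f x\<bar> \<le> B"
proof -
  have "compact (f ` {0..2*pi})"
    using assms(2) by (intro compact_continuous_image) (auto intro: continuous_on_subset)
  then obtain B where B: "\<forall>x\<in>{0..2*pi}. \<bar>f x\<bar> \<le> B"
    by (auto simp: bounded_real dest!: compact_imp_bounded)
  have "\<bar>f x\<bar> \<le> B" for x
  proof -
    define n where "n = \<lfloor>x / (2 * pi)\<rfloor>"
    have "of_int n \<le> x / (2 * pi)" "x / (2 * pi) < of_int n + 1" by (simp_all add: n_def)
    then have "x + 2 * pi * of_int (- n) \<in> {0..2*pi}"
      by (auto simp: field_simps)
    with B have "\<bar>f (x + 2 * pi * of_int (- n))\<bar> \<le> B" by blast
    then show ?thesis unfolding periodic_2pi_int[OF assms(1)] .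
  qed
  then show thesis by (rule that)
qed

lemma periodic_2pi_shift: "periodic_2pi f \<Longrightarrow> periodic_2pi (\<lambda>x. f (x + t))"
  unfolding periodic_2pi_def by (metis add.assoc add.commute)

lemma shift_invariant_seminorm_uniform: "shift_invariant_seminorm (Xspace \<infinity>) (Xnorm \<infinity>)"
proof -
  have X: "f \<in> Xspace \<infinity> \<longleftrightarrow> periodic_2pi f \<and> continuous_on UNIV f" for f
    by (simp add: Xspace_def)
  have N: "Xnorm \<infinity> f = (SUP x. \<bar>f x\<bar>)" for f by (simp add: Xnorm_def)
  have bdd: "bdd_above (range (\<lambda>x. \<bar>f x\<bar>))" if "f \<in> Xspace \<infinity>" for f
    using continuous_periodic_bounded[of f] that by (auto simp: X bdd_above_def)
  have cont: "continuous_on UNIV (\<lambda>x. f (x + t))" if "continuous_on UNIV f" for f :: "real \<Rightarrow> real" and t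
    by (rule continuous_on_compose2[OF that]) (auto intro!: continuous_intros)
  show ?thesis
  proof
    fix f g :: "real \<Rightarrow> real" and c t \<epsilon> :: real and k :: nat
    show "(\<lambda>x. cos (real k * x)) \<in> Xspace \<infinity>"
      using periodic_2pi_cos_sin(1)[of k] by (auto simp: X intro!: continuous_intros)
    show "(\<lambda>x. sin (real k * x)) \<in> Xspace \<infinity>"
      using periodic_2pi_cos_sin(2)[of k] by (auto simp: X intro!: continuous_intros)
    show "(\<lambda>x. f x + g x) \<in> Xspace \<infinity>" if "f \<in> Xspace \<infinity>" "g \<in> Xspace \<infinity>"
      using that by (auto simp: X periodic_2pi_def intro!: continuous_intros)
    show "(\<lambda>x. c * f x) \<in> Xspace \<infinity>" if "f \<in> Xspace \<infinity>"
      using that by (auto simp: X periodic_2pi_def intro!: continuous_intros)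
    show shift: "(\<lambda>x. f (x + t)) \<in> Xspace \<infinity>" if "f \<in> Xspace \<infinity>"
      using that cont[of f t] periodic_2pi_shift[of f t] by (auto simp: X)
    show "Xnorm \<infinity> (\<lambda>x. f x + g x) \<le> Xnorm \<infinity> f + Xnorm \<infinity> g" if "f \<in> Xspace \<infinity>" "g \<in> Xspace \<infinity>"
      unfolding N
    proof (rule cSUP_least)
      fix x
      have "\<bar>f x\<bar> \<le> (SUP x. \<bar>f x\<bar>)" "\<bar>g x\<bar> \<le> (SUP x. \<bar>g x\<bar>)"
        using bdd that by (auto intro: cSUP_upper)
      then show "\<bar>f x + g x\<bar> \<le> (SUP x. \<bar>f x\<bar>) + (SUP x. \<bar>g x\<bar>)" by linarith
    qed simp
    have scale_le: "Xnorm \<infinity> (\<lambda>x. c * f x) \<le> \<bar>c\<bar> * Xnorm \<infinity> f" if "f \<in> Xspace \<infinity>" for c f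
      unfolding N
    proof (rule cSUP_least)
      fix x
      have "\<bar>f x\<bar> \<le> (SUP x. \<bar>f x\<bar>)" using bdd[OF that] by (auto intro: cSUP_upper)
      then show "\<bar>c * f x\<bar> \<le> \<bar>c\<bar> * (SUP x. \<bar>f x\<bar>)" by (simp add: abs_mult mult_left_mono)
    qed simp
    show "Xnorm \<infinity> (\<lambda>x. c * f x) = \<bar>c\<bar> * Xnorm \<infinity> f" if f: "f \<in> Xspace \<infinity>"
    proof (cases "c = 0")
      case True
      then show ?thesis by (simp add: N)
    next
      case False
      have "(\<lambda>x. c * f x) \<in> Xspace \<infinity>"
        using f by (auto simp: X periodic_2pi_def intro!: continuous_intros)
      from scale_le[OF this, of "1 / c"] False
      have "\<bar>c\<bar> * Xnorm \<infinity> f \<le> Xnorm \<infinity> (\<lambda>x. c * f x)" by (simp add: field_simps)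
      with scale_le[OF f, of c] show ?thesis by simp
    qed
    have "range (\<lambda>x. \<bar>f (x + t)\<bar>) = range (\<lambda>x. \<bar>f x\<bar>)"
    proof (intro set_eqI iffI)
      fix y assume "y \<in> range (\<lambda>x. \<bar>f x\<bar>)"
      then obtain x where "y = \<bar>f (x - t + t)\<bar>" by auto
      then show "y \<in> range (\<lambda>x. \<bar>f (x + t)\<bar>)" by blast
    qed auto
    then show "Xnorm \<infinity> (\<lambda>x. f (x + t)) = Xnorm \<infinity> f" if "f \<in> Xspace \<infinity>"
      by (simp add: N)
    show "\<exists>M a b. Xnorm \<infinity> (\<lambda>x. f x - trig_poly M a b x) < \<epsilon>" if "f \<in> Xspace \<infinity>" "0 < \<epsilon>"
    proof -
      have "periodic_2pi f" "continuous_on UNIV f" "0 < \<epsilon> / 2" using that by (auto simp: X)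
      then obtain M a b where "\<And>x. \<bar>f x - trig_poly M a b x\<bar> < \<epsilon> / 2"
        by (rule trig_weierstrass) blast
      then have "Xnorm \<infinity> (\<lambda>x. f x - trig_poly M a b x) \<le> \<epsilon> / 2"
        unfolding N by (intro cSUP_least) (auto intro: less_imp_le)
      then show ?thesis using that(2) by (intro exI[of _ M] exI[of _ a] exI[of _ b]) linarith
    qed
  qed
qed

text \<open>
  The representation over the restricted measure gives access to the dominated convergence theorem.
\<close>

definition lp_int :: "real \<Rightarrow> (real \<Rightarrow> real) \<Rightarrow> real" where
  "lp_int P f = (\<integral>x. \<bar>f x\<bar> powr P \<partial>lebesgue_on {-pi..pi})"

lemma Xspace_lp: "f \<in> Xspace (ereal P) \<longleftrightarrow> periodic_2pi f \<and> f \<in> borel_measurable lebesgue \<and>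
    integrable (lebesgue_on {-pi..pi}) (\<lambda>x. \<bar>f x\<bar> powr P)"
  by (simp add: Xspace_def set_integrable_def integrable_restrict_space)

lemma Xnorm_lp: "Xnorm (ereal P) f = lp_int P f powr (1 / P)"
  by (simp add: Xnorm_def lp_int_def set_lebesgue_integral_def integral_restrict_space)

lemma lp_int_nonneg: "0 \<le> lp_int P f"
  by (simp add: lp_int_def)

lemma borel_measurable_lebesgue_on: "f \<in> borel_measurable lebesgue \<Longrightarrow> f \<in> borel_measurable (lebesgue_on A)"
  by (rule measurable_restrict_space1)

text \<open>
  Near any point the extension is a finite sum of translates of \<open>G\<close> with disjoint supports, hence
  continuous.
\<close>

lemma periodic_extension:
  fixes G :: "real \<Rightarrow> real"
  assumes G: "continuous_on UNIV G" "\<And>x. pi \<le> \<bar>x\<bar> \<Longrightarrow> G x = 0"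
  shows "\<exists>E. periodic_2pi E \<and> continuous_on UNIV E \<and> (\<forall>x. - pi \<le> x \<longrightarrow> x < pi \<longrightarrow> E x = G x) \<and> (\<forall>x. E x \<in> range G)"
proof -
  define n where "n x = \<lfloor>(x + pi) / (2 * pi)\<rfloor>" for x
  define E where "E x = G (x - 2 * pi * of_int (n x))" for x
  have n: "- pi \<le> x - 2 * pi * of_int (n x)" "x - 2 * pi * of_int (n x) < pi" for x
  proof -
    have "of_int (n x) \<le> (x + pi) / (2 * pi)" "(x + pi) / (2 * pi) < of_int (n x) + 1"
      by (simp_all add: n_def)
    then show "- pi \<le> x - 2 * pi * of_int (n x)" "x - 2 * pi * of_int (n x) < pi"
      by (simp_all add: field_simps)
  qed
  have far: "pi \<le> \<bar>x - 2 * pi * of_int k\<bar>" if "k \<noteq> n x" for x k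
  proof (cases "k < n x")
    case True
    then have "real_of_int k + 1 \<le> of_int (n x)" by linarith
    then have "2 * pi * (real_of_int k + 1) \<le> 2 * pi * of_int (n x)" by (intro mult_left_mono) auto
    with n(1)[of x] show ?thesis by (simp add: algebra_simps)
  next
    case False
    then have "of_int (n x) + 1 \<le> real_of_int k" using that by linarith
    then have "2 * pi * (of_int (n x) + 1) \<le> 2 * pi * real_of_int k" by (intro mult_left_mono) auto
    with n(2)[of x] show ?thesis by (simp add: algebra_simps)
  qed
  have sum: "E x = (\<Sum>k\<in>{-K..K}. G (x - 2 * pi * of_int k))" if "n x \<in> {-K..K}" for x K
  proof -
    have "(\<Sum>k\<in>{-K..K}. G (x - 2 * pi * of_int k)) = E x + (\<Sum>k\<in>{-K..K} - {n x}. G (x - 2 * pi * of_int k))"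
      using that by (subst sum.remove[of _ "n x"]) (auto simp: E_def)
    also have "(\<Sum>k\<in>{-K..K} - {n x}. G (x - 2 * pi * of_int k)) = 0"
      using far G(2) by (intro sum.neutral) auto
    finally show ?thesis by simp
  qed
  have "isCont E x" for x
  proof -
    define K where "K = \<bar>n x\<bar> + 1"
    have "\<forall>\<^sub>F y in nhds x. y \<in> {x - pi<..<x + pi}"
      by (intro eventually_nhds_in_open) auto
    then have "\<forall>\<^sub>F y in nhds x. (\<Sum>k\<in>{-K..K}. G (y - 2 * pi * of_int k)) = E y"
    proof eventually_elim
      case (elim y)
      have "(y + pi) / (2 * pi) < (x + pi) / (2 * pi) + 1" "(x + pi) / (2 * pi) - 1 < (y + pi) / (2 * pi)"
      proof -
        have "(y - x) / (2 * pi) < 1" "- 1 < (y - x) / (2 * pi)"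
          using elim by (simp_all add: pos_divide_less_eq pos_less_divide_eq)
        then show "(y + pi) / (2 * pi) < (x + pi) / (2 * pi) + 1" "(x + pi) / (2 * pi) - 1 < (y + pi) / (2 * pi)"
          by (simp_all add: add_divide_distrib diff_divide_distrib)
      qed
      then have "n y \<le> n x + 1" "n x - 1 \<le> n y" unfolding n_def by linarith+
      then have "n y \<in> {-K..K}" by (auto simp: K_def)
      then show ?case by (rule sum[symmetric])
    qed
    moreover have "isCont (\<lambda>y. \<Sum>k\<in>{-K..K}. G (y - 2 * pi * of_int k)) x"
    proof (intro continuous_intros)
      fix k
      have "isCont G (x - 2 * pi * of_int k)" using G(1) by (simp add: continuous_on_eq_continuous_at)
      then show "isCont (\<lambda>y. G (y - 2 * pi * of_int k)) x"
        by (rule isCont_o2[rotated]) (intro continuous_intros)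
    qed
    ultimately show ?thesis by (simp add: isCont_cong)
  qed
  then have 1: "continuous_on UNIV E" by (simp add: continuous_at_imp_continuous_on)
  have "n (x + 2 * pi) = n x + 1" for x
  proof -
    have "(x + 2 * pi + pi) / (2 * pi) = (x + pi) / (2 * pi) + 1" by (simp add: field_simps)
    then show ?thesis unfolding n_def by (simp only: one_add_floor)
  qed
  then have 2: "periodic_2pi E" by (simp add: periodic_2pi_def E_def algebra_simps)
  have 3: "E x = G x" if "- pi \<le> x" "x < pi" for x
  proof -
    have "n x = 0" unfolding n_def using that by (intro floor_unique) (simp_all add: field_simps)
    then show ?thesis by (simp add: E_def)
  qed
  show ?thesis using 1 2 3 by (intro exI[of _ E]) (auto simp: E_def)
qed

text \<open>Convexity of the power function, the pointwise form of Minkowski's inequality.\<close>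

lemma powr_add_le_convex:
  fixes x y A B P :: real
  assumes "1 \<le> P" "0 < A" "0 < B" "0 \<le> x" "0 \<le> y"
  shows "(x + y) powr P \<le> (A + B) powr P * (A / (A + B) * (x powr P / A powr P) + B / (A + B) * (y powr P / B powr P))"
proof -
  have zero: "(t + 0) powr P \<le> (C + D) powr P * (C / (C + D) * (t powr P / C powr P) + D / (C + D) * (0 powr P / D powr P))"
    if "0 < C" "0 < D" "0 \<le> t" for t C D
  proof -
    have "C / (C + D) \<le> 1" "0 < C / (C + D)" using that by simp_all
    then have "(C / (C + D)) powr P \<le> (C / (C + D)) powr 1"
      using assms(1) by (intro powr_mono') auto
    then have "C powr P / (C + D) powr P \<le> C / (C + D)"
      using that by (simp add: powr_divide)
    then have "C powr P \<le> (C + D) powr P * (C / (C + D))"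
      using that by (simp add: field_simps)
    then have "t powr P * C powr P \<le> t powr P * ((C + D) powr P * (C / (C + D)))"
      by (intro mult_left_mono) auto
    then have "t powr P \<le> t powr P * ((C + D) powr P * (C / (C + D))) / C powr P"
      using that by (simp only: pos_le_divide_eq powr_gt_zero)
    then show ?thesis using assms(1) by (simp add: mult_ac)
  qed
  consider "x = 0" | "y = 0" | "0 < x" "0 < y" using assms by fastforce
  then show ?thesis
  proof cases
    case 1
    then show ?thesis using zero[of B A y] assms by (simp add: add.commute)
  next
    case 2
    then show ?thesis using zero[of A B x] assms by simp
  next
    case 3
    define t where "t = B / (A + B)"
    have t: "0 \<le> t" "t \<le> 1" "1 - t = A / (A + B)" using assms by (simp_all add: t_def field_simps)
    have "((1 - t) *\<^sub>R (x / A) + t *\<^sub>R (y / B)) powr P \<le> (1 - t) * (x / A) powr P + t * (y / B) powr P"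
      by (rule convex_onD[OF powr_convex[OF assms(1)]]) (use t 3 assms in auto)
    also have "(1 - t) *\<^sub>R (x / A) + t *\<^sub>R (y / B) = (x + y) / (A + B)"
      unfolding t(3) using assms by (simp add: t_def add_divide_distrib)
    finally have "(x + y) powr P / (A + B) powr P \<le> A / (A + B) * (x powr P / A powr P) + t * (y powr P / B powr P)"
      using assms 3 by (simp add: powr_divide t(3))
    then show ?thesis using assms by (simp add: t_def pos_divide_le_eq mult.commute)
  qed
qed

context
  fixes P :: real
  assumes P: "1 \<le> P"
begin

lemma Xspace_lp_add:
  assumes "f \<in> Xspace (ereal P)" "g \<in> Xspace (ereal P)"
  shows "(\<lambda>x. f x + g x) \<in> Xspace (ereal P)"
proof -
  have [measurable]: "f \<in> borel_measurable (lebesgue_on {-pi..pi})" "g \<in> borel_measurable (lebesgue_on {-pi..pi})"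
    using assms by (auto simp: Xspace_lp intro: borel_measurable_lebesgue_on)
  have "integrable (lebesgue_on {-pi..pi}) (\<lambda>x. \<bar>f x + g x\<bar> powr P)"
  proof (rule Bochner_Integration.integrable_bound)
    show "integrable (lebesgue_on {-pi..pi}) (\<lambda>x. 2 powr P * (1 / 2 * \<bar>f x\<bar> powr P + 1 / 2 * \<bar>g x\<bar> powr P))"
      using assms by (auto simp: Xspace_lp)
    have "\<bar>f x + g x\<bar> powr P \<le> 2 powr P * (1 / 2 * \<bar>f x\<bar> powr P + 1 / 2 * \<bar>g x\<bar> powr P)" for x
    proof -
      have "\<bar>f x + g x\<bar> powr P \<le> (\<bar>f x\<bar> + \<bar>g x\<bar>) powr P" using P by (intro powr_mono2) auto
      also have "\<dots> \<le> 2 powr P * (1 / 2 * \<bar>f x\<bar> powr P + 1 / 2 * \<bar>g x\<bar> powr P)"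
        using powr_add_le_convex[OF P, of 1 1 "\<bar>f x\<bar>" "\<bar>g x\<bar>"] by simp
      finally show ?thesis .
    qed
    then show "AE x in lebesgue_on {-pi..pi}. norm (\<bar>f x + g x\<bar> powr P) \<le>
        norm (2 powr P * (1 / 2 * \<bar>f x\<bar> powr P + 1 / 2 * \<bar>g x\<bar> powr P))"
      by (intro AE_I2) (simp add: abs_mult)
  qed measurable
  then show ?thesis using assms by (auto simp: Xspace_lp periodic_2pi_def)
qed

lemma Xnorm_lp_less: "Xnorm (ereal P) f < A \<Longrightarrow> lp_int P f \<le> A powr P"
proof -
  assume A: "Xnorm (ereal P) f < A"
  have "lp_int P f = (lp_int P f powr (1 / P)) powr P"
    using P lp_int_nonneg[of P f] by (simp add: powr_powr)
  also have "\<dots> \<le> A powr P" using A P by (intro powr_mono2) (auto simp: Xnorm_lp)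
  finally show ?thesis .
qed

lemma Xnorm_lp_le: "0 \<le> A \<Longrightarrow> lp_int P f \<le> A powr P \<Longrightarrow> Xnorm (ereal P) f \<le> A"
proof -
  assume A: "0 \<le> A" "lp_int P f \<le> A powr P"
  have "lp_int P f powr (1 / P) \<le> (A powr P) powr (1 / P)"
    using A lp_int_nonneg P by (intro powr_mono2) auto
  also have "\<dots> = A" using A P by (simp add: powr_powr)
  finally show ?thesis by (simp add: Xnorm_lp)
qed

lemma Xnorm_lp_add:
  assumes f: "f \<in> Xspace (ereal P)" and g: "g \<in> Xspace (ereal P)"
  shows "Xnorm (ereal P) (\<lambda>x. f x + g x) \<le> Xnorm (ereal P) f + Xnorm (ereal P) g"
proof (rule field_le_epsilon)
  fix e :: real assume "0 < e"
  define A where "A = Xnorm (ereal P) f + e / 2"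
  define B where "B = Xnorm (ereal P) g + e / 2"
  have A: "0 < A" "lp_int P f \<le> A powr P" and B: "0 < B" "lp_int P g \<le> B powr P"
    using \<open>0 < e\<close> Xnorm_lp_less[of f A] Xnorm_lp_less[of g B] by (simp_all add: A_def B_def Xnorm_lp add_nonneg_pos)
  have int: "integrable (lebesgue_on {-pi..pi}) (\<lambda>x. \<bar>f x\<bar> powr P)"
    "integrable (lebesgue_on {-pi..pi}) (\<lambda>x. \<bar>g x\<bar> powr P)"
    "integrable (lebesgue_on {-pi..pi}) (\<lambda>x. \<bar>f x + g x\<bar> powr P)"
    using f g Xspace_lp_add[OF f g] by (auto simp: Xspace_lp)
  have "lp_int P (\<lambda>x. f x + g x) \<le>
      (\<integral>x. (A + B) powr P * (A / (A + B) * (\<bar>f x\<bar> powr P / A powr P) + B / (A + B) * (\<bar>g x\<bar> powr P / B powr P)) \<partial>lebesgue_on {-pi..pi})"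
    unfolding lp_int_def
  proof (rule integral_mono)
    fix x
    have "\<bar>f x + g x\<bar> powr P \<le> (\<bar>f x\<bar> + \<bar>g x\<bar>) powr P" using P by (intro powr_mono2) auto
    also have "\<dots> \<le> (A + B) powr P * (A / (A + B) * (\<bar>f x\<bar> powr P / A powr P) + B / (A + B) * (\<bar>g x\<bar> powr P / B powr P))"
      using A B by (intro powr_add_le_convex P) auto
    finally show "\<bar>f x + g x\<bar> powr P \<le> \<dots>" .
  qed (use int in auto)
  also have "\<dots> = (A + B) powr P * (A / (A + B) * (lp_int P f / A powr P) + B / (A + B) * (lp_int P g / B powr P))"
    using int by (simp add: lp_int_def)
  also have "\<dots> \<le> (A + B) powr P * (A / (A + B) * 1 + B / (A + B) * 1)"
    using A B by (intro mult_left_mono add_mono) auto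
  also have "\<dots> = (A + B) powr P" using A B by (simp add: add_divide_distrib[symmetric])
  finally have "Xnorm (ereal P) (\<lambda>x. f x + g x) \<le> A + B" using A B by (intro Xnorm_lp_le) auto
  then show "Xnorm (ereal P) (\<lambda>x. f x + g x) \<le> Xnorm (ereal P) f + Xnorm (ereal P) g + e"
    by (simp add: A_def B_def)
qed

lemma Xspace_lp_scale: "f \<in> Xspace (ereal P) \<Longrightarrow> (\<lambda>x. c * f x) \<in> Xspace (ereal P)"
  by (auto simp: Xspace_lp periodic_2pi_def abs_mult powr_mult)

lemma Xnorm_lp_scale: "Xnorm (ereal P) (\<lambda>x. c * f x) = \<bar>c\<bar> * Xnorm (ereal P) f"
proof -
  have "lp_int P (\<lambda>x. c * f x) = \<bar>c\<bar> powr P * lp_int P f"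
    by (simp add: lp_int_def abs_mult powr_mult)
  then show ?thesis
    using P lp_int_nonneg[of P f] by (simp add: Xnorm_lp powr_mult powr_powr)
qed

text \<open>Translation by less than a period only moves a piece of the interval by one period.\<close>

lemma has_integral_periodic_shift:
  fixes g :: "real \<Rightarrow> real"
  assumes "periodic_2pi g" "g integrable_on {-pi..pi}"
  shows "((\<lambda>x. g (x + t)) has_integral integral {-pi..pi} g) {-pi..pi}"
proof -
  define n where "n = \<lfloor>t / (2 * pi)\<rfloor>"
  define s where "s = t - 2 * pi * of_int n"
  have "of_int n \<le> t / (2 * pi)" "t / (2 * pi) < of_int n + 1" by (simp_all add: n_def)
  then have s: "0 \<le> s" "s \<le> 2 * pi" by (simp_all add: s_def field_simps)
  have "g (x + t) = g (x + s)" for x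
    using periodic_2pi_int[OF assms(1), of "x + s" n] by (simp add: s_def algebra_simps)
  moreover have "((\<lambda>x. g (x + s)) has_integral integral {-pi..pi} g) {-pi..pi}"
  proof -
    define c where "c = - pi + s"
    have c: "- pi \<le> c" "c \<le> pi" using s by (simp_all add: c_def)
    have 1: "g integrable_on {-pi..c}" "g integrable_on {c..pi}"
      using assms(2) c by (auto intro: integrable_subinterval_real)
    have "((\<lambda>x. g (x + - (2 * pi))) has_integral integral {-pi..c} g) {-pi - - (2 * pi)..c - - (2 * pi)}"
      by (intro has_integral_shift_real_ivl integrable_integral 1)
    moreover have "g (x + - (2 * pi)) = g x" for x
      using periodic_2pi_int[OF assms(1), of x "-1"] by simp
    ultimately have "(g has_integral integral {-pi..c} g) {pi..c + 2 * pi}" by simp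
    with integrable_integral[OF 1(2)]
    have "(g has_integral integral {c..pi} g + integral {-pi..c} g) {c..c + 2 * pi}"
      using c by (intro has_integral_combine[of c pi]) auto
    then have "(g has_integral integral {-pi..pi} g) {c..c + 2 * pi}"
      using Henstock_Kurzweil_Integration.integral_combine[OF c assms(2)] by (simp add: add.commute)
    from has_integral_shift_real_ivl[OF this, of s] show ?thesis
      by (simp add: c_def)
  qed
  ultimately show ?thesis by simp
qed

lemma borel_measurable_lebesgue_shift:
  fixes f :: "real \<Rightarrow> real"
  assumes "f \<in> borel_measurable lebesgue"
  shows "(\<lambda>x. f (x + t)) \<in> borel_measurable lebesgue"
proof -
  have "(\<lambda>x::real. t + (\<Sum>j\<in>Basis. (1 * (x \<bullet> j)) *\<^sub>R j)) \<in> lebesgue \<rightarrow>\<^sub>M lebesgue"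
    by (rule lebesgue_affine_measurable) simp
  then have "(\<lambda>x::real. x + t) \<in> lebesgue \<rightarrow>\<^sub>M lebesgue" by (simp add: add.commute)
  from measurable_compose[OF this assms] show ?thesis .
qed

lemma lp_shift:
  assumes f: "f \<in> Xspace (ereal P)"
  shows "(\<lambda>x. f (x + t)) \<in> Xspace (ereal P)" "lp_int P (\<lambda>x. f (x + t)) = lp_int P f"
proof -
  define g where "g x = \<bar>f x\<bar> powr P" for x
  have f': "periodic_2pi f" "f \<in> borel_measurable lebesgue" "integrable (lebesgue_on {-pi..pi}) g"
    using f by (auto simp: Xspace_lp g_def[abs_def])
  have g: "periodic_2pi g" using f'(1) by (simp add: periodic_2pi_def g_def)
  have "g integrable_on {-pi..pi}" "integral {-pi..pi} g = lp_int P f"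
    using integrable_on_lebesgue_on[OF f'(3)] lebesgue_integral_eq_integral[OF f'(3)]
    by (simp_all add: lp_int_def g_def[abs_def])
  from has_integral_periodic_shift[OF g this(1), of t, unfolded this(2)]
  have gi: "((\<lambda>x. g (x + t)) has_integral lp_int P f) {-pi..pi}" .
  then have "(\<lambda>x. g (x + t)) absolutely_integrable_on {-pi..pi}"
    by (intro nonnegative_absolutely_integrable_1) (auto simp: g_def integrable_on_def)
  then have i: "integrable (lebesgue_on {-pi..pi}) (\<lambda>x. g (x + t))"
    by (simp add: absolutely_integrable_on_def integrable_restrict_space set_integrable_def)
  show "(\<lambda>x. f (x + t)) \<in> Xspace (ereal P)"
    using i borel_measurable_lebesgue_shift[OF f'(2)] periodic_2pi_shift[OF f'(1)]
    by (simp add: Xspace_lp g_def)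
  show "lp_int P (\<lambda>x. f (x + t)) = lp_int P f"
    using lebesgue_integral_eq_integral[OF i] integral_unique[OF gi] by (simp add: lp_int_def g_def)
qed

lemma bounded_in_Xspace_lp:
  assumes "periodic_2pi f" "f \<in> borel_measurable lebesgue" "\<And>x. \<bar>f x\<bar> \<le> B"
  shows "f \<in> Xspace (ereal P)"
proof -
  interpret finite_measure "lebesgue_on {-pi..pi}" by (rule finite_measure_lebesgue_on) simp
  have [measurable]: "f \<in> borel_measurable (lebesgue_on {-pi..pi})"
    using assms by (auto intro: borel_measurable_lebesgue_on)
  have "integrable (lebesgue_on {-pi..pi}) (\<lambda>x. \<bar>f x\<bar> powr P)"
    by (rule integrable_const_bound[where B = "B powr P"])
      (use assms(3) P in \<open>auto intro!: powr_mono2\<close>)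
  then show ?thesis using assms by (simp add: Xspace_lp)
qed

lemma continuous_lebesgue_measurable: "continuous_on UNIV f \<Longrightarrow> (f :: real \<Rightarrow> real) \<in> borel_measurable lebesgue"
  by (intro measurable_completion) (simp add: borel_measurable_continuous_onI)

lemma continuous_in_Xspace_lp:
  assumes "periodic_2pi f" "continuous_on UNIV f"
  shows "f \<in> Xspace (ereal P)"
proof -
  obtain B where "\<And>x. \<bar>f x\<bar> \<le> B" using continuous_periodic_bounded[OF assms] by blast
  then show ?thesis using assms continuous_lebesgue_measurable by (intro bounded_in_Xspace_lp) auto
qed

lemma uniform_small_lp:
  assumes "\<And>x. \<bar>f x\<bar> \<le> e" "f \<in> Xspace (ereal P)"
  shows "Xnorm (ereal P) f \<le> e * (2 * pi) powr (1 / P)"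
proof -
  interpret finite_measure "lebesgue_on {-pi..pi}" by (rule finite_measure_lebesgue_on) simp
  have e: "0 \<le> e" using assms(1)[of 0] by linarith
  have "lp_int P f \<le> (\<integral>x. e powr P \<partial>lebesgue_on {-pi..pi})"
    unfolding lp_int_def using assms P by (intro integral_mono) (auto simp: Xspace_lp intro!: powr_mono2)
  also have "\<dots> = e powr P * (2 * pi)"
    by (simp add: measure_restrict_space)
  also have "\<dots> = (e * (2 * pi) powr (1 / P)) powr P"
    using e P by (simp add: powr_mult powr_powr)
  finally show ?thesis using e by (intro Xnorm_lp_le) auto
qed

lemma dominated_small_lp:
  assumes F: "\<And>i. F i \<in> Xspace (ereal P)" and f: "f \<in> Xspace (ereal P)"
    and lim: "AE x in lebesgue_on {-pi..pi}. (\<lambda>i. F i x) \<longlonglongrightarrow> f x"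
    and w: "integrable (lebesgue_on {-pi..pi}) w" "\<And>i x. \<bar>f x - F i x\<bar> powr P \<le> w x" and "0 < e"
  shows "\<exists>i. Xnorm (ereal P) (\<lambda>x. f x - F i x) < e"
proof -
  have [measurable]: "F i \<in> borel_measurable (lebesgue_on {-pi..pi})" "f \<in> borel_measurable (lebesgue_on {-pi..pi})" for i
    using F f by (auto simp: Xspace_lp intro: borel_measurable_lebesgue_on)
  have "(\<lambda>i. lp_int P (\<lambda>x. f x - F i x)) \<longlonglongrightarrow> (\<integral>x. 0 \<partial>lebesgue_on {-pi..pi})"
    unfolding lp_int_def
  proof (rule integral_dominated_convergence[OF _ _ w(1)])
    show "AE x in lebesgue_on {-pi..pi}. (\<lambda>i. \<bar>f x - F i x\<bar> powr P) \<longlonglongrightarrow> 0"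
      using lim
    proof eventually_elim
      case (elim x)
      have "(\<lambda>i. \<bar>f x - F i x\<bar>) \<longlonglongrightarrow> \<bar>f x - f x\<bar>" by (intro tendsto_intros elim)
      then show ?case using P by (intro tendsto_zero_powrI[OF _ tendsto_const]) auto
    qed
  qed (use w(2) in auto)
  then have "\<forall>\<^sub>F i in sequentially. lp_int P (\<lambda>x. f x - F i x) < (e / 2) powr P"
    using \<open>0 < e\<close> by (intro order_tendstoD) auto
  then obtain i where "lp_int P (\<lambda>x. f x - F i x) < (e / 2) powr P"
    by (auto simp: eventually_sequentially)
  then have "Xnorm (ereal P) (\<lambda>x. f x - F i x) \<le> e / 2" using \<open>0 < e\<close> by (intro Xnorm_lp_le) auto
  then show ?thesis using \<open>0 < e\<close> by (intro exI[of _ i]) linarith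
qed

lemma lp_trig_dense:
  assumes f: "f \<in> Xspace (ereal P)" and e: "0 < e"
  shows "\<exists>M a b. Xnorm (ereal P) (\<lambda>x. f x - trig_poly M a b x) < e"
proof -
  have f': "periodic_2pi f" "f \<in> borel_measurable lebesgue" using f by (auto simp: Xspace_lp)
  define clamp where "clamp B y = max (- B) (min B y)" for B y :: real
  have clamp: "\<bar>clamp B y\<bar> \<le> B" if "0 \<le> B" for B y using that by (auto simp: clamp_def)
  \<comment> \<open>A function of \<open>L\<^sub>p\<close> is approximated by its truncations.\<close>
  define h where "h m x = clamp (real m) (f x)" for m x
  have hX: "h m \<in> Xspace (ereal P)" for m
  proof (rule bounded_in_Xspace_lp)
    show "periodic_2pi (h m)" using f'(1) by (simp add: periodic_2pi_def h_def)
    have [measurable]: "f \<in> borel_measurable lebesgue" by fact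
    show "h m \<in> borel_measurable lebesgue" unfolding h_def[abs_def] clamp_def by measurable
    show "\<bar>h m x\<bar> \<le> real m" for x unfolding h_def by (rule clamp) simp
  qed
  have "\<exists>m. Xnorm (ereal P) (\<lambda>x. f x - h m x) < e / 3"
  proof (rule dominated_small_lp[OF hX f])
    show "AE x in lebesgue_on {-pi..pi}. (\<lambda>m. h m x) \<longlonglongrightarrow> f x"
    proof (rule AE_I2)
      fix x
      obtain m0 where m0: "\<bar>f x\<bar> < real m0" using reals_Archimedean2 by blast
      have "f x = h m x" if "m0 \<le> m" for m
        using that m0 by (auto simp: h_def clamp_def)
      then show "(\<lambda>m. h m x) \<longlonglongrightarrow> f x"
        by (intro Lim_transform_eventually[OF tendsto_const] eventually_sequentiallyI)
    qed
    show "integrable (lebesgue_on {-pi..pi}) (\<lambda>x. \<bar>f x\<bar> powr P)" using f by (simp add: Xspace_lp)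
    show "\<bar>f x - h m x\<bar> powr P \<le> \<bar>f x\<bar> powr P" for m x
      using P by (intro powr_mono2) (auto simp: h_def clamp_def)
  qed (use e in simp)
  then obtain m where m: "Xnorm (ereal P) (\<lambda>x. f x - h m x) < e / 3" by blast
  \<comment> \<open>A truncated function is almost everywhere a limit of bounded continuous functions; the factor
    \<open>cut\<close> makes them vanish at \<open>\<plusminus>\<pi>\<close>, so that they extend periodically.\<close>
  have "h m measurable_on UNIV"
    using hX[of m] by (intro lebesgue_measurable_imp_measurable_on_real) (auto simp: Xspace_lp)
  then obtain Z G where Z: "negligible Z" and G: "\<And>k::nat. continuous_on UNIV (G k)"
    "\<And>x. x \<notin> Z \<Longrightarrow> (\<lambda>k. G k x) \<longlonglongrightarrow> h m x"
    unfolding measurable_on_def by auto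
  define cut where "cut k x = max 0 (min 1 (real k * (pi - \<bar>x\<bar>)))" for k x
  define H where "H k x = clamp (real m) (G k x) * cut k x" for k x
  have "\<forall>k. \<exists>E. periodic_2pi E \<and> continuous_on UNIV E \<and> (\<forall>x. - pi \<le> x \<longrightarrow> x < pi \<longrightarrow> E x = H k x) \<and> (\<forall>x. E x \<in> range (H k))"
  proof (rule allI, rule periodic_extension)
    fix k
    show "continuous_on UNIV (H k)"
      unfolding H_def cut_def clamp_def by (intro continuous_intros G)
    show "H k x = 0" if "pi \<le> \<bar>x\<bar>" for x
    proof -
      have "real k * (pi - \<bar>x\<bar>) \<le> 0" using that by (intro mult_nonneg_nonpos) auto
      then show ?thesis by (simp add: H_def cut_def)
    qed
  qed
  from choice[OF this] obtain E where "\<forall>k. periodic_2pi (E k) \<and> continuous_on UNIV (E k) \<and>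
    (\<forall>x. - pi \<le> x \<longrightarrow> x < pi \<longrightarrow> E k x = H k x) \<and> (\<forall>x. E k x \<in> range (H k))" ..
  then have E: "\<And>k. periodic_2pi (E k)" "\<And>k. continuous_on UNIV (E k)"
    "\<And>k x. - pi \<le> x \<Longrightarrow> x < pi \<Longrightarrow> E k x = H k x" "\<And>k x. E k x \<in> range (H k)" by simp_all
  have Hm: "\<bar>H k x\<bar> \<le> real m" for k x
  proof -
    have "0 \<le> cut k x" "cut k x \<le> 1" by (auto simp: cut_def)
    then have "\<bar>clamp (real m) (G k x)\<bar> * \<bar>cut k x\<bar> \<le> real m * 1"
      by (intro mult_mono clamp) auto
    then show ?thesis by (simp add: H_def abs_mult)
  qed
  have Em: "\<bar>E k x\<bar> \<le> real m" for k x using E(4)[of k x] Hm by auto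
  have EX: "E k \<in> Xspace (ereal P)" for k by (intro continuous_in_Xspace_lp E)
  interpret finite_measure "lebesgue_on {-pi..pi}" by (rule finite_measure_lebesgue_on) simp
  have "\<exists>k. Xnorm (ereal P) (\<lambda>x. h m x - E k x) < e / 3"
  proof (rule dominated_small_lp[OF EX hX])
    have "negligible (insert pi (insert (- pi) Z))" using Z by simp
    then have "AE x in lebesgue. x \<notin> insert pi (insert (- pi) Z)"
      by (intro AE_not_in) (simp only: negligible_iff_null_sets)
    then have "AE x in lebesgue. x \<in> {-pi..pi} \<longrightarrow> (\<lambda>k. E k x) \<longlonglongrightarrow> h m x"
    proof eventually_elim
      case (elim x)
      show ?case
      proof
        assume "x \<in> {-pi..pi}"
        with elim have x: "- pi < x" "x < pi" "x \<notin> Z" by auto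
        have "(\<lambda>k. clamp (real m) (G k x)) \<longlonglongrightarrow> clamp (real m) (h m x)"
          unfolding clamp_def by (intro tendsto_intros G x)
        moreover have "clamp (real m) (h m x) = h m x" by (auto simp: h_def clamp_def)
        moreover have "(\<lambda>k. cut k x) \<longlonglongrightarrow> 1"
        proof -
          have "0 < pi - \<bar>x\<bar>" using x by auto
          obtain k0 where k0: "1 / (pi - \<bar>x\<bar>) < real k0" using reals_Archimedean2 by blast
          have "1 = cut k x" if "k0 \<le> k" for k
          proof -
            have "1 / (pi - \<bar>x\<bar>) \<le> real k" using k0 that by (meson less_imp_le of_nat_le_iff order_trans)
            then have "1 \<le> real k * (pi - \<bar>x\<bar>)" using \<open>0 < pi - \<bar>x\<bar>\<close> by (simp add: pos_divide_le_eq)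
            then show ?thesis by (simp add: cut_def)
          qed
          then show ?thesis
            by (intro Lim_transform_eventually[OF tendsto_const] eventually_sequentiallyI)
        qed
        ultimately have "(\<lambda>k. clamp (real m) (G k x) * cut k x) \<longlonglongrightarrow> h m x * 1"
          by (intro tendsto_mult) auto
        then show "(\<lambda>k. E k x) \<longlonglongrightarrow> h m x" using E(3)[of x] x by (simp add: H_def)
      qed
    qed
    then show "AE x in lebesgue_on {-pi..pi}. (\<lambda>k. E k x) \<longlonglongrightarrow> h m x"
      by (subst AE_restrict_space_iff) simp_all
    show "integrable (lebesgue_on {-pi..pi}) (\<lambda>x. (2 * real m) powr P)" by simp
    show "\<bar>h m x - E k x\<bar> powr P \<le> (2 * real m) powr P" for k x
      using P clamp[of "real m" "f x"] Em[of k x] by (intro powr_mono2) (auto simp: h_def)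
  qed (use e in simp)
  then obtain k where k: "Xnorm (ereal P) (\<lambda>x. h m x - E k x) < e / 3" by blast
  define c where "c = (2 * pi) powr (1 / P)"
  have c: "0 < c" by (simp add: c_def)
  have "0 < e / (6 * c)" using e c by simp
  then obtain M a b where T: "\<And>x. \<bar>E k x - trig_poly M a b x\<bar> < e / (6 * c)"
    by (rule trig_weierstrass[OF E(1,2)]) blast
  have "trig_poly M a b \<in> Xspace (ereal P)"
  proof (rule continuous_in_Xspace_lp)
    show "periodic_2pi (trig_poly M a b)"
      using periodic_2pi_cos_sin by (simp add: periodic_2pi_def trig_poly_def)
    show "continuous_on UNIV (trig_poly M a b)"
      unfolding trig_poly_def by (intro continuous_intros)
  qed
  from Xspace_lp_add[OF EX Xspace_lp_scale[OF this, of "-1"]]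
  have d: "(\<lambda>x. E k x - trig_poly M a b x) \<in> Xspace (ereal P)" for k by simp
  have "Xnorm (ereal P) (\<lambda>x. E k x - trig_poly M a b x) \<le> e / (6 * c) * c"
    unfolding c_def using T by (intro uniform_small_lp d) (simp add: c_def less_imp_le)
  also have "\<dots> < e / 3" using c e by simp
  finally have 3: "Xnorm (ereal P) (\<lambda>x. E k x - trig_poly M a b x) < e / 3" .
  have fh: "(\<lambda>x. f x - h m x) \<in> Xspace (ereal P)" and hE: "(\<lambda>x. h m x - E k x) \<in> Xspace (ereal P)"
    using Xspace_lp_add[OF f Xspace_lp_scale[OF hX, of "-1"]] Xspace_lp_add[OF hX Xspace_lp_scale[OF EX, of "-1"]] by simp_all
  have "Xnorm (ereal P) (\<lambda>x. f x - trig_poly M a b x) < e"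
    using Xnorm_lp_add[OF fh Xspace_lp_add[OF hE d[of k]]] Xnorm_lp_add[OF hE d[of k]] m k 3 by simp
  then show ?thesis by blast
qed

lemma shift_invariant_seminorm_lp: "shift_invariant_seminorm (Xspace (ereal P)) (Xnorm (ereal P))"
proof
  show "(\<lambda>x. cos (real k * x)) \<in> Xspace (ereal P)" "(\<lambda>x. sin (real k * x)) \<in> Xspace (ereal P)" for k
    by (intro continuous_in_Xspace_lp periodic_2pi_cos_sin continuous_intros)+
qed (use Xspace_lp_add Xspace_lp_scale lp_shift Xnorm_lp_add Xnorm_lp_scale lp_trig_dense in \<open>auto simp: Xnorm_lp\<close>)

end

lemma shift_invariant_seminorm_Xspace:
  assumes "1 \<le> p"
  shows "shift_invariant_seminorm (Xspace p) (Xnorm p)"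
proof (cases p)
  case (real P)
  then show ?thesis using assms by (simp add: shift_invariant_seminorm_lp)
qed (use assms shift_invariant_seminorm_uniform in auto)

section \<open>The Jackson--Stechkin inequalities\<close>

lemma central_binomial_odd: "(2 * Suc j) choose (Suc j) = 2 * ((2 * j + 1) choose j)"
  using binomial_symmetric[of j "2 * j + 1"] by (simp add: numeral_2_eq_2)

context shift_invariant_seminorm
begin

lemma poly_jackson_mono:
  assumes "poly_jackson k n h c" "c \<le> c'"
  shows "poly_jackson k n h c'"
  unfolding poly_jackson_def
proof (intro allI impI)
  fix M a b \<omega> and \<epsilon> :: real
  assume *: "0 \<le> \<omega>" "0 < \<epsilon>" "\<forall>t. 0 < t \<longrightarrow> t \<le> h \<longrightarrow> N (fin_diff (2 * k) t (trig_poly M a b)) \<le> \<omega>"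
  obtain \<tau> where \<tau>: "\<tau> \<in> trig_polys (n - 1)"
    "N (\<lambda>x. trig_poly M a b x - \<tau> x) \<le> c * (\<omega> / real ((2 * k) choose k)) + \<epsilon>"
    using assms(1)[unfolded poly_jackson_def, rule_format, OF *(1,2)] *(3) by blast
  have "c * (\<omega> / real ((2 * k) choose k)) \<le> c' * (\<omega> / real ((2 * k) choose k))"
    using assms(2) *(1) by (intro mult_right_mono) auto
  with \<tau>(2) have "N (\<lambda>x. trig_poly M a b x - \<tau> x) \<le> c' * (\<omega> / real ((2 * k) choose k)) + \<epsilon>" by linarith
  then show "\<exists>\<tau>\<in>trig_polys (n - 1). N (\<lambda>x. trig_poly M a b x - \<tau> x) \<le> c' * (\<omega> / real ((2 * k) choose k)) + \<epsilon>"
    by (rule bexI[OF _ \<tau>(1)])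
qed

text \<open>
  Odd orders reduce to the next even one with the same constant: \<open>\<omega>\<^bsub>2k\<^esub> \<le> 2 \<omega>\<^bsub>2k-1\<^esub>\<close>, whereas
  \<open>gamma_star (2k)\<close> is half of \<open>gamma_star (2k-1)\<close>.
\<close>

lemma inf_approx_le:
  assumes J: "poly_jackson k n h c" "0 \<le> c" "0 < h" "0 < k" and r: "r = 2 * k \<or> Suc r = 2 * k" and f: "f \<in> X"
  shows "(INF \<tau>\<in>trig_polys (n - 1). N (\<lambda>x. f x - \<tau> x)) \<le> c * gamma_star r * (SUP t\<in>{0<..h}. N (fin_diff r t f))"
proof (rule field_le_epsilon)
  fix \<epsilon> :: real assume \<epsilon>: "0 < \<epsilon>"
  define \<omega> where "\<omega> = (SUP t\<in>{0<..h}. N (fin_diff r t f))"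
  have le: "N (fin_diff r t f) \<le> \<omega>" if "0 < t" "t \<le> h" for t
    unfolding \<omega>_def
  proof (rule cSUP_upper)
    show "bdd_above ((\<lambda>t. N (fin_diff r t f)) ` {0<..h})"
      using N_fin_diff_le[OF f] by (intro bdd_aboveI2) auto
  qed (use that in auto)
  have \<omega>0: "0 \<le> \<omega>" using le[of h] N_nonneg[OF X_fin_diff[OF f], of r h] J(3) by simp
  obtain \<omega>' where \<omega>': "0 \<le> \<omega>'" "\<And>t. 0 < t \<Longrightarrow> t \<le> h \<Longrightarrow> N (fin_diff (2 * k) t f) \<le> \<omega>'"
    "\<omega>' / real ((2 * k) choose k) = gamma_star r * \<omega>"
  proof (cases "r = 2 * k")
    case True
    then show ?thesis using that[of \<omega>] \<omega>0 le by (simp add: gamma_star_def)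
  next
    case False
    then have r: "2 * k = Suc r" using r by simp
    obtain j where j: "k = Suc j" using J(4) gr0_implies_Suc by blast
    have "r = 2 * j + 1" using r j by simp
    then have "gamma_star r = 2 / real ((2 * k) choose k)"
      unfolding j central_binomial_odd by (simp add: gamma_star_def)
    moreover have "N (fin_diff (2 * k) t f) \<le> 2 * \<omega>" if "0 < t" "t \<le> h" for t
      unfolding r using N_fin_diff_Suc_le[OF f, of r t] le[OF that] by linarith
    ultimately show ?thesis using that[of "2 * \<omega>"] \<omega>0 by simp
  qed
  obtain \<tau> where \<tau>: "\<tau> \<in> trig_polys (n - 1)" "N (\<lambda>x. f x - \<tau> x) \<le> c * (gamma_star r * \<omega>) + \<epsilon>"
    using approximants_of_poly_jackson[OF J(1,2) f \<epsilon> \<omega>'(1,2)] unfolding \<omega>'(3) by blast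
  have "(INF \<tau>\<in>trig_polys (n - 1). N (\<lambda>x. f x - \<tau> x)) \<le> N (\<lambda>x. f x - \<tau> x)"
  proof (rule cINF_lower[OF _ \<tau>(1)])
    have "\<tau> \<in> X" if "\<tau> \<in> trig_polys (n - 1)" for \<tau>
    proof -
      have "\<exists>a b. \<tau> = trig_poly (n - 1) a b" using that by (simp add: trig_polys_def trig_poly_def)
      then show ?thesis using X_trig_poly by blast
    qed
    then show "bdd_below ((\<lambda>\<tau>. N (\<lambda>x. f x - \<tau> x)) ` trig_polys (n - 1))"
      using N_nonneg[OF X_diff[OF f]] by (intro bdd_belowI2[where m = 0]) blast
  qed
  also note \<tau>(2)
  finally show "(INF \<tau>\<in>trig_polys (n - 1). N (\<lambda>x. f x - \<tau> x)) \<le> c * gamma_star r * (SUP t\<in>{0<..h}. N (fin_diff r t f)) + \<epsilon>"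
    by (simp add: \<omega>_def)
qed

end

lemma jackson_stechkinI:
  assumes "\<And>X N n. shift_invariant_seminorm X N \<Longrightarrow> 0 < n \<Longrightarrow>
      shift_invariant_seminorm.poly_jackson N k n (a * pi / real n) c"
    and "0 \<le> c" "0 < a" "0 < k" "r = 2 * k \<or> Suc r = 2 * k"
  shows "jackson_stechkin r a c"
  unfolding jackson_stechkin_def best_approx_def mod_smooth_def
proof (intro allI impI)
  fix p :: ereal and n :: nat and f
  assume p: "1 \<le> p" and n: "1 \<le> n" and f: "f \<in> Xspace p"
  interpret shift_invariant_seminorm "Xspace p" "Xnorm p" by (rule shift_invariant_seminorm_Xspace[OF p])
  have "poly_jackson k n (a * pi / real n) c"
    using assms(1)[OF shift_invariant_seminorm_axioms, of n] n by simp
  then show "(INF \<tau>\<in>trig_polys (n - 1). Xnorm p (\<lambda>x. f x - \<tau> x)) \<le>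
      c * gamma_star r * (SUP h\<in>{0<..a * pi / real n}. Xnorm p (fin_diff r h f))"
    by (rule inf_approx_le) (use assms n f in auto)
qed

lemma jackson_stechkin_general:
  assumes "0 < r" "0 < \<alpha>" "8 * odd_ratio_sum ((r + 1) div 2) \<le> q * (\<alpha> ^ 2 * pi ^ 2)" "q < 1" "(1 + q) / (1 - q) \<le> c" "0 \<le> c"
  shows "jackson_stechkin r \<alpha> c"
proof (rule jackson_stechkinI)
  fix X N and n :: nat
  assume "shift_invariant_seminorm X N" "0 < n"
  then interpret shift_invariant_seminorm X N by simp
  show "poly_jackson ((r + 1) div 2) n (\<alpha> * pi / real n) c"
    by (rule poly_jackson_mono[OF poly_jackson_general assms(5)]) (use assms \<open>0 < n\<close> in auto)
qed (use assms in auto)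

lemma eight_odd_ratio_sum_le: "8 * odd_ratio_sum k \<le> pi ^ 2"
proof (cases "k = 0")
  case False
  then have "odd_ratio_sum k \<le> pi ^ 2 / 8 - 1 / (8 * sqrt (real k))" by (intro odd_ratio_sum_le) simp
  moreover have "0 \<le> 1 / (8 * sqrt (real k))" by simp
  ultimately show ?thesis by linarith
qed (simp add: odd_ratio_sum_def)

text \<open>
  At the critical step \<open>\<pi> / n\<close> the Neumann series converges only because the binomial ratios are
  smaller than \<open>1\<close>; the gap \<open>1 - q\<close> is at least of order \<open>1 / \<surd>r\<close>, and the constant is at
  most twice its reciprocal.
\<close>

lemma jackson_stechkin_critical:
  assumes "0 < r"
  shows "jackson_stechkin r 1 (2 * pi ^ 2 * sqrt (real r))"
proof -
  define k where "k = (r + 1) div 2"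
  have k: "0 < k" "k \<le> r" using assms by (auto simp: k_def)
  define s where "s = sqrt (real k)"
  have s: "0 < s" "s \<le> sqrt (real r)" using k by (simp_all add: s_def)
  define q where "q = 1 - 1 / (pi ^ 2 * s)"
  have q1: "q < 1" using s by (simp add: q_def)
  have "8 * odd_ratio_sum k \<le> pi ^ 2 - 1 / s"
    using odd_ratio_sum_le[OF k(1)] by (simp add: s_def field_simps)
  also have "\<dots> = q * (1 ^ 2 * pi ^ 2)" using s by (simp add: q_def field_simps)
  finally have q: "8 * odd_ratio_sum k \<le> q * (1 ^ 2 * pi ^ 2)" .
  have "(1 + q) / (1 - q) \<le> 2 / (1 - q)" using q1 by (intro divide_right_mono) auto
  also have "\<dots> = 2 * pi ^ 2 * s" using s by (simp add: q_def)
  also have "\<dots> \<le> 2 * pi ^ 2 * sqrt (real r)" using s by (intro mult_left_mono) auto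
  finally show ?thesis using assms q q1 unfolding k_def by (intro jackson_stechkin_general[of r 1 q]) auto
qed

theorem theorem5:
  shows "(\<forall>r\<ge>1. jackson_stechkin r 2 5)
    \<and> (\<forall>\<alpha>>1. \<exists>c. \<forall>r\<ge>1. jackson_stechkin r \<alpha> c)
    \<and> (\<exists>c :: nat \<Rightarrow> real. c \<in> O(\<lambda>r. sqrt (real r) * ln (real r)) \<and>
         (\<forall>r\<ge>1. jackson_stechkin r 1 (c r)))
    \<and> (\<forall>r\<in>{1, 2}. jackson_stechkin r 1 (5 / 4))
    \<and> (\<forall>r\<in>{3, 4}. jackson_stechkin r 1 (27 / 10))
    \<and> (\<forall>r\<in>{1, 2}. jackson_stechkin r 2 (17 / 16))
    \<and> (\<forall>r\<in>{3, 4}. jackson_stechkin r 2 (10 / 9))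
    \<and> (\<forall>r\<in>{5, 6}. jackson_stechkin r 2 (3 / 2))"
proof (intro conjI)
  show "\<forall>r\<ge>1. jackson_stechkin r 2 5"
  proof (intro allI impI)
    fix r :: nat assume "1 \<le> r"
    then show "jackson_stechkin r 2 5"
      using eight_odd_ratio_sum_le[of "(r + 1) div 2"]
      by (intro jackson_stechkin_general[where q = "1 / 4"]) auto
  qed
  show "\<forall>\<alpha>>1. \<exists>c. \<forall>r\<ge>1. jackson_stechkin r \<alpha> c"
  proof (intro allI impI)
    fix \<alpha> :: real assume \<alpha>: "1 < \<alpha>"
    define q where "q = 1 / \<alpha> ^ 2"
    have q: "0 < q" "q < 1" "q * \<alpha> ^ 2 = 1" using \<alpha> by (simp_all add: q_def power_strict_mono one_less_power)
    have "jackson_stechkin r \<alpha> ((1 + q) / (1 - q))" if "1 \<le> r" for r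
    proof (rule jackson_stechkin_general[where q = q])
      show "8 * odd_ratio_sum ((r + 1) div 2) \<le> q * (\<alpha> ^ 2 * pi ^ 2)"
        unfolding mult.assoc[symmetric] q(3) using eight_odd_ratio_sum_le by simp
    qed (use \<alpha> q that in auto)
    then show "\<exists>c. \<forall>r\<ge>1. jackson_stechkin r \<alpha> c" by blast
  qed
  show "\<exists>c :: nat \<Rightarrow> real. c \<in> O(\<lambda>r. sqrt (real r) * ln (real r)) \<and> (\<forall>r\<ge>1. jackson_stechkin r 1 (c r))"
  proof (intro exI conjI)
    show "(\<lambda>r. 2 * pi ^ 2 * sqrt (real r)) \<in> O(\<lambda>r. sqrt (real r) * ln (real r))"
    proof (rule bigoI)
      show "\<forall>\<^sub>F r in sequentially. norm (2 * pi ^ 2 * sqrt (real r)) \<le> 2 * pi ^ 2 * norm (sqrt (real r) * ln (real r))"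
      proof (rule eventually_sequentiallyI)
        fix r :: nat assume "3 \<le> r"
        then have "exp 1 \<le> real r" using exp_le by linarith
        then have "1 \<le> ln (real r)" using \<open>3 \<le> r\<close> by (simp add: ln_ge_iff)
        then have "sqrt (real r) * 1 \<le> sqrt (real r) * ln (real r)" by (intro mult_left_mono) auto
        then show "norm (2 * pi ^ 2 * sqrt (real r)) \<le> 2 * pi ^ 2 * norm (sqrt (real r) * ln (real r))"
          using \<open>1 \<le> ln (real r)\<close> by (simp add: abs_mult)
      qed
    qed
    show "\<forall>r\<ge>1. jackson_stechkin r 1 (2 * pi ^ 2 * sqrt (real r))"
      using jackson_stechkin_critical by simp
  qed
  have J2: "jackson_stechkin r \<alpha> (1 + 1 / (4 * \<alpha> ^ 2))" if "r \<in> {1, 2}" "0 < \<alpha>" for r \<alpha>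
    by (rule jackson_stechkinI[where k = 1, OF shift_invariant_seminorm.poly_jackson_2])
      (use that in \<open>auto intro: add_nonneg_nonneg\<close>)
  show "\<forall>r\<in>{1, 2}. jackson_stechkin r 1 (5 / 4)" using J2[of _ 1] by simp
  show "\<forall>r\<in>{1, 2}. jackson_stechkin r 2 (17 / 16)" using J2[of _ 2] by simp
  have J4: "jackson_stechkin r \<alpha> c" if "r \<in> {3, 4}" "0 < \<alpha>" "1 + 325 / (192 * \<alpha> ^ 4) \<le> c" "0 \<le> c" for r \<alpha> c
    by (rule jackson_stechkinI[where k = 2, OF shift_invariant_seminorm.poly_jackson_mono[OF _
          shift_invariant_seminorm.poly_jackson_4 that(3)]])
      (use that in auto)
  show "\<forall>r\<in>{3, 4}. jackson_stechkin r 1 (27 / 10)" by (intro ballI J4) auto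
  show "\<forall>r\<in>{3, 4}. jackson_stechkin r 2 (10 / 9)" by (intro ballI J4) auto
  show "\<forall>r\<in>{5, 6}. jackson_stechkin r 2 (3 / 2)"
  proof
    fix r :: nat assume r: "r \<in> {5, 6}"
    then have "(r + 1) div 2 = 3" by auto
    moreover have "odd_ratio_sum 3 = 3 / 4 + 1 / 180"
      by (simp add: odd_ratio_sum_def binomial_ratio_def eval_nat_numeral)
    moreover have "3 ^ 2 \<le> pi ^ 2" using pi_gt3 by (intro power_mono) auto
    ultimately show "jackson_stechkin r 2 (3 / 2)"
      using r by (intro jackson_stechkin_general[where q = "1 / 5"]) auto
  qed
qed

end
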